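(* \[\sup\big\{\|\log(\exp(A)\exp(B))\|_2:\ A,B\in M_2(\mathbb R),\ \|A\|_2\le\tfrac\pi2,\ \|B\|_2\le\tfrac\pi2,\ (A,B)\notin\{(\tfrac\pi2\tilde I,\tfrac\pi2\tilde I),(-\tfrac\pi2\tilde I,-\tfrac\pi2\tilde I)\}\big\}=\frac\pi2e^{\pi/2},\] where all logarithms occurring are well defined.
   Context: $\tilde I=\begin{pmatrix}0&-1\\1&0\end{pmatrix}$; $\|\cdot\|_2$ is the operator norm; $\log$ the principal matrix logarithm. *)

theory Defs
  imports "HOL-Analysis.Analysis"
begin

type_synonym mat2 = "real^2^2"

primrec mpow :: "real^'n^'n \<Rightarrow> nat \<Rightarrow> real^'n^'n" where
  "mpow A 0 = mat 1"
| "mpow A (Suc k) = A ** mpow A k"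

definition mexp :: "real^'n^'n \<Rightarrow> real^'n^'n" where
  "mexp A = (\<Sum>k. (1 / fact k) *\<^sub>R mpow A k)"

definition opnorm :: "real^'n^'n \<Rightarrow> real" where
  "opnorm A = onorm (\<lambda>x. A *v x)"

definition cplx_eigenvalue :: "real^'n^'n \<Rightarrow> complex \<Rightarrow> bool" where
  "cplx_eigenvalue A z \<longleftrightarrow>
     det ((\<chi> i j. (if i = j then z else 0) - complex_of_real (A $ i $ j)) :: complex^'n^'n) = 0"

definition is_principal_log :: "real^'n^'n \<Rightarrow> real^'n^'n \<Rightarrow> bool" where
  "is_principal_log M L \<longleftrightarrow> mexp L = M \<and> (\<forall>z. cplx_eigenvalue L z \<longrightarrow> \<bar>Im z\<bar> < pi)"

definition mlog :: "real^'n^'n \<Rightarrow> real^'n^'n" where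
  "mlog M = (THE L. is_principal_log M L)"

definition Itilde :: mat2 where
  "Itilde = vector [vector [0, -1], vector [1, 0]]"

end

theory Submission
  imports Defs
begin

text \<open>
  Identify \<open>real^2\<close> with the complex plane and write a real matrix as \<open>z \<mapsto> \<alpha> z + \<beta> cnj z\<close>; its operator norm is
  \<open>|\<alpha>| + |\<beta>|\<close>. Up to a positive factor the exponential of such a matrix is \<open>z \<mapsto> u z + v cnj z\<close> with
  \<open>|u|\<^sup>2 - |v|\<^sup>2 = 1\<close>, and the product of two of them has complex-linear part \<open>U\<close> in the disc around \<open>u1 u2\<close> of radius
  \<open>|v1| |v2|\<close>. The norm of the logarithm of a matrix of determinant one depends only on \<open>U\<close>, so the
  theorem says that these discs stay in an explicit region.

  The region of a single factor is replaced by the half-space \<open>|v| \<le> T (1 + Re u - |Im u|)\<close>, \<open>T = tanh (\<pi>/4)\<close>,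
  whose boundary plane contains both extremal exponentials \<open>exp (\<pi>/2 Itilde)\<close> and \<open>exp (\<pi>/2 diag (1, -1))\<close>; this
  is the concavity of \<open>\<phi> cot (\<phi>/2)\<close> as a function of \<open>\<phi>\<^sup>2\<close>. The plane cuts the hyperboloid
  \<open>|u|\<^sup>2 - |v|\<^sup>2 = 1\<close> in a conic, and bounding a linear functional of \<open>U\<close> over all pairs of factors becomes
  a biaffine problem on pairs of points of that conic. It follows that the product satisfies
  \<open>|V| \<le> T (1 + Re U + |Im U|)\<close> if \<open>Re U \<le> 0\<close> and \<open>|Im U| \<le> cosh (\<pi>/2) + 0.76 Re U\<close> always, and both
  are enough for the bound, with equality at \<open>(\<pi>/2 Itilde, \<pi>/2 diag (1, -1))\<close>. A nonzero trace makes a factor satisfy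
  its inequality even after a rotation of \<open>u\<close> by \<open>(Re \<alpha>)\<^sup>2 / 10\<close>, and this gain outweighs the contribution of
  the traces to the norm of the logarithm.
\<close>

section \<open>Exponential and logarithm of real two-by-two matrices\<close>

text \<open>A factor is recorded by the point \<open>(Re u, 1 - |Im u|)\<close>: the rotations
  \<open>exp (\<plusminus> pi/2 Itilde)\<close> sit at (0, 0), the identity at (1, 1),
  \<open>exp (pi/2 diag (1, -1))\<close> at (cosh (pi/2), 1). The target
  \<open>|V| \<le> T (1 + Re U + |Im U|)\<close> is the half-space condition of one factor carried
  over by multiplication with \<i> or -\<i>: no pair does worse than an extremal rotation times one
  factor. Hence the relaxed problem is tight along a whole arc, from U = -1, which only the excluded
  pairs reach and where the logarithm breaks down, to U = \<i> cosh (pi/2), where the supremum is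
  attained. Let L be half the trace of the logarithm and Z, W the moduli of its imaginary and
  antilinear parts. The norm is \<open>sqrt (L^2 + Z^2) + W\<close> with
  \<open>Z^2 - W^2 = q\<close>, so for L = 0 all is governed by the single number Z + W. At the
  extremal point a trace costs a multiple of L^2, so the compensating gain must be of the same
  order: angles a^2/10 for the half-traces a of the factors add up to at least L^2/20.\<close>

text \<open>The matrix of \<open>z \<mapsto> \<alpha> z + \<beta> cnj z\<close> in the real basis \<open>1, \<i>\<close>.\<close>

definition cmat :: "complex \<Rightarrow> complex \<Rightarrow> mat2" where
  "cmat \<alpha> \<beta> = vector [vector [Re \<alpha> + Re \<beta>, Im \<beta> - Im \<alpha>], vector [Im \<alpha> + Im \<beta>, Re \<alpha> - Re \<beta>]]"

lemma mat2_eq_iff: "A = B \<longleftrightarrow> A $ 1 $ 1 = B $ 1 $ 1 \<and> A $ 1 $ 2 = B $ 1 $ 2 \<and> A $ 2 $ 1 = B $ 2 $ 1 \<and> A $ 2 $ 2 = B $ 2 $ 2"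
  for A B :: mat2
  by (auto simp: vec_eq_iff forall_2)

lemma cmat_nth [simp]:
  "cmat \<alpha> \<beta> $ 1 $ 1 = Re \<alpha> + Re \<beta>" "cmat \<alpha> \<beta> $ 1 $ 2 = Im \<beta> - Im \<alpha>"
  "cmat \<alpha> \<beta> $ 2 $ 1 = Im \<alpha> + Im \<beta>" "cmat \<alpha> \<beta> $ 2 $ 2 = Re \<alpha> - Re \<beta>"
  by (simp_all add: cmat_def)

lemma cmat_exhaust: obtains \<alpha> \<beta> where "A = cmat \<alpha> \<beta>"
proof
  show "A = cmat (Complex ((A$1$1 + A$2$2)/2) ((A$2$1 - A$1$2)/2)) (Complex ((A$1$1 - A$2$2)/2) ((A$2$1 + A$1$2)/2))"
    by (simp add: mat2_eq_iff field_simps)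
qed

lemma cmat_inject [simp]: "cmat \<alpha> \<beta> = cmat \<alpha>' \<beta>' \<longleftrightarrow> \<alpha> = \<alpha>' \<and> \<beta> = \<beta>'"
  by (auto simp: mat2_eq_iff complex_eq_iff)

lemma cmat_mult: "cmat \<alpha> \<beta> ** cmat \<gamma> \<delta> = cmat (\<alpha> * \<gamma> + \<beta> * cnj \<delta>) (\<alpha> * \<delta> + \<beta> * cnj \<gamma>)"
  by (simp add: mat2_eq_iff matrix_matrix_mult_def sum_2 algebra_simps)

lemma cmat_scaleR: "r *\<^sub>R cmat \<alpha> \<beta> = cmat (of_real r * \<alpha>) (of_real r * \<beta>)"
  by (simp add: mat2_eq_iff algebra_simps)

lemma mat_1_eq_cmat: "mat 1 = cmat 1 0"
  by (simp add: mat2_eq_iff mat_def)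

lemma Itilde_eq_cmat: "Itilde = cmat \<i> 0"
  by (simp add: mat2_eq_iff Itilde_def)

section \<open>Operator norm in complex coordinates\<close>

lemma norm_real2: "norm (x :: real^2) = cmod (Complex (x $ 1) (x $ 2))"
  by (simp add: norm_vec_def L2_set_def sum_2 cmod_def)

lemma norm_cmat_mult_vec:
  "norm (cmat \<alpha> \<beta> *v x) = cmod (\<alpha> * Complex (x $ 1) (x $ 2) + \<beta> * cnj (Complex (x $ 1) (x $ 2)))"
proof -
  have "Complex ((cmat \<alpha> \<beta> *v x) $ 1) ((cmat \<alpha> \<beta> *v x) $ 2)
      = \<alpha> * Complex (x $ 1) (x $ 2) + \<beta> * cnj (Complex (x $ 1) (x $ 2))"
    by (simp add: complex_eq_iff matrix_vector_mult_def sum_2 algebra_simps)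
  then show ?thesis
    by (simp only: norm_real2)
qed

text \<open>A square root z of the phase of \<open>\<beta> * cnj \<alpha>\<close> makes
  \<open>\<alpha> * z\<close> and \<open>\<beta> * cnj z\<close> point in the same
  direction.\<close>

lemma exists_unit_aligned:
  fixes \<alpha> \<beta> :: complex
  shows "\<exists>z. cmod z = 1 \<and> cmod (\<alpha> * z + \<beta> * cnj z) = cmod \<alpha> + cmod \<beta>"
proof (cases "\<alpha> = 0 \<or> \<beta> = 0")
  case True
  then show ?thesis
    by (intro exI[of _ 1]) auto
next
  case False
  define w where "w = (\<beta> * cnj \<alpha>) / of_real (cmod \<beta> * cmod \<alpha>)"
  define z where "z = csqrt w"
  have w1: "cmod w = 1"
    using False by (simp add: w_def norm_divide norm_mult)
  have z2: "z * z = w"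
    unfolding z_def by (metis power2_csqrt power2_eq_square)
  have z1: "cmod z = 1"
    using z2 w1 by (metis norm_ge_zero norm_mult power2_eq_square power2_eq_1_iff power_one real_sqrt_abs real_sqrt_one abs_of_nonneg)
  have zz: "z * cnj z = 1"
    using z1 by (simp add: complex_norm_square[symmetric])
  have "cmod (\<alpha> * z + \<beta> * cnj z) = cmod ((\<alpha> * z + \<beta> * cnj z) * z)"
    by (simp add: norm_mult z1)
  also have "(\<alpha> * z + \<beta> * cnj z) * z = \<alpha> * (z * z) + \<beta> * (z * cnj z)"
    by (simp add: algebra_simps)
  also have "\<dots> = \<alpha> * w + \<beta>"
    by (simp add: z2 zz)
  also have "\<dots> = \<beta> * of_real (1 + cmod \<alpha> / cmod \<beta>)"
  proof -
    have "\<alpha> * cnj \<alpha> = of_real (cmod \<alpha>) * of_real (cmod \<alpha>)"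
      by (simp add: complex_norm_square[symmetric] power2_eq_square[symmetric])
    moreover have "\<alpha> * w = \<beta> * (\<alpha> * cnj \<alpha>) / of_real (cmod \<beta> * cmod \<alpha>)"
      by (simp add: w_def mult.left_commute)
    ultimately have "\<alpha> * w = \<beta> * (of_real (cmod \<alpha>) * of_real (cmod \<alpha>)) / of_real (cmod \<beta> * cmod \<alpha>)"
      by simp
    also have "\<dots> = \<beta> * of_real (cmod \<alpha> / cmod \<beta>)"
      using False by (simp add: field_simps)
    finally show ?thesis
      by (simp add: algebra_simps)
  qed
  also have "cmod \<dots> = cmod \<beta> * \<bar>1 + cmod \<alpha> / cmod \<beta>\<bar>"
    by (simp only: norm_mult norm_of_real)
  also have "\<dots> = cmod \<alpha> + cmod \<beta>"
    using False by (simp add: field_simps abs_of_nonneg)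
  finally show ?thesis
    using z1 by blast
qed

lemma opnorm_cmat: "opnorm (cmat \<alpha> \<beta>) = cmod \<alpha> + cmod \<beta>"
proof (rule antisym)
  have "norm (cmat \<alpha> \<beta> *v x) \<le> (cmod \<alpha> + cmod \<beta>) * norm x" for x
    unfolding norm_cmat_mult_vec unfolding norm_real2
    by (rule norm_triangle_le) (simp add: norm_mult algebra_simps)
  then show "opnorm (cmat \<alpha> \<beta>) \<le> cmod \<alpha> + cmod \<beta>"
    unfolding opnorm_def by (rule onorm_le)
next
  obtain z where z: "cmod z = 1" "cmod (\<alpha> * z + \<beta> * cnj z) = cmod \<alpha> + cmod \<beta>"
    using exists_unit_aligned by blast
  define x :: "real^2" where "x = vector [Re z, Im z]"
  have x: "Complex (x $ 1) (x $ 2) = z"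
    by (simp add: x_def)
  have "norm (cmat \<alpha> \<beta> *v x) \<le> opnorm (cmat \<alpha> \<beta>) * norm x"
    unfolding opnorm_def by (rule onorm) simp
  then show "cmod \<alpha> + cmod \<beta> \<le> opnorm (cmat \<alpha> \<beta>)"
    unfolding norm_cmat_mult_vec unfolding norm_real2 x by (simp add: z)
qed

text \<open>Entire functions of \<open>q\<close>: the cosine and the cardinal sine of \<open>sqrt q\<close>, continued to negative \<open>q\<close>.\<close>

definition csq :: "real \<Rightarrow> real" where
  "csq q = (if q \<ge> 0 then cos (sqrt q) else cosh (sqrt (- q)))"

definition snq :: "real \<Rightarrow> real" where
  "snq q = (if q > 0 then sin (sqrt q) / sqrt q else if q = 0 then 1 else sinh (sqrt (- q)) / sqrt (- q))"

text \<open>For \<open>q = (Im \<alpha>)^2 - |\<beta>|^2\<close> this makes the determinant of the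
  exponential of a trace-free matrix equal to one.\<close>

lemma csq_snq_pythagoras: "(csq q)\<^sup>2 + q * (snq q)\<^sup>2 = 1"
proof -
  consider "q > 0" | "q = 0" | "q < 0" by linarith
  then show ?thesis
  proof cases
    case 1
    then show ?thesis
      by (simp add: csq_def snq_def power_divide)
  next
    case 2
    then show ?thesis
      by (simp add: csq_def)
  next
    case 3
    then have "q * (sinh (sqrt (- q)) / sqrt (- q))\<^sup>2 = - (sinh (sqrt (- q)))\<^sup>2"
      by (simp add: power_divide field_simps)
    then show ?thesis
      using 3 cosh_square_eq[of "sqrt (- q)"] by (simp add: csq_def snq_def)
  qed
qed

text \<open>The square of the trace-free part N is the scalar \<open>- (b^2 - |\<beta>|^2)\<close>,
  so all powers of \<open>a + N\<close> stay in the span of 1 and N; \<open>p\<close> and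
  \<open>q\<close> are their coordinates.\<close>

lemma mpow_cmat:
  fixes a b :: real and \<beta> :: complex and p q :: "nat \<Rightarrow> real"
  assumes "p 0 = 1" "q 0 = 0"
    and p: "\<And>n. p (Suc n) = a * p n - (b\<^sup>2 - (cmod \<beta>)\<^sup>2) * q n"
    and q: "\<And>n. q (Suc n) = p n + a * q n"
  shows "mpow (cmat (Complex a b) \<beta>) n = cmat (Complex (p n) (q n * b)) (of_real (q n) * \<beta>)"
proof (induction n)
  case 0
  then show ?case
    using assms by (simp add: mat_1_eq_cmat complex_eq_iff)
next
  case (Suc n)
  have "\<beta> * cnj (of_real (q n) * \<beta>) = of_real (q n * (cmod \<beta>)\<^sup>2)"
    by (simp add: complex_norm_square[symmetric] mult.left_commute)
  then show ?case
    by (simp add: Suc cmat_mult p q complex_eq_iff algebra_simps power2_eq_square)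
qed

lemma mexp_cmat_sums:
  fixes a b :: real and \<beta> :: complex and p q :: "nat \<Rightarrow> real"
  assumes "p 0 = 1" "q 0 = 0"
    and "\<And>n. p (Suc n) = a * p n - (b\<^sup>2 - (cmod \<beta>)\<^sup>2) * q n"
    and "\<And>n. q (Suc n) = p n + a * q n"
    and P: "(\<lambda>n. p n / fact n) sums P" and Q: "(\<lambda>n. q n / fact n) sums Q"
  shows "mexp (cmat (Complex a b) \<beta>) = cmat (Complex P (Q * b)) (of_real Q * \<beta>)"
proof -
  have eq: "(1 / fact n) *\<^sub>R mpow (cmat (Complex a b) \<beta>) n
      = (p n / fact n) *\<^sub>R cmat 1 0 + (q n / fact n) *\<^sub>R cmat (Complex 0 b) \<beta>" for n
    by (subst mpow_cmat[of p q, OF assms(1-4)])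
       (simp add: mat2_eq_iff field_simps)
  have "(\<lambda>n. (1 / fact n) *\<^sub>R mpow (cmat (Complex a b) \<beta>) n) sums
      (P *\<^sub>R cmat 1 0 + Q *\<^sub>R cmat (Complex 0 b) \<beta>)"
    unfolding eq by (intro sums_add sums_scaleR_left P Q)
  moreover have "P *\<^sub>R cmat 1 0 + Q *\<^sub>R cmat (Complex 0 b) \<beta> = cmat (Complex P (Q * b)) (of_real Q * \<beta>)"
    by (simp add: mat2_eq_iff algebra_simps)
  ultimately show ?thesis
    unfolding mexp_def by (simp add: sums_iff)
qed

text \<open>The eigenvalues are \<open>a \<plusminus> sqrt (- r)\<close>. According to the sign of
  r, the coordinates of the powers come from \<open>(a + \<i> w)^n\<close>, from \<open>a^n\<close>
  and its derivative in a, or from \<open>(a \<plusminus> w)^n\<close>, where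
  \<open>w^2 = |r|\<close>.\<close>

lemma mexp_cmat:
  fixes a b :: real and \<beta> :: complex
  defines "r \<equiv> b\<^sup>2 - (cmod \<beta>)\<^sup>2"
  shows "mexp (cmat (Complex a b) \<beta>)
    = cmat (of_real (exp a) * Complex (csq r) (snq r * b)) (of_real (exp a) * (of_real (snq r) * \<beta>))"
proof -
  have *: ?thesis if "p 0 = 1" "q 0 = 0" "\<And>n. p (Suc n) = a * p n - r * q n" "\<And>n. q (Suc n) = p n + a * q n"
    "(\<lambda>n. p n / fact n) sums (exp a * csq r)" "(\<lambda>n. q n / fact n) sums (exp a * snq r)" for p q
  proof -
    have "mexp (cmat (Complex a b) \<beta>) = cmat (Complex (exp a * csq r) (exp a * snq r * b)) (of_real (exp a * snq r) * \<beta>)"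
      by (rule mexp_cmat_sums[of p q]) (use that in \<open>simp_all add: r_def\<close>)
    then show ?thesis
      by (simp add: complex_eq_iff)
  qed
  have exp_sums: "(\<lambda>n. z ^ n / fact n) sums exp z" for z :: real
    using exp_converges[of z] by (simp add: divide_inverse mult.commute)
  consider "r > 0" | "r = 0" | "r < 0" by linarith
  then show ?thesis
  proof cases
    case 1
    define w where "w = sqrt r"
    have w: "w > 0" "w * w = r"
      using 1 by (simp_all add: w_def)
    define z where "z = Complex a w"
    have z: "(\<lambda>n. z ^ n /\<^sub>R fact n) sums exp z"
      by (rule exp_converges)
    have "(\<lambda>n. Re (z ^ n) / fact n) sums (exp a * csq r)"
      using sums_Re[OF z] 1 by (simp add: z_def Re_exp csq_def w_def divide_inverse mult.commute)
    moreover have "(\<lambda>n. Im (z ^ n) / w / fact n) sums (exp a * snq r)"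
      using sums_divide[OF sums_Im[OF z], of w] 1
      by (simp add: z_def Im_exp snq_def w_def divide_inverse mult.commute mult.left_commute)
    ultimately show ?thesis
      using w by (intro *[of "\<lambda>n. Re (z ^ n)" "\<lambda>n. Im (z ^ n) / w"]) (auto simp: z_def field_simps)
  next
    case 2
    have "(\<lambda>n. real (Suc n) * a ^ n / fact (Suc n)) sums exp a"
      using exp_sums[of a] by (simp del: of_nat_Suc)
    then have "(\<lambda>n. real n * a ^ (n - 1) / fact n) sums exp a"
      using sums_Suc_iff[of "\<lambda>n. real n * a ^ (n - 1) / fact n" "exp a"] by (simp del: of_nat_Suc fact_Suc)
    moreover have "real (Suc n) * a ^ (Suc n - 1) = a ^ n + a * (real n * a ^ (n - 1))" for n
      by (cases n) (auto simp: algebra_simps)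
    moreover have "csq r = 1" "snq r = 1"
      using 2 by (auto simp: csq_def snq_def)
    ultimately show ?thesis
      using exp_sums[of a] by (intro *[of "\<lambda>n. a ^ n" "\<lambda>n. real n * a ^ (n - 1)"])
        (simp_all only: power_0 of_nat_0 mult_zero_left 2 diff_zero power_Suc mult_1_right)
  next
    case 3
    define w where "w = sqrt (- r)"
    have w: "w > 0" "w * w = - r"
      using 3 by (simp_all add: w_def)
    then have r_eq: "r = - (w * w)"
      by simp
    have "(\<lambda>n. ((a + w) ^ n / fact n + (a - w) ^ n / fact n) / 2) sums ((exp (a + w) + exp (a - w)) / 2)"
      by (intro sums_divide sums_add exp_sums)
    moreover have "(exp (a + w) + exp (a - w)) / 2 = exp a * csq r"
      using 3 by (simp add: csq_def w_def cosh_def exp_add exp_diff exp_minus field_simps)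
    moreover have "(\<lambda>n. ((a + w) ^ n / fact n - (a - w) ^ n / fact n) / (2 * w)) sums ((exp (a + w) - exp (a - w)) / (2 * w))"
      by (intro sums_divide sums_diff exp_sums)
    moreover have "(exp (a + w) - exp (a - w)) / (2 * w) = exp a * snq r"
      using 3 by (simp add: snq_def w_def sinh_def exp_add exp_diff exp_minus field_simps)
    moreover have "((a + w) ^ Suc n + (a - w) ^ Suc n) / 2
        = a * (((a + w) ^ n + (a - w) ^ n) / 2) - r * (((a + w) ^ n - (a - w) ^ n) / (2 * w))" for n
    proof -
      have "r * (((a + w) ^ n - (a - w) ^ n) / (2 * w)) = - (w * ((a + w) ^ n - (a - w) ^ n) / 2)"
        unfolding r_eq using w(1) by (simp add: field_simps)
      then show ?thesis
        by (simp only: power_Suc) (simp add: field_simps)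
    qed
    moreover have "((a + w) ^ Suc n - (a - w) ^ Suc n) / (2 * w)
        = ((a + w) ^ n + (a - w) ^ n) / 2 + a * (((a + w) ^ n - (a - w) ^ n) / (2 * w))" for n
      using w(1) by (simp only: power_Suc) (simp add: field_simps)
    ultimately show ?thesis
      by (intro *[of "\<lambda>n. ((a + w) ^ n + (a - w) ^ n) / 2" "\<lambda>n. ((a + w) ^ n - (a - w) ^ n) / (2 * w)"])
        (simp_all add: add_divide_distrib diff_divide_distrib mult.commute)
  qed
qed

section \<open>Spectrum, uniqueness and existence of the principal logarithm\<close>

lemma cplx_eigenvalue_cmat:
  "cplx_eigenvalue (cmat \<alpha> \<beta>) z \<longleftrightarrow> (z - of_real (Re \<alpha>))\<^sup>2 + of_real ((Im \<alpha>)\<^sup>2 - (cmod \<beta>)\<^sup>2) = 0"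
proof -
  have "(of_real ((cmod \<beta>)\<^sup>2) :: complex) = (of_real (Re \<beta>))\<^sup>2 + (of_real (Im \<beta>))\<^sup>2"
    by (simp add: cmod_power2)
  then show ?thesis
    unfolding cplx_eigenvalue_def det_2 by (simp add: algebra_simps power2_eq_square)
qed

lemma principal_strip_cmat:
  "(\<forall>z. cplx_eigenvalue (cmat \<alpha> \<beta>) z \<longrightarrow> \<bar>Im z\<bar> < pi) \<longleftrightarrow> (Im \<alpha>)\<^sup>2 - (cmod \<beta>)\<^sup>2 < pi\<^sup>2"
proof -
  define r where "r = (Im \<alpha>)\<^sup>2 - (cmod \<beta>)\<^sup>2"
  show ?thesis
    unfolding cplx_eigenvalue_cmat r_def[symmetric]
  proof (intro iffI allI impI)
    assume *: "\<forall>z. (z - of_real (Re \<alpha>))\<^sup>2 + of_real r = 0 \<longrightarrow> \<bar>Im z\<bar> < pi"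
    show "r < pi\<^sup>2"
    proof (cases "r < 0")
      case True
      then show ?thesis
        using zero_le_power2[of pi] by linarith
    next
      case False
      then have "(Complex (Re \<alpha>) (sqrt r) - of_real (Re \<alpha>))\<^sup>2 + of_real r = 0"
        by (simp add: complex_eq_iff power2_eq_square)
      then have "sqrt r < pi"
        using * by fastforce
      then have "(sqrt r)\<^sup>2 < pi\<^sup>2"
        using False by (intro power_strict_mono) auto
      then show ?thesis
        using False by simp
    qed
  next
    fix z :: complex assume r: "r < pi\<^sup>2" and "(z - of_real (Re \<alpha>))\<^sup>2 + of_real r = 0"
    then have re: "(Re z - Re \<alpha>)\<^sup>2 - (Im z)\<^sup>2 + r = 0" and im: "(Re z - Re \<alpha>) * Im z = 0"
      by (auto simp: complex_eq_iff power2_eq_square)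
    have "(Im z)\<^sup>2 < pi\<^sup>2"
      using re im r by auto
    then show "\<bar>Im z\<bar> < pi"
      by (metis abs_of_pos pi_gt_zero real_sqrt_abs real_sqrt_less_iff)
  qed
qed

lemma csq_strict_antimono:
  assumes "q < q'" "q' \<le> pi\<^sup>2"
  shows "csq q' < csq q"
proof -
  consider "0 \<le> q" | "q < 0" "0 \<le> q'" | "q' < 0" by linarith
  then show ?thesis
  proof cases
    case 1
    have "sqrt q' \<le> pi"
      using assms by (simp add: real_le_lsqrt)
    then show ?thesis
      using 1 assms by (simp add: csq_def cos_monotone_0_pi)
  next
    case 2
    have "cos (sqrt q') \<le> 1" "1 < cosh (sqrt (- q))"
      using 2 cosh_real_nonneg_less_iff[of 0 "sqrt (- q)"] by auto
    then have "cos (sqrt q') < cosh (sqrt (- q))" by linarith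
    then show ?thesis
      using 2 by (simp add: csq_def)
  next
    case 3
    then show ?thesis
      using assms by (simp add: csq_def cosh_real_nonneg_less_iff)
  qed
qed

lemma csq_inj:
  assumes "csq q = csq q'" "q \<le> pi\<^sup>2" "q' \<le> pi\<^sup>2"
  shows "q = q'"
  using csq_strict_antimono[of q q'] csq_strict_antimono[of q' q] assms by linarith

lemma csq_surj:
  assumes "x > - 1"
  obtains q where "q < pi\<^sup>2" "csq q = x"
proof (cases "x \<le> 1")
  case True
  have "arccos x < pi" "0 \<le> arccos x"
    using True assms arccos_less_mono[of x "-1"] by (auto intro: arccos_lbound)
  then have "(arccos x)\<^sup>2 < pi\<^sup>2"
    by (intro power_strict_mono) auto
  moreover have "csq ((arccos x)\<^sup>2) = x"
    using True assms \<open>0 \<le> arccos x\<close> by (simp add: csq_def)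
  ultimately show ?thesis
    by (rule that)
next
  case False
  then have "arcosh x > 0"
    by (simp add: arcosh_real_gt_1_iff less_imp_le)
  then have "csq (- (arcosh x)\<^sup>2) = x"
    using False by (simp add: csq_def)
  moreover have "- (arcosh x)\<^sup>2 < pi\<^sup>2"
    by (smt (verit) pi_gt_zero zero_le_power2 zero_less_power)
  ultimately show ?thesis
    using that by blast
qed

lemma snq_pos: "q < pi\<^sup>2 \<Longrightarrow> snq q > 0"
proof -
  assume q: "q < pi\<^sup>2"
  consider "q > 0" | "q = 0" | "q < 0" by linarith
  then show ?thesis
  proof cases
    case 1
    then have "sqrt q < pi"
      using q by (simp add: real_less_lsqrt)
    then show ?thesis
      using 1 by (simp add: snq_def sin_gt_zero)
  qed (auto simp: snq_def)
qed

text \<open>The determinant of the exponential returns \<open>Re \<alpha>\<close>; half its trace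
  then returns \<open>csq q\<close>, hence q, because \<open>csq\<close> is injective up to pi^2;
  finally the positive factor \<open>snq q\<close> is divided out.\<close>

lemma principal_log_cmat_unique:
  fixes M L L' :: mat2
  assumes "is_principal_log M L" "is_principal_log M L'"
  shows "L = L'"
proof -
  obtain \<alpha> \<beta> where L: "L = cmat \<alpha> \<beta>" by (rule cmat_exhaust)
  obtain \<alpha>' \<beta>' where L': "L' = cmat \<alpha>' \<beta>'" by (rule cmat_exhaust)
  define q where "q = (Im \<alpha>)\<^sup>2 - (cmod \<beta>)\<^sup>2"
  define q' where "q' = (Im \<alpha>')\<^sup>2 - (cmod \<beta>')\<^sup>2"
  have q: "q < pi\<^sup>2" "q' < pi\<^sup>2"
    using assms unfolding is_principal_log_def L L' principal_strip_cmat q_def q'_def by auto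
  have "mexp (cmat (Complex (Re \<alpha>) (Im \<alpha>)) \<beta>) = mexp (cmat (Complex (Re \<alpha>') (Im \<alpha>')) \<beta>')"
    using assms by (simp add: is_principal_log_def L L')
  then have *: "exp (Re \<alpha>) * csq q = exp (Re \<alpha>') * csq q'"
     "exp (Re \<alpha>) * (snq q * Im \<alpha>) = exp (Re \<alpha>') * (snq q' * Im \<alpha>')"
     "complex_of_real (exp (Re \<alpha>)) * (of_real (snq q) * \<beta>) = of_real (exp (Re \<alpha>')) * (of_real (snq q') * \<beta>')"
    unfolding mexp_cmat cmat_inject q_def[symmetric] q'_def[symmetric] by (auto simp: complex_eq_iff)
  have det: "(e * csq q)\<^sup>2 + (e * (snq q * y))\<^sup>2 - (cmod (of_real e * (of_real (snq q) * \<beta>)))\<^sup>2 = e\<^sup>2"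
    if "q = y\<^sup>2 - (cmod \<beta>)\<^sup>2" for e q y :: real and \<beta> :: complex
  proof -
    have "(e * csq q)\<^sup>2 + (e * (snq q * y))\<^sup>2 - (cmod (of_real e * (of_real (snq q) * \<beta>)))\<^sup>2
        = e\<^sup>2 * ((csq q)\<^sup>2 + q * (snq q)\<^sup>2)"
      by (simp add: that norm_mult power_mult_distrib algebra_simps)
    then show ?thesis
      by (simp add: csq_snq_pythagoras)
  qed
  have "(exp (Re \<alpha>))\<^sup>2 = (exp (Re \<alpha>'))\<^sup>2"
    using det[OF q_def, of "exp (Re \<alpha>)"] det[OF q'_def, of "exp (Re \<alpha>')"] unfolding * by simp
  then have re: "Re \<alpha> = Re \<alpha>'"
    by (simp add: power2_eq_iff_nonneg)
  then have qq: "q = q'"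
    using * q by (auto intro: csq_inj)
  then show ?thesis
    using * re snq_pos[OF q(1)] by (simp add: L L' complex_eq_iff)
qed

text \<open>The exponential formula read backwards: r^2 is the determinant,
  \<open>csq q = Re u\<close> fixes q, and \<open>snq q\<close> is divided out. The hypothesis
  \<open>det\<close> ensures that the matrix so obtained has this very q.\<close>

lemma principal_log_scaled_cmat:
  assumes r: "r > 0" and det: "(cmod u)\<^sup>2 - (cmod v)\<^sup>2 = 1" and q: "q < pi\<^sup>2" "csq q = Re u"
  shows "is_principal_log (cmat (of_real r * u) (of_real r * v))
      (cmat (Complex (ln r) (Im u / snq q)) (v / of_real (snq q)))"
proof -
  note S = snq_pos[OF q(1)]
  have "(Im u)\<^sup>2 - (cmod v)\<^sup>2 = q * (snq q)\<^sup>2"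
    using det csq_snq_pythagoras[of q] q by (simp add: cmod_power2)
  then have q_eq: "(Im u / snq q)\<^sup>2 - (cmod (v / of_real (snq q)))\<^sup>2 = q"
    using S by (simp add: norm_divide power_divide field_simps)
  have "mexp (cmat (Complex (ln r) (Im u / snq q)) (v / of_real (snq q)))
      = cmat (of_real r * u) (of_real r * v)"
    unfolding mexp_cmat q_eq using S r q by (simp add: complex_eq_iff)
  moreover have "(Im (Complex (ln r) (Im u / snq q)))\<^sup>2 - (cmod (v / of_real (snq q)))\<^sup>2 < pi\<^sup>2"
    using q_eq q by simp
  ultimately show ?thesis
    unfolding is_principal_log_def principal_strip_cmat by blast
qed

lemma mlog_eqI: "is_principal_log M L \<Longrightarrow> mlog M = L" for M L :: mat2
  unfolding mlog_def by (rule the_equality) (auto intro: principal_log_cmat_unique)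

section \<open>The chord inequality\<close>

lemma exp_pi_half_bounds: "(48102 / 10000) < exp (pi / 2)" "exp (pi / 2) < (48108 / 10000)"
proof -
  have bound: "1 + x + x\<^sup>2 / 2 + x ^ 3 / 6 + x ^ 4 / 24 \<le> exp x"
    "exp x \<le> 1 + x + x\<^sup>2 / 2 + x ^ 3 / 6 + x ^ 4 / 24 + x ^ 5 / 40" if "0 \<le> x" "x \<le> 1" for x :: real
  proof -
    obtain t where t: "\<bar>t\<bar> \<le> \<bar>x\<bar>" "exp x = (\<Sum>m<5. x ^ m / fact m) + exp t / fact 5 * x ^ 5"
      using Maclaurin_exp_le[of x 5] by blast
    have sum: "(\<Sum>m<5. x ^ m / fact m) = 1 + x + x\<^sup>2 / 2 + x ^ 3 / 6 + x ^ 4 / 24"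
      by (simp add: eval_nat_numeral)
    have "exp t \<le> exp 1"
      using t that by simp
    then have "exp t \<le> 3"
      using exp_le by linarith
    then have "exp t / fact 5 * x ^ 5 \<le> 3 / 120 * x ^ 5"
      using that by (intro mult_mono) (auto simp: fact_numeral)
    moreover have "0 \<le> exp t / fact 5 * x ^ 5"
      using that by simp
    ultimately show "1 + x + x\<^sup>2 / 2 + x ^ 3 / 6 + x ^ 4 / 24 \<le> exp x"
      "exp x \<le> 1 + x + x\<^sup>2 / 2 + x ^ 3 / 6 + x ^ 4 / 24 + x ^ 5 / 40"
      using t(2) unfolding sum by linarith+
  qed
  \<comment> \<open>At pi/16, about 0.196, a Taylor polynomial of degree four is accurate enough to
    survive the eighth power.\<close>
  have pow: "exp (pi / 2) = exp (pi / 16) ^ 8"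
    by (simp flip: exp_of_nat_mult)
  have "(1216949 / 1000000) \<le> exp ((196349 / 1000000) :: real)"
    using bound(1)[of "(196349 / 1000000)"] by (simp add: power_numeral_even power_numeral_odd power2_eq_square)
  also have "\<dots> \<le> exp (pi / 16)"
    using pi_approx by simp
  finally have "(1216949 / 1000000) ^ 8 \<le> exp (pi / 16) ^ 8"
    by (intro power_mono) auto
  then show "(48102 / 10000) < exp (pi / 2)"
    unfolding pow by (rule less_le_trans[rotated]) (simp add: power_divide)
  have "exp (pi / 16) \<le> exp ((19635 / 100000) :: real)"
    using pi_approx by simp
  also have "\<dots> \<le> (1216959 / 1000000)"
    using bound(2)[of "(19635 / 100000)"] by (simp add: power_numeral_even power_numeral_odd power2_eq_square)
  finally have "exp (pi / 16) ^ 8 \<le> (1216959 / 1000000) ^ 8"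
    by (intro power_mono) auto
  then show "exp (pi / 2) < (48108 / 10000)"
    unfolding pow by (rule le_less_trans) (simp add: power_divide)
qed

lemma exp_minus_pi_half_bounds: "(2078 / 10000) < exp (- (pi / 2))" "exp (- (pi / 2)) < (2079 / 10000)"
proof -
  have "exp (- (pi / 2)) = 1 / exp (pi / 2)"
    by (simp add: exp_minus inverse_eq_divide)
  moreover have "(2078 / 10000) < 1 / exp (pi / 2)" "1 / exp (pi / 2) < (2079 / 10000)"
    using exp_pi_half_bounds by (auto simp: field_simps)
  ultimately show "(2078 / 10000) < exp (- (pi / 2))" "exp (- (pi / 2)) < (2079 / 10000)"
    by auto
qed

lemma cosh_pi_half_bounds: "(2509 / 1000) < cosh (pi / 2)" "cosh (pi / 2) < (25094 / 10000)"
  using exp_pi_half_bounds exp_minus_pi_half_bounds by (auto simp: cosh_def)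

definition \<T> :: real where "\<T> = tanh (pi / 4)"

lemma \<T>_eq: "\<T> = (exp (pi / 2) - 1) / (exp (pi / 2) + 1)"
proof -
  have "exp (pi / 2) = exp (pi / 4) * exp (pi / 4)"
    by (simp flip: exp_add)
  then show ?thesis
    unfolding \<T>_def tanh_altdef by (simp add: exp_minus divide_simps)
qed

lemma \<T>_bounds: "(655 / 1000) < \<T>" "\<T> < (656 / 1000)"
  using exp_pi_half_bounds by (auto simp: \<T>_eq field_simps)

text \<open>The half-argument formula for tanh; it links the slope of the half-space to the end
  point of the conic.\<close>

lemma \<T>_cosh: "\<T>\<^sup>2 * (cosh (pi / 2) + 1) = cosh (pi / 2) - 1"
proof -
  have *: "exp (pi / 2) + 1 > 0"
    using exp_pi_half_bounds by linarith
  have c: "cosh (pi / 2) = (exp (pi / 2) ^ 2 + 1) / (2 * exp (pi / 2))"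
    by (simp add: cosh_def exp_minus field_simps power2_eq_square)
  have e: "exp (pi / 2) \<noteq> 0" "exp (pi / 2) + 1 \<noteq> 0"
    using * by auto
  show "\<T>\<^sup>2 * (cosh (pi / 2) + 1) = cosh (pi / 2) - 1"
    unfolding \<T>_eq c using e by (simp add: divide_simps power2_eq_square) (simp add: algebra_simps)
qed

text \<open>The derivative has the sign of the decreasing function \<open>r\<close>, so F can only
  rise first and fall afterwards, and its minimum is at an end point.\<close>

lemma nonneg_between_zeros:
  fixes F F' p r :: "real \<Rightarrow> real"
  assumes ends: "F l \<ge> 0" "F u \<ge> 0" and cont: "continuous_on {l..u} F"
    and deriv: "\<And>x. l < x \<Longrightarrow> x < u \<Longrightarrow> (F has_real_derivative p x * r x) (at x)"
    and p: "\<And>x. l < x \<Longrightarrow> x < u \<Longrightarrow> p x \<ge> 0"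
    and r: "\<And>x y. l < x \<Longrightarrow> x \<le> y \<Longrightarrow> y < u \<Longrightarrow> r y \<le> r x"
    and x: "l \<le> x" "x \<le> u"
  shows "F x \<ge> 0"
proof (cases "x = l \<or> x = u")
  case True
  then show ?thesis using ends by auto
next
  case False
  then have x: "l < x" "x < u" using x by auto
  show ?thesis
  proof (cases "r x \<ge> 0")
    case True
    have "F l \<le> F x"
    proof (rule DERIV_nonneg_imp_increasing_open[of l x F])
      fix y assume y: "l < y" "y < x"
      then have "p y * r y \<ge> 0"
        using p[of y] r[of y x] x True by (intro mult_nonneg_nonneg) auto
      then show "\<exists>D. (F has_real_derivative D) (at y) \<and> D \<ge> 0"
        using deriv[of y] y x by force
    qed (use x in \<open>auto intro: continuous_on_subset[OF cont]\<close>)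
    then show ?thesis using ends by linarith
  next
    case False
    have "F x \<ge> F u"
    proof (rule DERIV_nonpos_imp_decreasing_open[of x u F])
      fix y assume y: "x < y" "y < u"
      then have "p y * r y \<le> 0"
        using p[of y] r[of x y] x False by (intro mult_nonneg_nonpos) auto
      then show "\<exists>D. (F has_real_derivative D) (at y) \<and> D \<le> 0"
        using deriv[of y] y x by force
    qed (use x in \<open>auto intro: continuous_on_subset[OF cont]\<close>)
    then show ?thesis using ends by linarith
  qed
qed

text \<open>The chord of \<open>q \<mapsto> \<phi> cot (\<phi>/2)\<close>, \<open>q = \<phi>\<^sup>2\<close>, between \<open>q = -\<pi>\<^sup>2/4\<close> and \<open>q = \<pi>\<^sup>2/4\<close>.\<close>

definition chord0 :: real where "chord0 = pi / 4 * (1 + 1 / \<T>)"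
definition chord1 :: real where "chord1 = (1 / \<T> - 1) / pi"

lemma chord_bounds: "chord0 < 2" "0 < chord1" "chord1 < 1 / 4"
proof -
  have inv: "1 / \<T> < (1527 / 1000)" "1 / \<T> > 1"
    using \<T>_bounds by (auto simp: field_simps)
  have "pi / 4 * (1 + 1 / \<T>) < (7854 / 10000) * (2527 / 1000)"
    by (rule mult_strict_mono) (use inv pi_approx in auto)
  then show "chord0 < 2"
    by (simp add: chord0_def)
  show "0 < chord1" "chord1 < 1 / 4"
    using inv pi_approx by (auto simp: chord1_def field_simps)
qed

text \<open>At \<phi> = pi/2 the function \<open>\<phi> cot (\<phi>/2)\<close> equals pi/2; at
  \<phi> = \<i> pi/2 it is \<open>pi/2 coth (pi/4) = pi / (2 T)\<close>.\<close>

lemma chord_ends: "chord0 - chord1 * (pi / 2)\<^sup>2 = pi / 2" "\<T> * (chord0 + chord1 * (pi / 2)\<^sup>2) = pi / 2"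
  using \<T>_bounds by (auto simp: chord0_def chord1_def field_simps power2_eq_square)

lemma tan_over_mono:
  assumes "0 < x" "x \<le> y" "y < pi / 2"
  shows "tan x / x \<le> tan y / (y::real)"
proof (rule DERIV_nonneg_imp_nondecreasing[of x y "\<lambda>x. tan x / x"])
  show "x \<le> y" by fact
  fix z assume "x \<le> z" "z \<le> y"
  then have z: "0 < z" "z < pi / 2" using assms by auto
  then have c: "cos z > 0" by (intro cos_gt_zero_pi) auto
  have "sin z * cos z \<le> z * 1"
    using z c by (intro mult_mono sin_x_le_x) (auto intro: sin_ge_zero)
  then have "tan z * cos z * cos z \<le> z"
    using c by (simp add: tan_def)
  then have "tan z \<le> z * inverse ((cos z)\<^sup>2)"
    using c by (simp add: field_simps power2_eq_square)
  then show "\<exists>D. ((\<lambda>x. tan x / x) has_real_derivative D) (at z) \<and> 0 \<le> D"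
    using z c by (intro exI[of _ "(inverse ((cos z)\<^sup>2) * z - tan z * 1) / (z * z)"] conjI)
      (auto intro!: derivative_eq_intros simp: mult.commute)
qed

lemma sinh_ge_self:
  assumes "0 \<le> x"
  shows "x \<le> sinh (x::real)"
proof -
  have "sinh 0 - 0 \<le> sinh x - x"
  proof (rule DERIV_nonneg_imp_nondecreasing[of 0 x "\<lambda>x. sinh x - x"])
    fix z :: real
    show "\<exists>D. ((\<lambda>x. sinh x - x) has_real_derivative D) (at z) \<and> 0 \<le> D"
      using cosh_real_ge_1[of z] by (intro exI[of _ "cosh z - 1"]) (auto intro!: derivative_eq_intros)
  qed (use assms in auto)
  then show ?thesis by simp
qed

lemma tanh_over_antimono:
  assumes "0 < x" "x \<le> y"
  shows "tanh y / (y::real) \<le> tanh x / x"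
proof (rule DERIV_nonpos_imp_nonincreasing[of x y "\<lambda>x. tanh x / x"])
  show "x \<le> y" by fact
  fix z assume "x \<le> z" "z \<le> y"
  then have z: "0 < z" using assms by auto
  have "z * 1 \<le> sinh z * cosh z"
    using z by (intro mult_mono cosh_real_ge_1 sinh_ge_self) auto
  moreover have "z * (1 - (tanh z)\<^sup>2) = z / (cosh z)\<^sup>2"
  proof -
    have "1 - (tanh z)\<^sup>2 = ((cosh z)\<^sup>2 - (sinh z)\<^sup>2) / (cosh z)\<^sup>2"
      by (simp add: tanh_def power_divide diff_divide_distrib)
    then show ?thesis
      by (simp add: hyperbolic_pythagoras)
  qed
  moreover have "tanh z = sinh z * cosh z / (cosh z)\<^sup>2"
    by (simp add: tanh_def power2_eq_square)
  ultimately have "z * (1 - (tanh z)\<^sup>2) \<le> tanh z"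
    by (simp add: divide_right_mono)
  then show "\<exists>D. ((\<lambda>x. tanh x / x) has_real_derivative D) (at z) \<and> D \<le> 0"
    using z by (intro exI[of _ "((1 - (tanh z)\<^sup>2) * z - tanh z * 1) / (z * z)"] conjI)
      (auto intro!: derivative_eq_intros simp: mult.commute divide_nonpos_pos)
qed

text \<open>Meant for \<open>C = cos (x/2)\<close>, \<open>s = sin (x/2)\<close>,
  \<open>t = tan (x/2) / (x/2)\<close>: once the positive weight \<open>x^2 * C\<close> is pulled
  out of a derivative, the remaining bracket is monotone term by term. The variant with the other
  sign serves the hyperbolic functions.\<close>

lemma weight_expand:
  fixes x C :: real
  assumes "x \<noteq> 0" "x\<^sup>2 * C * t = 2 * (x * s)"
  shows "x\<^sup>2 * C * (A / x\<^sup>2 + (B - K * t / 2)) = A * C + B * x\<^sup>2 * C - K * x * s"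
proof -
  have "x\<^sup>2 * C * (A / x\<^sup>2 + (B - K * t / 2)) = A * C + B * x\<^sup>2 * C - K * (x\<^sup>2 * C * t) / 2"
    using assms(1) by (simp add: distrib_left right_diff_distrib)
  then show ?thesis
    unfolding assms(2) by simp
qed

lemma weight_expand':
  fixes x C :: real
  assumes "x \<noteq> 0" "x\<^sup>2 * C * t = 2 * (x * s)"
  shows "x\<^sup>2 * C * (A / x\<^sup>2 + (K * t / 2 - B)) = A * C - B * x\<^sup>2 * C + K * x * s"
  using weight_expand[OF assms, of A "- B" "- K"] by simp

text \<open>The difference of the two sides vanishes at 0 and at pi/2. Its derivative is
  \<open>x^2 cos (x/2)\<close> times a bracket that decreases, because \<open>tan y / y\<close>
  increases and \<open>chord0 < 2\<close>, \<open>chord1 < 1/4\<close>.\<close>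

lemma cot_half_ge_chord:
  assumes "0 \<le> x" "x \<le> pi / 2"
  shows "(chord0 - chord1 * x\<^sup>2) * sin (x / 2) \<le> x * cos (x / 2)"
proof -
  define F where "F x = x * cos (x / 2) - (chord0 - chord1 * x\<^sup>2) * sin (x / 2)" for x
  have "F x \<ge> 0"
  proof (rule nonneg_between_zeros[of F 0 "pi / 2" "\<lambda>x. x\<^sup>2 * cos (x / 2)"
        "\<lambda>x. (1 - chord0 / 2) / x\<^sup>2 + (chord1 / 2 - (1 / 2 - 2 * chord1) * (tan (x / 2) / (x / 2)) / 2)"])
    show "F (pi / 2) \<ge> 0"
      unfolding F_def chord_ends by (simp add: sin_45 cos_45)
    show "continuous_on {0..pi / 2} F"
      unfolding F_def by (intro continuous_intros) auto
    fix x assume x: "0 < x" "x < pi / 2"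
    have c: "cos (x / 2) > 0"
      using x by (intro cos_gt_zero_pi) auto
    then show "0 \<le> x\<^sup>2 * cos (x / 2)" by simp
    have "x\<^sup>2 * cos (x / 2) * ((1 - chord0 / 2) / x\<^sup>2 + (chord1 / 2 - (1 / 2 - 2 * chord1) * (tan (x / 2) / (x / 2)) / 2))
       = (1 - chord0 / 2) * cos (x / 2) + chord1 / 2 * x\<^sup>2 * cos (x / 2) - (1 / 2 - 2 * chord1) * x * sin (x / 2)"
      using x c by (intro weight_expand) (simp_all add: tan_def power2_eq_square)
    moreover have "(F has_real_derivative (1 - chord0 / 2) * cos (x / 2) + chord1 / 2 * x\<^sup>2 * cos (x / 2) - (1 / 2 - 2 * chord1) * x * sin (x / 2)) (at x)"
      unfolding F_def by (rule derivative_eq_intros refl | simp)+ (simp add: field_simps power2_eq_square)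
    ultimately show "(F has_real_derivative x\<^sup>2 * cos (x / 2) * ((1 - chord0 / 2) / x\<^sup>2 + (chord1 / 2 - (1 / 2 - 2 * chord1) * (tan (x / 2) / (x / 2)) / 2))) (at x)"
      by simp
  next
    fix x y assume xy: "0 < x" "x \<le> y" "y < pi / 2"
    have h1: "(1 - chord0 / 2) / y\<^sup>2 \<le> (1 - chord0 / 2) / x\<^sup>2"
      using xy chord_bounds by (intro divide_left_mono power_mono) auto
    have h2: "(1 / 2 - 2 * chord1) * (tan (x / 2) / (x / 2)) \<le> (1 / 2 - 2 * chord1) * (tan (y / 2) / (y / 2))"
      using xy chord_bounds by (intro mult_left_mono tan_over_mono) auto
    show "(1 - chord0 / 2) / y\<^sup>2 + (chord1 / 2 - (1 / 2 - 2 * chord1) * (tan (y / 2) / (y / 2)) / 2)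
       \<le> (1 - chord0 / 2) / x\<^sup>2 + (chord1 / 2 - (1 / 2 - 2 * chord1) * (tan (x / 2) / (x / 2)) / 2)"
      by (rule add_mono[OF h1 diff_mono[OF order_refl divide_right_mono[OF h2]]]) simp
  qed (use assms in \<open>auto simp: F_def\<close>)
  then show ?thesis
    by (simp add: F_def)
qed

lemma coth_half_ge_chord:
  assumes "0 \<le> x" "x \<le> pi / 2"
  shows "(chord0 + chord1 * x\<^sup>2) * sinh (x / 2) \<le> x * cosh (x / 2)"
proof -
  define F where "F x = x * cosh (x / 2) - (chord0 + chord1 * x\<^sup>2) * sinh (x / 2)" for x
  have "F x \<ge> 0"
  proof (rule nonneg_between_zeros[of F 0 "pi / 2" "\<lambda>x. x\<^sup>2 * cosh (x / 2)"
        "\<lambda>x. (1 - chord0 / 2) / x\<^sup>2 + ((1 / 2 - 2 * chord1) * (tanh (x / 2) / (x / 2)) / 2 - chord1 / 2)"])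
    have "\<T> * (chord0 + chord1 * (pi / 2)\<^sup>2) * cosh (pi / 4) = (chord0 + chord1 * (pi / 2)\<^sup>2) * sinh (pi / 4)"
      using cosh_real_pos[of "pi / 4"] by (simp add: \<T>_def tanh_def)
    then show "F (pi / 2) \<ge> 0"
      unfolding F_def using chord_ends(2) by simp
    show "continuous_on {0..pi / 2} F"
      unfolding F_def by (intro continuous_intros) auto
    fix x assume x: "0 < x" "x < pi / 2"
    have c: "cosh (x / 2) > 0"
      by simp
    then show "0 \<le> x\<^sup>2 * cosh (x / 2)" by simp
    have "x\<^sup>2 * cosh (x / 2) * ((1 - chord0 / 2) / x\<^sup>2 + ((1 / 2 - 2 * chord1) * (tanh (x / 2) / (x / 2)) / 2 - chord1 / 2))
       = (1 - chord0 / 2) * cosh (x / 2) - chord1 / 2 * x\<^sup>2 * cosh (x / 2) + (1 / 2 - 2 * chord1) * x * sinh (x / 2)"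
      using x c by (intro weight_expand') (simp_all add: tanh_def power2_eq_square)
    moreover have "(F has_real_derivative (1 - chord0 / 2) * cosh (x / 2) - chord1 / 2 * x\<^sup>2 * cosh (x / 2) + (1 / 2 - 2 * chord1) * x * sinh (x / 2)) (at x)"
      unfolding F_def by (rule derivative_eq_intros refl | simp)+ (simp add: field_simps power2_eq_square)
    ultimately show "(F has_real_derivative x\<^sup>2 * cosh (x / 2) * ((1 - chord0 / 2) / x\<^sup>2 + ((1 / 2 - 2 * chord1) * (tanh (x / 2) / (x / 2)) / 2 - chord1 / 2))) (at x)"
      by simp
  next
    fix x y assume xy: "0 < x" "x \<le> y" "y < pi / 2"
    have h1: "(1 - chord0 / 2) / y\<^sup>2 \<le> (1 - chord0 / 2) / x\<^sup>2"
      using xy chord_bounds by (intro divide_left_mono power_mono) auto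
    have h2: "(1 / 2 - 2 * chord1) * (tanh (y / 2) / (y / 2)) \<le> (1 / 2 - 2 * chord1) * (tanh (x / 2) / (x / 2))"
      using xy chord_bounds by (intro mult_left_mono tanh_over_antimono) auto
    show "(1 - chord0 / 2) / y\<^sup>2 + ((1 / 2 - 2 * chord1) * (tanh (y / 2) / (y / 2)) / 2 - chord1 / 2)
       \<le> (1 - chord0 / 2) / x\<^sup>2 + ((1 / 2 - 2 * chord1) * (tanh (x / 2) / (x / 2)) / 2 - chord1 / 2)"
      by (rule add_mono[OF h1 diff_mono[OF divide_right_mono[OF h2] order_refl]]) simp
  qed (use assms in \<open>auto simp: F_def\<close>)
  then show ?thesis
    by (simp add: F_def)
qed

text \<open>By the double-angle formulas \<open>(1 + csq q) / snq q\<close> is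
  \<open>\<phi> cot (\<phi>/2)\<close> with \<open>q = \<phi>^2\<close>, for either sign of
  q.\<close>

lemma snq_chord:
  assumes "\<bar>q\<bar> \<le> (pi / 2)\<^sup>2"
  shows "snq q * (chord0 - chord1 * q) \<le> 1 + csq q"
proof -
  have r: "sqrt \<bar>q\<bar> \<le> pi / 2"
    using assms pi_gt_zero by (intro real_le_lsqrt) auto
  consider "q > 0" | "q = 0" | "q < 0" by linarith
  then show ?thesis
  proof cases
    case 1
    define x where "x = sqrt q"
    have x: "0 < x" "x \<le> pi / 2" "q = x\<^sup>2"
      using 1 r by (auto simp: x_def)
    have c: "cos (x / 2) > 0"
      using x by (intro cos_gt_zero_pi) auto
    have sc: "sin x = 2 * sin (x / 2) * cos (x / 2)" "1 + cos x = 2 * cos (x / 2) * cos (x / 2)"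
      using sin_double[of "x / 2"] cos_double_cos[of "x / 2"] by (auto simp: power2_eq_square)
    have "2 * cos (x / 2) * ((chord0 - chord1 * x\<^sup>2) * sin (x / 2)) \<le> 2 * cos (x / 2) * (x * cos (x / 2))"
      using c cot_half_ge_chord[of x] x by (intro mult_left_mono) auto
    then have "sin x * (chord0 - chord1 * x\<^sup>2) \<le> (1 + cos x) * x"
      unfolding sc by (simp add: algebra_simps)
    then have "sin x / x * (chord0 - chord1 * x\<^sup>2) \<le> 1 + cos x"
      using x by (simp add: divide_le_eq)
    then have "snq q * (chord0 - chord1 * q) \<le> 1 + csq q"
      unfolding x(3)[symmetric] using 1 by (simp add: snq_def csq_def x_def)
    then show ?thesis .
  next
    case 2
    then show ?thesis
      using chord_bounds by (simp add: snq_def csq_def)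
  next
    case 3
    define x where "x = sqrt (- q)"
    have x2: "x\<^sup>2 = - q"
      using 3 by (simp add: x_def)
    have x: "0 < x" "x \<le> pi / 2"
      using 3 r by (auto simp: x_def)
    have sc: "sinh x = 2 * sinh (x / 2) * cosh (x / 2)" "1 + cosh x = 2 * cosh (x / 2) * cosh (x / 2)"
      using sinh_double[of "x / 2"] cosh_double_cosh[of "x / 2"] by (auto simp: power2_eq_square)
    have "2 * cosh (x / 2) * ((chord0 + chord1 * x\<^sup>2) * sinh (x / 2)) \<le> 2 * cosh (x / 2) * (x * cosh (x / 2))"
      using coth_half_ge_chord[of x] x by (intro mult_left_mono) auto
    then have "sinh x * (chord0 + chord1 * x\<^sup>2) \<le> (1 + cosh x) * x"
      unfolding sc by (simp add: algebra_simps)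
    then have "sinh x / x * (chord0 + chord1 * x\<^sup>2) \<le> 1 + cosh x"
      using x by (simp add: divide_le_eq)
    then have "snq q * (chord0 - chord1 * q) \<le> 1 + csq q"
      using x2 3 by (simp add: snq_def csq_def x_def)
    then show ?thesis .
  qed
qed

section \<open>Biaffine forms on a conic\<close>

text \<open>With \<open>\<sigma>\<close> and \<open>p\<close> the sum and product of the parameters of two points on the conic, this is the gap between a
  linear functional and its maximum at the conic point of parameter \<open>\<rho>\<close>. The idea is that the expression is concave in \<open>p\<close>,
  so that only \<open>p = 0\<close> (one factor trivial) and \<open>4 p = \<sigma>\<^sup>2\<close> (equal factors) matter.\<close>

lemma arc_quadratic:
  fixes k \<rho> \<sigma> p \<eta> :: real
  assumes k: "(1509 / 1000) \<le> k" "k \<le> (151 / 100)" and \<rho>: "0 \<le> \<rho>" "\<rho> * (k + 1) \<le> 1" and \<sigma>: "0 \<le> \<sigma>" "\<sigma> \<le> (8 / 10)"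
    and \<eta>: "0 \<le> \<eta>" "\<eta> \<le> 2 * \<rho>\<^sup>2" and p: "0 \<le> p" "4 * p \<le> \<sigma>\<^sup>2"
  defines "e \<equiv> \<rho> * (2 - k * \<rho>)"
  shows "0 \<le> (\<sigma> - \<rho>)\<^sup>2 + p * (\<rho>\<^sup>2 * (k\<^sup>2 - 2) + 2 * k * e - k * \<eta>
      + \<sigma> * ((k + 1) * e - k * \<rho>\<^sup>2 - k * (2 * (1 - \<rho>\<^sup>2) + \<eta>))) - p\<^sup>2 * (k * (2 * (1 - \<rho>\<^sup>2) + \<eta>) - \<rho>\<^sup>2)"
proof -
  have \<rho>4: "\<rho> \<le> (4 / 10)"
  proof (rule ccontr)
    assume "\<not> \<rho> \<le> (4 / 10)"
    then have "(4 / 10) * (2509 / 1000) \<le> \<rho> * (k + 1)"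
      using k by (intro mult_mono) auto
    then show False
      using \<rho> by simp
  qed
  \<comment> \<open>\<open>Q\<close> arises from \<open>B\<close> below when \<eta> is raised to 2
    \<rho>^2, the last term to its bound \<open>k * \<sigma>^2 / 2\<close>, and the nonnegative
    \<open>\<rho>^2 (k^2 - 2)\<close> is dropped. It is free of p, so
    \<open>(\<sigma> - \<rho>)^2 + p * Q\<close> is affine in p and only the ends of the range of p
    count.\<close>
  define Q where "Q = 4 * k * \<rho> - 2 * k * \<sigma> - 2 * k * (k + 1) * \<rho>\<^sup>2 + 2 * (k + 1) * \<sigma> * \<rho> - k * \<sigma>\<^sup>2 / 2
     - k * (k + 2) * \<sigma> * \<rho>\<^sup>2"
  define B where "B = \<rho>\<^sup>2 * (k\<^sup>2 - 2) + 2 * k * e - k * \<eta>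
      + \<sigma> * ((k + 1) * e - k * \<rho>\<^sup>2 - k * (2 * (1 - \<rho>\<^sup>2) + \<eta>)) - p * (k * (2 * (1 - \<rho>\<^sup>2) + \<eta>) - \<rho>\<^sup>2)"
  have "Q \<le> B"
  proof -
    have k2: "k\<^sup>2 \<ge> 2"
      using k power_mono[of "(1509 / 1000)" k 2] by (simp add: power2_eq_square)
    have "k * \<eta> * (1 + \<sigma>) \<le> k * (2 * \<rho>\<^sup>2) * (1 + \<sigma>)"
      using k \<sigma> \<eta> by (intro mult_right_mono mult_left_mono) auto
    moreover have "p * (k * (2 * (1 - \<rho>\<^sup>2) + \<eta>) - \<rho>\<^sup>2) \<le> (\<sigma>\<^sup>2 / 4) * (k * 2)"
    proof (rule mult_mono)
      have "k * \<eta> \<le> k * (2 * \<rho>\<^sup>2)"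
        using k \<eta> by (intro mult_left_mono) auto
      then show "k * (2 * (1 - \<rho>\<^sup>2) + \<eta>) - \<rho>\<^sup>2 \<le> k * 2"
        using zero_le_power2[of \<rho>] unfolding distrib_left right_diff_distrib by linarith
      have "\<rho>\<^sup>2 \<le> (4 / 10)\<^sup>2"
        using \<rho> \<rho>4 by (intro power_mono) auto
      then have \<rho>2: "\<rho>\<^sup>2 \<le> (16 / 100)"
        by (simp add: power2_eq_square)
      then have "(1509 / 1000) * (2 * (1 - (16 / 100))) \<le> k * (2 * (1 - \<rho>\<^sup>2) + \<eta>)"
        using k \<eta> by (intro mult_mono) auto
      then show "0 \<le> k * (2 * (1 - \<rho>\<^sup>2) + \<eta>) - \<rho>\<^sup>2"
        using \<rho>2 by simp
    qed (use p in auto)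
    moreover have "0 \<le> \<rho>\<^sup>2 * (k\<^sup>2 - 2)"
      using k2 by simp
    moreover have "B - Q = \<rho>\<^sup>2 * (k\<^sup>2 - 2) + (k * (2 * \<rho>\<^sup>2) * (1 + \<sigma>) - k * \<eta> * (1 + \<sigma>))
        + ((\<sigma>\<^sup>2 / 4) * (k * 2) - p * (k * (2 * (1 - \<rho>\<^sup>2) + \<eta>) - \<rho>\<^sup>2))"
      unfolding B_def Q_def e_def by (simp add: algebra_simps power2_eq_square)
    ultimately show ?thesis
      by linarith
  qed
  \<comment> \<open>This is the end \<open>4 p = \<sigma>^2\<close>. In terms of w = \<sigma> -
    \<rho> a positive definite quadratic form in |w| and \<sigma>^2 is a lower bound.\<close>
  have main: "0 \<le> 4 * (\<sigma> - \<rho>)\<^sup>2 + \<sigma>\<^sup>2 * Q"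
  proof -
    define w where "w = \<sigma> - \<rho>"
    have h1: "2 * k * \<rho> * (\<rho> * (k + 1)) \<le> 2 * k * \<rho> * 1"
      using \<rho> k by (intro mult_left_mono) auto
    have h2: "k * (k + 2) * \<sigma> * \<rho> * \<rho> \<le> (151 / 100) * ((151 / 100) + 2) * \<sigma> * \<rho> * (4 / 10)"
      using \<rho> \<rho>4 k \<sigma> by (intro mult_mono) auto
    have h3: "2 * (2509 / 1000) * (\<sigma> * \<rho>) \<le> 2 * (k + 1) * (\<sigma> * \<rho>)"
      using \<rho> k \<sigma> by (intro mult_right_mono) auto
    have h4: "k * \<sigma>\<^sup>2 \<le> (151 / 100) * \<sigma>\<^sup>2"
      using k by (intro mult_right_mono) auto
    have h5: "0 \<le> (796 / 100000) * (\<sigma> * \<rho>)"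
      using \<rho> \<sigma> by simp
    have eq: "Q - (- 2 * k * w + (289 / 100) * (\<sigma> * \<rho>) - (755 / 1000) * \<sigma>\<^sup>2) = (2 * k * \<rho> * 1 - 2 * k * \<rho> * (\<rho> * (k + 1)))
       + ((151 / 100) * ((151 / 100) + 2) * \<sigma> * \<rho> * (4 / 10) - k * (k + 2) * \<sigma> * \<rho> * \<rho>)
       + (2 * (k + 1) * (\<sigma> * \<rho>) - 2 * (2509 / 1000) * (\<sigma> * \<rho>)) + ((151 / 100) * \<sigma>\<^sup>2 - k * \<sigma>\<^sup>2) / 2 + (796 / 100000) * (\<sigma> * \<rho>)"
      unfolding Q_def w_def by (simp add: field_simps power2_eq_square)
    have "0 \<le> Q - (- 2 * k * w + (289 / 100) * (\<sigma> * \<rho>) - (755 / 1000) * \<sigma>\<^sup>2)"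
      unfolding eq
      by (intro add_nonneg_nonneg divide_nonneg_nonneg h5 h1[THEN diff_ge_0_iff_ge[THEN iffD2]] h2[THEN diff_ge_0_iff_ge[THEN iffD2]]
          h3[THEN diff_ge_0_iff_ge[THEN iffD2]] h4[THEN diff_ge_0_iff_ge[THEN iffD2]]) simp
    then have "Q \<ge> - 2 * k * w + (289 / 100) * (\<sigma> * \<rho>) - (755 / 1000) * \<sigma>\<^sup>2"
      by (simp only: diff_ge_0_iff_ge)
    also have "- 2 * k * w + (289 / 100) * (\<sigma> * \<rho>) - (755 / 1000) * \<sigma>\<^sup>2 = - (2 * k + (289 / 100) * \<sigma>) * w + (2135 / 1000) * \<sigma>\<^sup>2"
      unfolding w_def by (simp add: field_simps power2_eq_square)
    finally have Q: "- (2 * k + (289 / 100) * \<sigma>) * w + (2135 / 1000) * \<sigma>\<^sup>2 \<le> Q" .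
    \<comment> \<open>5.332 = 2 * 1.51 + 2.89 * 0.8 is the largest value of the coefficient.\<close>
    have "- (2 * k + (289 / 100) * \<sigma>) * w \<ge> - (5332 / 1000) * \<bar>w\<bar>"
    proof (cases "w \<ge> 0")
      case True
      show ?thesis
        unfolding abs_of_nonneg[OF True]
      proof -
        have "(2 * k + (289 / 100) * \<sigma>) * w \<le> (5332 / 1000) * w"
          using k \<sigma> True by (intro mult_right_mono) auto
        moreover have "- (2 * k + (289 / 100) * \<sigma>) * w = - ((2 * k + (289 / 100) * \<sigma>) * w)"
          by (rule mult_minus_left)
        ultimately show "- (5332 / 1000) * w \<le> - (2 * k + (289 / 100) * \<sigma>) * w"
          by linarith
      qed
    next
      case False
      then have "(2 * k + (289 / 100) * \<sigma>) * w \<le> 0"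
        using k \<sigma> by (intro mult_nonneg_nonpos) auto
      then have "0 \<le> - (2 * k + (289 / 100) * \<sigma>) * w"
        by (simp only: mult_minus_left neg_0_le_iff_le)
      then show ?thesis
        by (rule order_trans[rotated]) simp
    qed
    then have "\<sigma>\<^sup>2 * (- (5332 / 1000) * \<bar>w\<bar> + (2135 / 1000) * \<sigma>\<^sup>2) \<le> \<sigma>\<^sup>2 * Q"
      using Q by (intro mult_left_mono) auto
    moreover have "4 * w\<^sup>2 + s * (- (5332 / 1000) * \<bar>w\<bar> + (2135 / 1000) * s)
        = (2 * \<bar>w\<bar> - (1333 / 1000) * s)\<^sup>2 + (358111 / 1000000) * (s * s)" for s
      by (simp add: power2_diff) (simp add: field_simps power2_eq_square)
    moreover have "0 \<le> (2 * \<bar>w\<bar> - (1333 / 1000) * \<sigma>\<^sup>2)\<^sup>2 + (358111 / 1000000) * (\<sigma>\<^sup>2 * \<sigma>\<^sup>2)"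
      by simp
    ultimately have "0 \<le> 4 * w\<^sup>2 + \<sigma>\<^sup>2 * Q"
      by (smt (verit))
    then show ?thesis
      unfolding w_def .
  qed
  have "0 \<le> (\<sigma> - \<rho>)\<^sup>2 + p * Q"
  proof (cases "Q \<ge> 0")
    case True
    then show ?thesis using p by simp
  next
    case False
    then have "(\<sigma>\<^sup>2 / 4) * Q \<le> p * Q"
      using p by (intro mult_right_mono_neg) auto
    then show ?thesis
      using main by simp
  qed
  also have "\<dots> \<le> (\<sigma> - \<rho>)\<^sup>2 + p * B"
    using p \<open>Q \<le> B\<close> by (intro add_mono mult_left_mono) auto
  also have "\<dots> = (\<sigma> - \<rho>)\<^sup>2 + p * (\<rho>\<^sup>2 * (k\<^sup>2 - 2) + 2 * k * e - k * \<eta>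
      + \<sigma> * ((k + 1) * e - k * \<rho>\<^sup>2 - k * (2 * (1 - \<rho>\<^sup>2) + \<eta>))) - p\<^sup>2 * (k * (2 * (1 - \<rho>\<^sup>2) + \<eta>) - \<rho>\<^sup>2)"
    unfolding B_def by (simp add: algebra_simps power2_eq_square)
  finally show ?thesis .
qed

text \<open>Inserting two arc points into the biaffine form and clearing the denominators
  \<open>d1\<close>, \<open>d2\<close> leaves the left side, up to a factor k + 2. It is symmetric
  in \<open>r1\<close> and \<open>r2\<close>, hence a polynomial in their sum and product.\<close>

lemma arc_product_identity:
  fixes k \<rho> r1 r2 \<eta> :: real
  defines "e \<equiv> \<rho> * (2 - k * \<rho>)" and "d1 \<equiv> 1 - k * r1 + r1\<^sup>2" and "d2 \<equiv> 1 - k * r2 + r2\<^sup>2"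
    and "p \<equiv> r1 * r2" and "\<sigma> \<equiv> r1 + r2"
  shows "\<rho>\<^sup>2 * d1 * d2 - e * (r1 * d2 + r2 * d1) + (1 - \<rho>\<^sup>2) * (r1\<^sup>2 * d2 + r2\<^sup>2 * d1)
      + (k + 2) * p * ((1 - \<rho>\<^sup>2) * (1 - p) + e * \<sigma>) - (1 - \<rho>\<^sup>2 + \<eta>) * k * p * (1 + r1) * (1 + r2)
    = (\<sigma> - \<rho>)\<^sup>2 + p * (\<rho>\<^sup>2 * (k\<^sup>2 - 2) + 2 * k * e - k * \<eta>
      + \<sigma> * ((k + 1) * e - k * \<rho>\<^sup>2 - k * (2 * (1 - \<rho>\<^sup>2) + \<eta>))) - p\<^sup>2 * (k * (2 * (1 - \<rho>\<^sup>2) + \<eta>) - \<rho>\<^sup>2)"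
  unfolding assms by algebra

text \<open>In the coordinates \<open>x = Re u\<close>, \<open>z = 1 - |Im u|\<close>, with \<open>T\<^sup>2 = k / (k + 2)\<close>: the half-space condition together with
  \<open>|v|\<^sup>2 = x\<^sup>2 + z\<^sup>2 - 2 z\<close>. The points \<open>(arcx k r, r * arcx k r)\<close> parametrise the conic on which equality holds, from the
  origin (\<open>r = 0\<close>) to \<open>(k + 1, 1)\<close> (\<open>r = 1 / (k + 1)\<close>).\<close>

definition feasible :: "real \<Rightarrow> real \<Rightarrow> real \<Rightarrow> bool" where
  "feasible k x z \<longleftrightarrow> 0 \<le> z \<and> z \<le> x \<and> z \<le> 1 \<and> x\<^sup>2 + z\<^sup>2 - k * x * z \<le> (k + 2) * z"

definition arcd :: "real \<Rightarrow> real \<Rightarrow> real" where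
  "arcd k r = 1 - k * r + r\<^sup>2"

definition arcx :: "real \<Rightarrow> real \<Rightarrow> real" where
  "arcx k r = (k + 2) * r / arcd k r"

section \<open>The arc, its tangents and its convex hull\<close>

lemma arcd_pos: "0 \<le> k \<Longrightarrow> k < 2 \<Longrightarrow> 0 < arcd k r"
proof -
  assume k: "0 \<le> k" "k < 2"
  have "arcd k r = (r - k / 2)\<^sup>2 + (1 - (k / 2)\<^sup>2)"
    by (simp add: arcd_def power2_eq_square algebra_simps)
  moreover have "(k / 2)\<^sup>2 < 1\<^sup>2"
    using k by (intro power_strict_mono) auto
  ultimately show ?thesis
    by (metis add_nonneg_pos diff_gt_0_iff_gt one_power2 zero_le_power2)
qed

lemma arcx_end: "0 < k \<Longrightarrow> arcx k (1 / (k + 1)) = k + 1"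
proof -
  assume k: "0 < k"
  have "arcd k (1 / (k + 1)) = (k + 2) / (k + 1)\<^sup>2"
  proof -
    have "k + 1 \<noteq> 0"
      using k by simp
    then show ?thesis
      by (simp add: arcd_def divide_simps power2_eq_square)
  qed
  then show ?thesis
    using k by (simp add: arcx_def power2_eq_square)
qed

text \<open>The region lies in the convex hull of the arc and (1, 1): where
  \<open>z / x \<le> 1 / (k + 1)\<close> the ray from the origin meets the arc at or beyond the
  point, and all other points lie in the triangle (0, 0), (1, 1), (k + 1, 1).\<close>

lemma affine_nonneg_on_feasible:
  fixes k x z \<alpha> \<beta> \<gamma> :: real
  assumes k: "0 < k" "k < 2" and feas: "feasible k x z"
    and arc: "\<And>r. 0 \<le> r \<Longrightarrow> r \<le> 1 / (k + 1) \<Longrightarrow> 0 \<le> \<alpha> + \<beta> * arcx k r + \<gamma> * (r * arcx k r)"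
    and vertex: "0 \<le> \<alpha> + \<beta> + \<gamma>"
  shows "0 \<le> \<alpha> + \<beta> * x + \<gamma> * z"
proof -
  have zero: "0 \<le> \<alpha>"
    using arc[of 0] k by (simp add: arcx_def)
  have f: "0 \<le> z" "z \<le> x" "z \<le> 1" "x\<^sup>2 + z\<^sup>2 - k * x * z \<le> (k + 2) * z"
    using feas by (auto simp: feasible_def)
  show ?thesis
  proof (cases "z = 0")
    case True
    then have "x\<^sup>2 \<le> 0"
      using f by simp
    then have "x = 0"
      by simp
    then show ?thesis
      using True zero by simp
  next
    case False
    then have z: "0 < z" and x: "0 < x"
      using f by auto
    define r where "r = z / x"
    have zr: "z = r * x" and r0: "0 < r"
      using x z by (auto simp: r_def)
    show ?thesis
    proof (cases "r \<le> 1 / (k + 1)")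
      case True
      have d: "0 < arcd k r"
        using k by (simp add: arcd_pos)
      have "x * (x * arcd k r) \<le> x * ((k + 2) * r)"
        using f(4) unfolding zr arcd_def by (simp add: algebra_simps power2_eq_square)
      then have "x * arcd k r \<le> (k + 2) * r"
        using x by simp
      then have le: "x \<le> arcx k r"
        using d by (simp add: arcx_def pos_le_divide_eq)
      define t where "t = x / arcx k r"
      have t: "0 \<le> t" "t \<le> 1" "x = t * arcx k r"
        using le x by (auto simp: t_def)
      have "\<alpha> + \<beta> * x + \<gamma> * z = (1 - t) * \<alpha> + t * (\<alpha> + \<beta> * arcx k r + \<gamma> * (r * arcx k r))"
        unfolding zr by (subst (1 2) t(3)) (simp add: algebra_simps)
      moreover have "0 \<le> (1 - t) * \<alpha>" "0 \<le> t * (\<alpha> + \<beta> * arcx k r + \<gamma> * (r * arcx k r))"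
        using t zero arc[of r] r0 True by (auto intro!: mult_nonneg_nonneg)
      ultimately show ?thesis
        by linarith
    next
      case False
      define t where "t = (x / z - 1) / k"
      have "x / z \<le> k + 1"
        using False k z x by (simp add: r_def field_simps)
      then have t: "0 \<le> t" "t \<le> 1"
        using k z f(2) by (auto simp: t_def field_simps)
      have "x / z = 1 + k * t"
        using k by (simp add: t_def)
      then have xt: "x = z * (1 + k * t)"
        using z by (simp add: field_simps)
      have "0 \<le> \<alpha> + \<beta> * (k + 1) + \<gamma>"
        using arc[of "1 / (k + 1)"] k arcx_end[of k] by simp
      then have "0 \<le> t * (\<alpha> + \<beta> * (k + 1) + \<gamma>)" "0 \<le> (1 - t) * (\<alpha> + \<beta> + \<gamma>)"
        using t vertex by (intro mult_nonneg_nonneg; linarith)+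
      then have "0 \<le> z * ((1 - t) * (\<alpha> + \<beta> + \<gamma>) + t * (\<alpha> + \<beta> * (k + 1) + \<gamma>))" "0 \<le> (1 - z) * \<alpha>"
        using z f(3) zero by (intro mult_nonneg_nonneg; linarith)+
      then have "0 \<le> (1 - z) * \<alpha> + z * ((1 - t) * (\<alpha> + \<beta> + \<gamma>) + t * (\<alpha> + \<beta> * (k + 1) + \<gamma>))"
        by linarith
      also have "\<dots> = \<alpha> + \<beta> * x + \<gamma> * z"
        unfolding xt by (simp add: algebra_simps)
      finally show ?thesis .
    qed
  qed
qed

text \<open>Multiplied by \<open>arcd k r\<close>, the difference of the two sides is
  \<open>(k + 2) (r - \<rho>)^2\<close>: the line touches the conic at the parameter \<rho>.\<close>

lemma arc_below_tangent:
  fixes k \<rho> r :: real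
  assumes k: "0 < k" "k < 2" and \<rho>: "0 < \<rho>" "\<rho> * k < 2"
  shows "arcx k r * (\<rho> * (2 - k * \<rho>)) - (1 - \<rho>\<^sup>2) * (r * arcx k r) \<le> (k + 2) * \<rho>\<^sup>2"
proof -
  have d: "0 < arcd k r"
    using k by (simp add: arcd_pos)
  have "(k + 2) * \<rho>\<^sup>2 * arcd k r - ((k + 2) * r * (\<rho> * (2 - k * \<rho>)) - (1 - \<rho>\<^sup>2) * (r * ((k + 2) * r)))
      = (k + 2) * (r - \<rho>)\<^sup>2"
    unfolding arcd_def by algebra
  moreover have "0 \<le> (k + 2) * (r - \<rho>)\<^sup>2"
    using k by simp
  ultimately have "(k + 2) * r * (\<rho> * (2 - k * \<rho>)) - (1 - \<rho>\<^sup>2) * (r * ((k + 2) * r)) \<le> (k + 2) * \<rho>\<^sup>2 * arcd k r"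
    by linarith
  then have "((k + 2) * r * (\<rho> * (2 - k * \<rho>)) - (1 - \<rho>\<^sup>2) * (r * ((k + 2) * r))) / arcd k r \<le> (k + 2) * \<rho>\<^sup>2"
    using d by (simp add: pos_divide_le_eq)
  moreover have "arcx k r * E - F * (r * arcx k r) = ((k + 2) * r * E - F * (r * ((k + 2) * r))) / arcd k r" for E F
    by (simp add: arcx_def diff_divide_distrib)
  ultimately show ?thesis
    by simp
qed

text \<open>The arc lies in the triangle (0, 0), (1, 0), (k + 1, 1), bounded by the tangents at its
  two ends and the chord between them.\<close>

lemma arc_region:
  fixes k r :: real
  assumes k: "0 < k" "k < 2" and r: "0 \<le> r" "r \<le> 1 / (k + 1)"
  shows "0 \<le> r * arcx k r" "r * arcx k r \<le> 1" "(k + 1) * (r * arcx k r) \<le> arcx k r" "arcx k r \<le> 1 + k * (r * arcx k r)"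
proof -
  have d: "0 < arcd k r"
    using k by (simp add: arcd_pos)
  have x: "0 \<le> arcx k r"
    using d k r by (simp add: arcx_def)
  then show "0 \<le> r * arcx k r"
    using r by simp
  have "(k + 1) * r \<le> 1"
    using r k by (simp add: field_simps)
  then have "((k + 1) * r) * arcx k r \<le> 1 * arcx k r"
    using x by (intro mult_right_mono) auto
  then show *: "(k + 1) * (r * arcx k r) \<le> arcx k r"
    by (simp add: mult.assoc)
  have "1 / (k + 1) * k < 2"
    using k by (simp add: field_simps)
  then have "arcx k r * (1 / (k + 1) * (2 - k * (1 / (k + 1)))) - (1 - (1 / (k + 1))\<^sup>2) * (r * arcx k r) \<le> (k + 2) * (1 / (k + 1))\<^sup>2"
    using k by (intro arc_below_tangent) auto
  moreover have "1 / (k + 1) * (2 - k * (1 / (k + 1))) = (k + 2) / (k + 1)\<^sup>2" "1 - (1 / (k + 1))\<^sup>2 = k * (k + 2) / (k + 1)\<^sup>2"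
  proof -
    define c where "c = k + 1"
    have c: "k = c - 1" "c \<noteq> 0" "k + 1 = c"
      using k by (auto simp: c_def)
    show "1 / (k + 1) * (2 - k * (1 / (k + 1))) = (k + 2) / (k + 1)\<^sup>2" "1 - (1 / (k + 1))\<^sup>2 = k * (k + 2) / (k + 1)\<^sup>2"
      unfolding c(3) unfolding c(1) using c(2) by (simp_all add: power2_eq_square field_simps)
  qed
  moreover have "(k + 2) / (k + 1)\<^sup>2 * (arcx k r - k * (r * arcx k r))
      = arcx k r * ((k + 2) / (k + 1)\<^sup>2) - k * (k + 2) / (k + 1)\<^sup>2 * (r * arcx k r)"
    "(k + 2) * (1 / (k + 1))\<^sup>2 = (k + 2) / (k + 1)\<^sup>2 * 1"
  proof -
    have "k * (k + 2) / (k + 1)\<^sup>2 = k * ((k + 2) / (k + 1)\<^sup>2)"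
      by simp
    then show "(k + 2) / (k + 1)\<^sup>2 * (arcx k r - k * (r * arcx k r))
      = arcx k r * ((k + 2) / (k + 1)\<^sup>2) - k * (k + 2) / (k + 1)\<^sup>2 * (r * arcx k r)"
      by (simp only: right_diff_distrib left_diff_distrib mult.commute mult.left_commute mult.assoc)
  qed (simp add: power_divide)
  ultimately have "(k + 2) / (k + 1)\<^sup>2 * (arcx k r - k * (r * arcx k r)) \<le> (k + 2) / (k + 1)\<^sup>2 * 1"
    by metis
  moreover have "0 < (k + 2) / (k + 1)\<^sup>2"
    using k by simp
  ultimately have "arcx k r - k * (r * arcx k r) \<le> 1"
    by (simp only: mult_le_cancel_left_pos)
  then show **: "arcx k r \<le> 1 + k * (r * arcx k r)"
    by simp
  show "r * arcx k r \<le> 1"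
    using * ** by (simp add: algebra_simps)
qed

lemma feasible_arc:
  fixes k r :: real
  assumes k: "0 < k" "k < 2" and r: "0 \<le> r" "r \<le> 1 / (k + 1)"
  shows "feasible k (arcx k r) (r * arcx k r)"
proof -
  note region = arc_region[OF k r]
  have "0 \<le> k * (r * arcx k r)"
    using k region(1) by simp
  then have "r * arcx k r \<le> arcx k r"
    using region(3) unfolding distrib_right by linarith
  moreover have "arcx k r * arcd k r = (k + 2) * r"
    using arcd_pos[of k r] k by (simp add: arcx_def)
  then have "arcx k r * (arcx k r * arcd k r) = (k + 2) * (r * arcx k r)"
    by simp
  then have "(arcx k r)\<^sup>2 + (r * arcx k r)\<^sup>2 - k * arcx k r * (r * arcx k r) = (k + 2) * (r * arcx k r)"
    by (simp add: arcd_def algebra_simps power2_eq_square)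
  ultimately show ?thesis
    using region unfolding feasible_def by simp
qed

lemma affine_nonneg_on_triangle:
  fixes k x z \<alpha> \<beta> \<gamma> :: real
  assumes z: "0 \<le> z" "z \<le> 1" and x: "(k + 1) * z \<le> x" "x \<le> 1 + k * z"
    and v: "0 \<le> \<alpha>" "0 \<le> \<alpha> + \<beta>" "0 \<le> \<alpha> + \<beta> * (k + 1) + \<gamma>"
  shows "0 \<le> \<alpha> + \<beta> * x + \<gamma> * z"
proof -
  define u where "u = x - (k + 1) * z"
  have u: "0 \<le> u" "u \<le> 1 - z"
    using x by (auto simp: u_def algebra_simps)
  have "\<alpha> + \<beta> * x + \<gamma> * z = z * (\<alpha> + \<beta> * (k + 1) + \<gamma>) + (1 - z - u) * \<alpha> + u * (\<alpha> + \<beta>)"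
    by (simp add: u_def algebra_simps)
  moreover have "0 \<le> z * (\<alpha> + \<beta> * (k + 1) + \<gamma>)" "0 \<le> (1 - z - u) * \<alpha>" "0 \<le> u * (\<alpha> + \<beta>)"
    using z u v by (auto intro!: mult_nonneg_nonneg simp del: mult_nonneg_nonneg)
  ultimately show ?thesis
    by linarith
qed

text \<open>The form is affine in each factor separately, so both can be moved to the arc or to (1,
  1). Two arc points lead to \<open>arc_quadratic\<close>. With one factor at (1, 1) it suffices to
  replace the arc of the other by the triangle around it.\<close>

lemma left_biaffine:
  fixes k \<rho> \<eta> x1 z1 x2 z2 :: real
  assumes k: "(1509 / 1000) \<le> k" "k \<le> (151 / 100)" and \<rho>: "0 \<le> \<rho>" "\<rho> * (k + 1) \<le> 1"
    and \<eta>: "0 \<le> \<eta>" "\<eta> \<le> 2 * \<rho>\<^sup>2"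
    and f: "feasible k x1 z1" "feasible k x2 z2"
  defines "e \<equiv> \<rho> * (2 - k * \<rho>)"
  shows "0 \<le> (k + 2) * \<rho>\<^sup>2 - e * (x1 + x2) + (1 - \<rho>\<^sup>2) * (z1 + z2 + x1 * x2 - z1 * z2) + e * (x1 * z2 + x2 * z1)
     - (1 - \<rho>\<^sup>2 + \<eta>) * (k / (k + 2)) * ((x1 + z1) * (x2 + z2))"
proof -
  define N where "N = (1 - \<rho>\<^sup>2 + \<eta>) * (k / (k + 2))"
  have k0: "0 < k" "k < 2" using k by auto
  have \<rho>4: "\<rho> \<le> (4 / 10)"
  proof (rule ccontr)
    assume "\<not> \<rho> \<le> (4 / 10)"
    then have "(4 / 10) * (2509 / 1000) \<le> \<rho> * (k + 1)"
      using k by (intro mult_mono) auto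
    then show False
      using \<rho> by simp
  qed
  then have "\<rho>\<^sup>2 \<le> (4 / 10)\<^sup>2"
    using \<rho> by (intro power_mono) auto
  then have \<rho>2: "\<rho>\<^sup>2 \<le> (16 / 100)"
    by (simp add: power2_eq_square)
  have "k / (k + 2) \<le> (4302 / 10000)"
    using k by (simp add: field_simps)
  then have "N \<le> (1 + \<rho>\<^sup>2) * (4302 / 10000)"
    unfolding N_def using \<eta> k0 by (intro mult_mono) auto
  then have N: "N \<le> (4302 / 10000) + (4302 / 10000) * \<rho>\<^sup>2"
    by (simp add: algebra_simps)
  have e: "e = 2 * \<rho> - k * \<rho>\<^sup>2" "(1509 / 1000) * \<rho>\<^sup>2 \<le> k * \<rho>\<^sup>2"
    using k by (simp add: e_def algebra_simps power2_eq_square) (intro mult_right_mono, use k in auto)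
  have arcs: "0 \<le> (k + 2) * \<rho>\<^sup>2 - e * (arcx k r1 + arcx k r2)
      + (1 - \<rho>\<^sup>2) * (r1 * arcx k r1 + r2 * arcx k r2 + arcx k r1 * arcx k r2 - r1 * arcx k r1 * (r2 * arcx k r2))
      + e * (arcx k r1 * (r2 * arcx k r2) + arcx k r2 * (r1 * arcx k r1))
      - N * ((arcx k r1 + r1 * arcx k r1) * (arcx k r2 + r2 * arcx k r2))"
    if r: "0 \<le> r1" "r1 \<le> 1 / (k + 1)" "0 \<le> r2" "r2 \<le> 1 / (k + 1)" for r1 r2
  proof -
    define d1 d2 where "d1 = arcd k r1" and "d2 = arcd k r2"
    have d: "0 < d1" "0 < d2"
      using k0 by (simp_all add: d1_def d2_def arcd_pos)
    have "1 / (k + 1) \<le> (4 / 10)"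
      using k by (simp add: field_simps)
    then have "r1 + r2 \<le> (8 / 10)"
      using r by linarith
    moreover have "4 * (r1 * r2) \<le> (r1 + r2)\<^sup>2"
      using zero_le_power2[of "r1 - r2"] by (simp add: power2_eq_square algebra_simps)
    ultimately have H: "0 \<le> \<rho>\<^sup>2 * d1 * d2 - e * (r1 * d2 + r2 * d1) + (1 - \<rho>\<^sup>2) * (r1\<^sup>2 * d2 + r2\<^sup>2 * d1)
      + (k + 2) * (r1 * r2) * ((1 - \<rho>\<^sup>2) * (1 - r1 * r2) + e * (r1 + r2)) - (1 - \<rho>\<^sup>2 + \<eta>) * k * (r1 * r2) * (1 + r1) * (1 + r2)"
      unfolding d1_def d2_def arcd_def e_def arc_product_identity
      by (intro arc_quadratic) (use k \<rho> \<eta> r in auto)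
    have x: "arcx k r1 = (k + 2) * r1 / d1" "arcx k r2 = (k + 2) * r2 / d2"
      by (simp_all add: arcx_def d1_def d2_def)
    have Nk: "(k + 2) * N = (1 - \<rho>\<^sup>2 + \<eta>) * k"
      using k0 by (simp add: N_def)
    have "(k + 2) * \<rho>\<^sup>2 - e * (arcx k r1 + arcx k r2)
      + (1 - \<rho>\<^sup>2) * (r1 * arcx k r1 + r2 * arcx k r2 + arcx k r1 * arcx k r2 - r1 * arcx k r1 * (r2 * arcx k r2))
      + e * (arcx k r1 * (r2 * arcx k r2) + arcx k r2 * (r1 * arcx k r1))
      - N * ((arcx k r1 + r1 * arcx k r1) * (arcx k r2 + r2 * arcx k r2))
      = (k + 2) / (d1 * d2) * (\<rho>\<^sup>2 * d1 * d2 - e * (r1 * d2 + r2 * d1) + (1 - \<rho>\<^sup>2) * (r1\<^sup>2 * d2 + r2\<^sup>2 * d1)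
      + (k + 2) * (r1 * r2) * ((1 - \<rho>\<^sup>2) * (1 - r1 * r2) + e * (r1 + r2)) - ((k + 2) * N) * (r1 * r2) * (1 + r1) * (1 + r2))"
      unfolding x using d by (simp add: field_simps power2_eq_square)
    also have "\<dots> \<ge> 0"
      unfolding Nk using H d k0 by (intro mult_nonneg_nonneg) auto
    finally show ?thesis .
  qed
  have vertex: "0 \<le> (k + 2) * \<rho>\<^sup>2 - e * (1 + x) + (1 - \<rho>\<^sup>2) * (1 + z + 1 * x - 1 * z) + e * (1 * z + x * 1) - N * ((1 + 1) * (x + z))"
    if "feasible k x z" for x z
  proof -
    have "0 \<le> ((k + 2) * \<rho>\<^sup>2 - e + (1 - \<rho>\<^sup>2)) + (1 - \<rho>\<^sup>2 - 2 * N) * x + (e - 2 * N) * z"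
    proof (rule affine_nonneg_on_feasible[OF k0 that])
      fix r assume "0 \<le> r" "r \<le> 1 / (k + 1)"
      note region = arc_region[OF k0 this]
      have q: "0 \<le> 1 - 2 * \<rho> + (12 / 10) * \<rho>\<^sup>2"
        using \<rho>4 \<rho> zero_le_power2[of \<rho>] by auto
      have kr: "(1509 / 1000) * \<rho>\<^sup>2 \<le> k * \<rho>\<^sup>2"
        by (rule e(2))
      show "0 \<le> ((k + 2) * \<rho>\<^sup>2 - e + (1 - \<rho>\<^sup>2)) + (1 - \<rho>\<^sup>2 - 2 * N) * arcx k r + (e - 2 * N) * (r * arcx k r)"
      proof (rule affine_nonneg_on_triangle[of _ k, OF region])
        show "0 \<le> (k + 2) * \<rho>\<^sup>2 - e + (1 - \<rho>\<^sup>2)"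
          using q kr zero_le_power2[of \<rho>] unfolding e(1) distrib_right by linarith
        show "0 \<le> (k + 2) * \<rho>\<^sup>2 - e + (1 - \<rho>\<^sup>2) + (1 - \<rho>\<^sup>2 - 2 * N)"
          using q kr N zero_le_power2[of \<rho>] \<rho>2 \<rho>4 unfolding e(1) distrib_right by linarith
        have "0 \<le> (k + 2) * (1 - 2 * N)"
          using N \<rho>2 k0 by (intro mult_nonneg_nonneg) auto
        also have "\<dots> = (k + 2) * \<rho>\<^sup>2 - e + (1 - \<rho>\<^sup>2) + (1 - \<rho>\<^sup>2 - 2 * N) * (k + 1) + (e - 2 * N)"
          by (simp add: algebra_simps)
        finally show "0 \<le> (k + 2) * \<rho>\<^sup>2 - e + (1 - \<rho>\<^sup>2) + (1 - \<rho>\<^sup>2 - 2 * N) * (k + 1) + (e - 2 * N)" .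
      qed
    next
      have "0 \<le> k * \<rho>\<^sup>2"
        using k0 by simp
      then show "0 \<le> ((k + 2) * \<rho>\<^sup>2 - e + (1 - \<rho>\<^sup>2)) + (1 - \<rho>\<^sup>2 - 2 * N) + (e - 2 * N)"
        using N \<rho>2 unfolding distrib_right by linarith
    qed
    then show ?thesis
      by (simp add: algebra_simps)
  qed
  have "0 \<le> ((k + 2) * \<rho>\<^sup>2 - e * x2 + (1 - \<rho>\<^sup>2) * z2) + (- e + (1 - \<rho>\<^sup>2) * x2 + e * z2 - N * (x2 + z2)) * x1
     + ((1 - \<rho>\<^sup>2) * (1 - z2) + e * x2 - N * (x2 + z2)) * z1"
  proof (rule affine_nonneg_on_feasible[OF k0 f(1)])
    fix r1 assume r1: "0 \<le> r1" "r1 \<le> 1 / (k + 1)"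
    let ?x = "arcx k r1" let ?z = "r1 * arcx k r1"
    have "0 \<le> ((k + 2) * \<rho>\<^sup>2 - e * ?x + (1 - \<rho>\<^sup>2) * ?z) + (- e + (1 - \<rho>\<^sup>2) * ?x + e * ?z - N * (?x + ?z)) * x2
       + ((1 - \<rho>\<^sup>2) * (1 - ?z) + e * ?x - N * (?x + ?z)) * z2"
    proof (rule affine_nonneg_on_feasible[OF k0 f(2)])
      fix r2 assume "0 \<le> r2" "r2 \<le> 1 / (k + 1)"
      from arcs[OF r1 this] show "0 \<le> ((k + 2) * \<rho>\<^sup>2 - e * ?x + (1 - \<rho>\<^sup>2) * ?z) + (- e + (1 - \<rho>\<^sup>2) * ?x + e * ?z - N * (?x + ?z)) * arcx k r2
       + ((1 - \<rho>\<^sup>2) * (1 - ?z) + e * ?x - N * (?x + ?z)) * (r2 * arcx k r2)"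
        by (simp add: algebra_simps)
    next
      have "feasible k ?x ?z"
        by (rule feasible_arc[OF k0 r1])
      from vertex[OF this] show "0 \<le> ((k + 2) * \<rho>\<^sup>2 - e * ?x + (1 - \<rho>\<^sup>2) * ?z) + (- e + (1 - \<rho>\<^sup>2) * ?x + e * ?z - N * (?x + ?z))
       + ((1 - \<rho>\<^sup>2) * (1 - ?z) + e * ?x - N * (?x + ?z))"
        by (simp add: algebra_simps)
    qed
    then show "0 \<le> ((k + 2) * \<rho>\<^sup>2 - e * x2 + (1 - \<rho>\<^sup>2) * z2) + (- e + (1 - \<rho>\<^sup>2) * x2 + e * z2 - N * (x2 + z2)) * ?x
     + ((1 - \<rho>\<^sup>2) * (1 - z2) + e * x2 - N * (x2 + z2)) * ?z"
      by (simp add: algebra_simps)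
  next
    from vertex[OF f(2)] show "0 \<le> ((k + 2) * \<rho>\<^sup>2 - e * x2 + (1 - \<rho>\<^sup>2) * z2) + (- e + (1 - \<rho>\<^sup>2) * x2 + e * z2 - N * (x2 + z2))
     + ((1 - \<rho>\<^sup>2) * (1 - z2) + e * x2 - N * (x2 + z2))"
      by (simp add: algebra_simps)
  qed
  then show ?thesis
    unfolding N_def[symmetric] by (simp add: algebra_simps)
qed

text \<open>The second and third vertex lie slightly outside the conic: they are read off the tangents at \<open>r = 1/5\<close> and at the
  end point.\<close>

lemma affine_nonneg_on_polygon:
  fixes k x z \<alpha> \<beta> \<gamma> :: real
  assumes k: "1509 / 1000 \<le> k" "k \<le> 15094 / 10000" and feas: "feasible k x z"
    and v: "0 \<le> \<alpha>" "0 \<le> \<alpha> + \<beta> * (4134 / 10000)" "0 \<le> \<alpha> + \<beta> * (16718 / 10000) + \<gamma> * (445 / 1000)"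
      "0 \<le> \<alpha> + \<beta> * (k + 1) + \<gamma>" "0 \<le> \<alpha> + \<beta> + \<gamma>"
  shows "0 \<le> \<alpha> + \<beta> * x + \<gamma> * z"
proof (rule affine_nonneg_on_feasible[OF _ _ feas _ v(5)])
  show k0: "0 < k" "k < 2"
    using k by auto
  have between: "0 \<le> \<alpha> + \<beta> * x + \<gamma> * z"
    if "l \<le> x" "x \<le> u" "0 \<le> \<alpha> + \<beta> * l + \<gamma> * z" "0 \<le> \<alpha> + \<beta> * u + \<gamma> * z" for l u x z :: real
  proof (cases "\<beta> \<ge> 0")
    case True
    then have "\<beta> * l \<le> \<beta> * x"
      using that by (intro mult_left_mono) auto
    then show ?thesis using that by linarith
  next
    case False
    then have "\<beta> * u \<le> \<beta> * x"
      using that by (intro mult_left_mono_neg) auto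
    then show ?thesis using that by linarith
  qed
  fix r assume r: "0 \<le> r" "r \<le> 1 / (k + 1)"
  define X Z where "X = arcx k r" and "Z = r * arcx k r"
  have reg: "0 \<le> Z" "Z \<le> 1" "(k + 1) * Z \<le> X" "X \<le> 1 + k * Z"
    using arc_region[OF k0 r] by (simp_all add: X_def Z_def)
  have tang: "X * (1 / 5 * (2 - k * (1 / 5))) - (1 - (1 / 5)\<^sup>2) * Z \<le> (k + 2) * (1 / 5)\<^sup>2"
    unfolding X_def Z_def using k by (intro arc_below_tangent) auto
  then have "X * (10 - k) \<le> k + 2 + 24 * Z"
    by (simp add: power2_eq_square algebra_simps)
  moreover have "X * (84906 / 10000) \<le> X * (10 - k)"
    using k reg by (intro mult_left_mono) (auto intro: order_trans[OF _ reg(3)])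
  ultimately have t: "X * (84906 / 10000) \<le> 35094 / 10000 + 24 * Z"
    using k by linarith
  have left: "0 \<le> \<alpha> + \<beta> * ((k + 1) * Z) + \<gamma> * Z"
  proof -
    have "0 \<le> (1 - Z) * \<alpha>" "0 \<le> Z * (\<alpha> + \<beta> * (k + 1) + \<gamma>)"
      using reg v by (intro mult_nonneg_nonneg; linarith)+
    moreover have "\<alpha> + \<beta> * ((k + 1) * Z) + \<gamma> * Z = (1 - Z) * \<alpha> + Z * (\<alpha> + \<beta> * (k + 1) + \<gamma>)"
      by (simp add: algebra_simps)
    ultimately show ?thesis by linarith
  qed
  have "0 \<le> \<alpha> + \<beta> * X + \<gamma> * Z"
  proof (cases "Z \<le> 445 / 1000")
    case True
    define s where "s = Z / (445 / 1000)"
    have s: "0 \<le> s" "s \<le> 1" "Z = (445 / 1000) * s"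
      using True reg by (auto simp: s_def)
    let ?u = "(1 - s) * (4134 / 10000) + s * (16718 / 10000)"
    have "X \<le> ?u"
      using t s(1,2) unfolding s(3) by (simp add: field_simps)
    moreover have "0 \<le> (1 - s) * (\<alpha> + \<beta> * (4134 / 10000))" "0 \<le> s * (\<alpha> + \<beta> * (16718 / 10000) + \<gamma> * (445 / 1000))"
      using s v by (intro mult_nonneg_nonneg; linarith)+
    moreover have "\<alpha> + \<beta> * ?u + \<gamma> * Z = (1 - s) * (\<alpha> + \<beta> * (4134 / 10000)) + s * (\<alpha> + \<beta> * (16718 / 10000) + \<gamma> * (445 / 1000))"
      unfolding s(3) by (simp add: algebra_simps)
    ultimately show ?thesis
      using between[OF reg(3) _ left] by simp
  next
    case False
    define s where "s = (Z - 445 / 1000) / (555 / 1000)"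
    have s: "0 \<le> s" "s \<le> 1" "Z = (1 - s) * (445 / 1000) + s"
      using False reg by (auto simp: s_def field_simps)
    let ?u = "(1 - s) * (16718 / 10000) + s * (k + 1)"
    have "(1 - s) * (1 + k * (445 / 1000)) \<le> (1 - s) * (16718 / 10000)"
      using s k by (intro mult_left_mono) auto
    moreover have "1 + k * Z = (1 - s) * (1 + k * (445 / 1000)) + s * (k + 1)"
      unfolding s(3) by (simp add: algebra_simps)
    ultimately have "X \<le> ?u"
      using reg(4) by linarith
    moreover have "0 \<le> (1 - s) * (\<alpha> + \<beta> * (16718 / 10000) + \<gamma> * (445 / 1000))" "0 \<le> s * (\<alpha> + \<beta> * (k + 1) + \<gamma>)"
      using s v by (intro mult_nonneg_nonneg; linarith)+
    moreover have "\<alpha> + \<beta> * ?u + \<gamma> * Z = (1 - s) * (\<alpha> + \<beta> * (16718 / 10000) + \<gamma> * (445 / 1000)) + s * (\<alpha> + \<beta> * (k + 1) + \<gamma>)"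
      unfolding s(3) by (simp add: algebra_simps)
    ultimately show ?thesis
      using between[OF reg(3) _ left] by simp
  qed
  then show "0 \<le> \<alpha> + \<beta> * arcx k r + \<gamma> * (r * arcx k r)"
    by (simp add: X_def Z_def)
qed

text \<open>Being symmetric and affine in each factor, the form is controlled by its values at pairs
  of polygon vertices.\<close>

lemma biaffine_nonneg_on_polygon:
  fixes k m M G :: real
  defines "F \<equiv> \<lambda>x1 z1 x2 z2. G - (m * ((1 - z1) * (1 - z2) - x1 * x2) + x1 * (1 - z2) + x2 * (1 - z1)
    + M * (k / (k + 2)) * ((x1 + z1) * (x2 + z2)))"
    and "V \<equiv> {(0, 0), (4134 / 10000, 0), (16718 / 10000, 445 / 1000), (k + 1, 1), (1, 1)}"
  assumes k: "1509 / 1000 \<le> k" "k \<le> 15094 / 10000"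
    and vertices: "\<And>v w. v \<in> V \<Longrightarrow> w \<in> V \<Longrightarrow> 0 \<le> F (fst v) (snd v) (fst w) (snd w)"
    and f: "feasible k x1 z1" "feasible k x2 z2"
  shows "0 \<le> F x1 z1 x2 z2"
proof -
  define N where "N = M * (k / (k + 2))"
  have aff: "F x z x' z' = (G - m * (1 - z') - x') + (m * x' - (1 - z') - N * (x' + z')) * x + (m * (1 - z') + x' - N * (x' + z')) * z" for x z x' z'
    unfolding F_def N_def[symmetric] by (simp add: algebra_simps)
  have sym: "F x z x' z' = F x' z' x z" for x z x' z'
    unfolding F_def N_def[symmetric] by (simp add: algebra_simps)
  have step: "0 \<le> F x z x' z'" if "feasible k x z" and *: "\<And>v. v \<in> V \<Longrightarrow> 0 \<le> F (fst v) (snd v) x' z'" for x z x' z'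
    unfolding aff
  proof (rule affine_nonneg_on_polygon[OF k that(1)])
  qed (use *[of "(0, 0)"] *[of "(4134 / 10000, 0)"] *[of "(16718 / 10000, 445 / 1000)"] *[of "(k + 1, 1)"] *[of "(1, 1)"]
      in \<open>simp_all add: V_def aff\<close>)
  show ?thesis
  proof (rule step[OF f(1)])
    fix v assume "v \<in> V"
    then show "0 \<le> F (fst v) (snd v) x2 z2"
      by (subst sym, intro step[OF f(2)], subst sym, intro vertices)
  qed
qed

text \<open>The first bound is attained at (0, 0) and (k + 1, 1), the extremal pair. The factor
  1.2561 exceeds \<open>sqrt (1 + 0.76^2)\<close>, the norm of the functional. Moving the point (0,
  0) along the tangent direction (1, 0) of the arc changes the left side by
  \<open>1.2561 k - 0.76 (k + 1) < 0\<close> per unit; a slope m must therefore be at least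
  \<open>k / sqrt (2 k + 1)\<close>, about 0.753, whence 0.76.\<close>

lemma right_biaffine:
  assumes k: "1509 / 1000 \<le> k" "k \<le> 15094 / 10000" and f: "feasible k x1 z1" "feasible k x2 z2"
  shows "(76 / 100) * ((1 - z1) * (1 - z2) - x1 * x2) + x1 * (1 - z2) + x2 * (1 - z1)
    + (12561 / 10000) * (k / (k + 2)) * ((x1 + z1) * (x2 + z2)) \<le> k + 1"
    and "x1 * (1 - z2) + x2 * (1 - z1) + k / (k + 2) * ((x1 + z1) * (x2 + z2)) \<le> 53 / 10"
proof -
  define \<tau> where "\<tau> = k / (k + 2)"
  have \<tau>: "0 \<le> \<tau>" "\<tau> \<le> 4302 / 10000" "\<tau> * (k + 2) = k"
    using k by (auto simp: \<tau>_def field_simps)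
  have \<tau>k: "\<tau> * k = k - 2 * \<tau>"
    using \<tau>(3) by (simp add: algebra_simps)
  have \<tau>kx: "\<tau> * (k * x) = k * x - 2 * (\<tau> * x)" for x
    using arg_cong[OF \<tau>k, of "\<lambda>y. y * x"] by (simp add: algebra_simps)
  have kk: "k * k \<le> 22783 / 10000" "k * k \<ge> 2277 / 1000"
    using mult_mono[OF k(2) k(2)] mult_mono[OF k(1) k(1)] k by auto
  \<comment> \<open>The relation \<open>\<tau> * (k + 2) = k\<close> reduces every product that
    occurs at the vertices to a linear expression in k, \<tau> and \<open>K\<close>; bounds on these
    three then decide.\<close>
  define K where "K = k * k"
  have KK: "k * k = K" "k * (k * x) = K * x" for x
    by (simp_all add: K_def)
  have K: "K \<le> 22783 / 10000" "K \<ge> 2277 / 1000"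
    using kk by (auto simp: K_def)
  have "\<tau> * k * k = K - 2 * k + 4 * \<tau>"
    unfolding \<tau>k by (simp add: algebra_simps K_def \<tau>k \<tau>kx)
  then have K\<tau>: "K * \<tau> = K - 2 * k + 4 * \<tau>"
    by (simp add: K_def mult_ac)
  have K\<tau>x: "K * (\<tau> * x) = K * x - 2 * (k * x) + 4 * (\<tau> * x)" for x
    using arg_cong[OF K\<tau>, of "\<lambda>y. y * x"] by (simp add: algebra_simps)
  have "0 \<le> k + 1 - ((76 / 100) * ((1 - z1) * (1 - z2) - x1 * x2) + x1 * (1 - z2) + x2 * (1 - z1)
    + (12561 / 10000) * (k / (k + 2)) * ((x1 + z1) * (x2 + z2)))"
  proof (rule biaffine_nonneg_on_polygon[OF k _ f], unfold \<tau>_def[symmetric])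
    fix v w :: "real \<times> real"
    assume "v \<in> {(0, 0), (4134 / 10000, 0), (16718 / 10000, 445 / 1000), (k + 1, 1), (1, 1)}"
      "w \<in> {(0, 0), (4134 / 10000, 0), (16718 / 10000, 445 / 1000), (k + 1, 1), (1, 1)}"
    then show "0 \<le> k + 1 - ((76 / 100) * ((1 - snd v) * (1 - snd w) - fst v * fst w) + fst v * (1 - snd w) + fst w * (1 - snd v)
    + (12561 / 10000) * \<tau> * ((fst v + snd v) * (fst w + snd w)))"
      using k \<tau>(1,2) K
      by (elim insertE emptyE)
        (simp_all add: algebra_simps \<tau>k \<tau>kx KK K\<tau> K\<tau>x add_divide_distrib diff_divide_distrib)
  qed
  then show "(76 / 100) * ((1 - z1) * (1 - z2) - x1 * x2) + x1 * (1 - z2) + x2 * (1 - z1)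
    + (12561 / 10000) * (k / (k + 2)) * ((x1 + z1) * (x2 + z2)) \<le> k + 1"
    by simp
  have "0 \<le> 53 / 10 - (0 * ((1 - z1) * (1 - z2) - x1 * x2) + x1 * (1 - z2) + x2 * (1 - z1)
    + 1 * (k / (k + 2)) * ((x1 + z1) * (x2 + z2)))"
  proof (rule biaffine_nonneg_on_polygon[OF k _ f], unfold \<tau>_def[symmetric])
    fix v w :: "real \<times> real"
    assume "v \<in> {(0, 0), (4134 / 10000, 0), (16718 / 10000, 445 / 1000), (k + 1, 1), (1, 1)}"
      "w \<in> {(0, 0), (4134 / 10000, 0), (16718 / 10000, 445 / 1000), (k + 1, 1), (1, 1)}"
    then show "0 \<le> 53 / 10 - (0 * ((1 - snd v) * (1 - snd w) - fst v * fst w) + fst v * (1 - snd w) + fst w * (1 - snd v)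
    + 1 * \<tau> * ((fst v + snd v) * (fst w + snd w)))"
      using k \<tau>(1,2) K
      by (elim insertE emptyE)
        (simp_all add: algebra_simps \<tau>k \<tau>kx KK K\<tau> K\<tau>x add_divide_distrib diff_divide_distrib)
  qed
  then show "x1 * (1 - z2) + x2 * (1 - z1) + k / (k + 2) * ((x1 + z1) * (x2 + z2)) \<le> 53 / 10"
    by simp
qed

section \<open>Separation of exponentials and of their products\<close>

text \<open>The parameter for which the conic ends at \<open>(cosh (pi / 2), 1)\<close>, the point
  of \<open>exp (pi/2 diag (1, -1))\<close>.\<close>

definition \<kappa> :: real where "\<kappa> = cosh (pi / 2) - 1"

lemma cosh_pi_half: "cosh (pi / 2) = \<kappa> + 1"
  by (simp add: \<kappa>_def)

lemma \<kappa>_bounds: "1509 / 1000 \<le> \<kappa>" "\<kappa> \<le> 15094 / 10000"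
  using cosh_pi_half_bounds by (auto simp: \<kappa>_def)

lemma \<T>_sq: "\<T>\<^sup>2 = \<kappa> / (\<kappa> + 2)"
proof -
  have "\<T>\<^sup>2 * (\<kappa> + 2) = \<kappa>"
    using \<T>_cosh by (simp add: \<kappa>_def add.commute)
  then show ?thesis
    using \<kappa>_bounds by (simp add: eq_divide_eq)
qed

lemma \<T>_pos: "0 < \<T>" and \<T>_less_1: "\<T> < 1"
  using \<T>_bounds by auto

section \<open>Exponentials satisfy the half-space condition, with room for a rotation\<close>

lemma snq_nonneg: "\<bar>q\<bar> \<le> (pi / 2)\<^sup>2 \<Longrightarrow> 0 \<le> snq q"
proof -
  assume q: "\<bar>q\<bar> \<le> (pi / 2)\<^sup>2"
  then have r: "sqrt \<bar>q\<bar> \<le> pi / 2"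
    using pi_gt_zero by (intro real_le_lsqrt) auto
  then show ?thesis
    using pi_ge_zero by (auto simp: snq_def intro!: divide_nonneg_nonneg sin_ge_zero intro: order_trans[of _ "pi / 2"])
qed

lemma csq_nonneg: "\<bar>q\<bar> \<le> (pi / 2)\<^sup>2 \<Longrightarrow> 0 \<le> csq q"
proof -
  assume q: "\<bar>q\<bar> \<le> (pi / 2)\<^sup>2"
  then have r: "sqrt \<bar>q\<bar> \<le> pi / 2"
    using pi_gt_zero by (intro real_le_lsqrt) auto
  have "0 \<le> cos (sqrt q)" if "q \<ge> 0"
  proof (rule cos_ge_zero)
    show "- (pi / 2) \<le> sqrt q"
      using that pi_gt_zero by (intro order_trans[of "- (pi / 2)" 0 "sqrt q"]) auto
  qed (use r that in auto)
  then show ?thesis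
    by (auto simp: csq_def)
qed

text \<open>The quotient \<open>csq q / snq q\<close> is \<open>\<phi> cot \<phi> \<le> 1\<close>
  for \<open>q = \<phi>^2\<close> and \<open>x coth x \<le> 1 + x\<close> for
  \<open>q = - x^2\<close>. It allows \<open>snq q\<close> to be taken out of the loss caused by a
  rotation.\<close>

lemma csq_le_snq:
  assumes q: "\<bar>q\<bar> \<le> (pi / 2)\<^sup>2" and t: "0 \<le> t" "- q \<le> t\<^sup>2"
  shows "csq q \<le> snq q * (1 + t)"
proof -
  have r: "sqrt \<bar>q\<bar> \<le> pi / 2"
    using q pi_gt_zero by (intro real_le_lsqrt) auto
  consider "q > 0" | "q = 0" | "q < 0" by linarith
  then show ?thesis
  proof cases
    case 1
    define x where "x = sqrt q"
    have x: "0 < x" "x \<le> pi / 2"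
      using 1 r by (auto simp: x_def)
    have "x * cos x \<le> sin x * 1"
    proof (cases "x = pi / 2")
      case False
      then have c: "cos x > 0"
        using x by (intro cos_gt_zero_pi) auto
      have "x \<le> tan x"
        using abs_tan_ge[of x] tan_gt_zero[of x] x False by simp
      then show ?thesis
        using c by (simp add: tan_def field_simps)
    next
      case True
      then show ?thesis
        by (simp only: cos_pi_half sin_pi_half)
    qed
    also have "\<dots> \<le> sin x * (1 + t)"
      using x t by (intro mult_left_mono sin_ge_zero) auto
    finally show ?thesis
      using 1 x by (simp add: csq_def snq_def x_def[symmetric] pos_le_divide_eq mult.commute)
  next
    case 2
    then show ?thesis
      using t by (simp add: csq_def snq_def)
  next
    case 3
    define x where "x = sqrt (- q)"
    have x: "0 < x" "x \<le> t"
      using 3 t by (auto simp: x_def intro: real_le_lsqrt)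
    have "x * exp (- x) \<le> sinh x * 1"
      using x sinh_ge_self[of x] by (intro mult_mono) auto
    then have "x * cosh x \<le> sinh x * (1 + x)"
      unfolding cosh_minus_sinh[symmetric] by (simp add: algebra_simps)
    also have "\<dots> \<le> sinh x * (1 + t)"
      using x by (intro mult_left_mono) auto
    finally show ?thesis
      using 3 x by (simp add: csq_def snq_def x_def[symmetric] pos_le_divide_eq mult.commute)
  qed
qed

text \<open>For given t the worst case is a = 0, \<open>|b| = d = pi/2 - t\<close>, where the chord
  becomes the plane. A trace leaves less room for b:
  \<open>a^2 \<le> (d - |b|) (d + |b|) \<le> (d - |b|) pi\<close>, which is the source of the term
  \<open>a^2 / pi\<close>.\<close>

lemma exponential_region:
  fixes a b t :: real
  assumes t: "0 \<le> t" and norm: "sqrt (a\<^sup>2 + b\<^sup>2) + t \<le> pi / 2"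
  defines "q \<equiv> b\<^sup>2 - t\<^sup>2"
  shows "\<bar>q\<bar> \<le> (pi / 2)\<^sup>2"
    and "snq q * t + snq q * \<T> * (a\<^sup>2 / pi) \<le> \<T> * (1 + csq q - snq q * \<bar>b\<bar>)"
proof -
  have b: "\<bar>b\<bar> \<le> sqrt (a\<^sup>2 + b\<^sup>2)"
    by (rule real_le_rsqrt) simp
  define d where "d = pi / 2 - t"
  have d: "\<bar>b\<bar> \<le> d" "d \<le> pi / 2" "0 \<le> d"
    using b norm t abs_ge_zero[of b] unfolding d_def by linarith+
  have a: "a\<^sup>2 \<le> (d - \<bar>b\<bar>) * pi"
  proof -
    have "a\<^sup>2 + b\<^sup>2 \<le> d\<^sup>2"
      using norm d by (intro sqrt_le_D) (simp add: d_def)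
    then have "a\<^sup>2 \<le> (d - \<bar>b\<bar>) * (d + \<bar>b\<bar>)"
      by (simp add: algebra_simps power2_eq_square)
    also have "\<dots> \<le> (d - \<bar>b\<bar>) * pi"
      using d by (intro mult_left_mono) auto
    finally show ?thesis .
  qed
  have "b\<^sup>2 \<le> (pi / 2)\<^sup>2" "t\<^sup>2 \<le> (pi / 2)\<^sup>2"
    using d t by (auto simp: abs_le_square_iff[symmetric] d_def)
  then show q: "\<bar>q\<bar> \<le> (pi / 2)\<^sup>2"
    using zero_le_power2[of b] zero_le_power2[of t] unfolding q_def abs_le_iff by linarith
  note S = snq_nonneg[OF q]
  \<comment> \<open>\<open>d^2 - t^2 = pi^2/4 - pi t\<close> is affine in t; this is why a chord in
    q yields a half-space.\<close>
  have "chord0 - chord1 * (d\<^sup>2 - t\<^sup>2) = (chord0 - chord1 * (pi / 2)\<^sup>2) + chord1 * (pi * t)"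
    by (simp add: d_def algebra_simps power2_eq_square)
  also have "\<dots> = d + t / \<T>"
    unfolding chord_ends using \<T>_pos by (simp add: chord1_def d_def field_simps)
  finally have chord: "chord0 - chord1 * (d\<^sup>2 - t\<^sup>2) = d + t / \<T>" .
  have "chord1 * b\<^sup>2 \<le> chord1 * d\<^sup>2"
    using chord_bounds d by (intro mult_left_mono) (auto simp: abs_le_square_iff[symmetric])
  then have "d + t / \<T> \<le> chord0 - chord1 * q"
    unfolding chord[symmetric] q_def by (simp add: algebra_simps)
  then have "snq q * (d + t / \<T>) \<le> snq q * (chord0 - chord1 * q)"
    using S by (intro mult_left_mono) auto
  also have "\<dots> \<le> 1 + csq q"
    by (rule snq_chord[OF q])
  finally have "\<T> * (snq q * (d + t / \<T>)) \<le> \<T> * (1 + csq q)"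
    using \<T>_pos by (intro mult_left_mono) auto
  then have "snq q * \<T> * d + snq q * t \<le> \<T> * (1 + csq q)"
    using \<T>_pos by (simp add: algebra_simps)
  moreover have "snq q * \<T> * (a\<^sup>2 / pi) \<le> snq q * \<T> * (d - \<bar>b\<bar>)"
    using S \<T>_pos a by (intro mult_left_mono) (auto simp: divide_le_eq)
  ultimately show "snq q * t + snq q * \<T> * (a\<^sup>2 / pi) \<le> \<T> * (1 + csq q - snq q * \<bar>b\<bar>)"
    by (simp add: algebra_simps)
qed

lemma cos_ge_quadratic: "1 - x\<^sup>2 / 2 \<le> cos (x :: real)"
proof -
  have "\<bar>sin (x / 2)\<bar>\<^sup>2 \<le> \<bar>x / 2\<bar>\<^sup>2"
    by (intro power_mono abs_sin_x_le_abs_x) simp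
  then show ?thesis
    using cos_double_sin[of "x / 2"] by (simp add: power_divide)
qed

text \<open>Here \<open>s\<close> plays the role of \<open>|v|\<close>.\<close>

definition separated :: "complex \<Rightarrow> real \<Rightarrow> bool" where
  "separated u s \<longleftrightarrow> 0 \<le> s \<and> s\<^sup>2 = (cmod u)\<^sup>2 - 1 \<and> 0 \<le> Re u \<and> s \<le> \<T> * (1 + Re u - \<bar>Im u\<bar>)"

text \<open>Since \<open>|\<delta>| \<le> 1/4\<close>, the rotation lowers
  \<open>Re u - |Im u|\<close> by at most \<open>|\<delta>| (9/8 Re u + |Im u|)\<close>, and the
  term \<open>a^2 / pi\<close> of the unrotated estimate pays for this.\<close>

lemma separated_exponential:
  fixes a b t \<delta> :: real
  assumes t: "0 \<le> t" and norm: "sqrt (a\<^sup>2 + b\<^sup>2) + t \<le> pi / 2" and \<delta>: "\<bar>\<delta>\<bar> \<le> a\<^sup>2 / 10"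
  defines "q \<equiv> b\<^sup>2 - t\<^sup>2"
  shows "separated (Complex (csq q) (snq q * b) * cis \<delta>) (snq q * t)"
proof -
  define x y s where "x = csq q" and "y = snq q * b" and "s = snq q * t"
  note q = exponential_region(1)[OF t norm, folded q_def]
  note S = snq_nonneg[OF q]
  have x0: "0 \<le> x" and s0: "0 \<le> s"
    using csq_nonneg[OF q] S t by (auto simp: x_def s_def)
  have y: "\<bar>y\<bar> = snq q * \<bar>b\<bar>"
    using S by (simp add: y_def abs_mult)
  have hyp: "x\<^sup>2 + y\<^sup>2 - s\<^sup>2 = 1"
    using csq_snq_pythagoras[of q] by (simp add: x_def y_def s_def q_def power_mult_distrib algebra_simps)
  have bt: "\<bar>b\<bar> + t \<le> pi / 2"
  proof -
    have "\<bar>b\<bar> \<le> sqrt (a\<^sup>2 + b\<^sup>2)"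
      by (rule real_le_rsqrt) simp
    then show ?thesis
      using norm by linarith
  qed
  have a2: "a\<^sup>2 \<le> (pi / 2)\<^sup>2"
  proof -
    have "\<bar>a\<bar> \<le> sqrt (a\<^sup>2 + b\<^sup>2)"
      by (rule real_le_rsqrt) simp
    then have "\<bar>a\<bar> \<le> \<bar>pi / 2\<bar>"
      using norm t pi_gt_zero by linarith
    then show ?thesis
      by (rule abs_le_square_iff[THEN iffD1])
  qed
  have pi: "pi < 3142 / 1000"
    using pi_approx by simp
  have "(pi / 2)\<^sup>2 \<le> (1571 / 1000)\<^sup>2"
    using pi by (intro power_mono) auto
  then have a3: "a\<^sup>2 \<le> 25 / 10"
    using a2 by (simp add: power2_eq_square)
  then have \<delta>4: "\<bar>\<delta>\<bar> \<le> 1 / 4"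
    using \<delta> by simp
  then have c: "0 < cos \<delta>"
    using pi_gt3 by (intro cos_gt_zero_pi) auto
  have sin_le: "\<bar>sin \<delta>\<bar> \<le> \<bar>\<delta>\<bar>"
    by (rule abs_sin_x_le_abs_x)
  have cos_ge: "1 - \<bar>\<delta>\<bar> / 8 \<le> cos \<delta>"
  proof -
    have "\<delta>\<^sup>2 = \<bar>\<delta>\<bar> * \<bar>\<delta>\<bar>"
      by (simp add: power2_eq_square)
    also have "\<dots> \<le> 1 / 4 * \<bar>\<delta>\<bar>"
      using \<delta>4 by (intro mult_right_mono) auto
    finally show ?thesis
      using cos_ge_quadratic[of \<delta>] by simp
  qed
  define x' y' where "x' = x * cos \<delta> - y * sin \<delta>" and "y' = x * sin \<delta> + y * cos \<delta>"
  have "x * (cos \<delta> - \<bar>sin \<delta>\<bar>) - \<bar>y\<bar> * (\<bar>sin \<delta>\<bar> + cos \<delta>) \<le> x' - \<bar>y'\<bar>"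
  proof -
    have "y * sin \<delta> \<le> \<bar>y\<bar> * \<bar>sin \<delta>\<bar>"
      by (simp flip: abs_mult)
    moreover have "\<bar>x * sin \<delta>\<bar> = x * \<bar>sin \<delta>\<bar>" "\<bar>y * cos \<delta>\<bar> = \<bar>y\<bar> * cos \<delta>"
      using x0 c by (simp_all add: abs_mult)
    then have "\<bar>y'\<bar> \<le> x * \<bar>sin \<delta>\<bar> + \<bar>y\<bar> * cos \<delta>"
      using abs_triangle_ineq[of "x * sin \<delta>" "y * cos \<delta>"] unfolding y'_def by linarith
    ultimately show ?thesis
      by (simp add: x'_def algebra_simps)
  qed
  moreover have "x * (1 - (9 / 8) * \<bar>\<delta>\<bar>) \<le> x * (cos \<delta> - \<bar>sin \<delta>\<bar>)"
    using sin_le cos_ge x0 by (intro mult_left_mono) auto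
  moreover have "\<bar>y\<bar> * (\<bar>sin \<delta>\<bar> + cos \<delta>) \<le> \<bar>y\<bar> * (1 + \<bar>\<delta>\<bar>)"
    using sin_le cos_le_one[of \<delta>] by (intro mult_left_mono; linarith)
  ultimately have rot: "x - \<bar>y\<bar> - \<bar>\<delta>\<bar> * ((9 / 8) * x + \<bar>y\<bar>) \<le> x' - \<bar>y'\<bar>"
    by (simp add: algebra_simps)
  have "\<bar>\<delta>\<bar> * ((9 / 8) * x + \<bar>y\<bar>) \<le> snq q * (a\<^sup>2 / pi)"
  proof -
    have "x \<le> snq q * (1 + t)"
      unfolding x_def using q t by (intro csq_le_snq) (auto simp: q_def)
    then have "(9 / 8) * x + \<bar>y\<bar> \<le> snq q * ((9 / 8) * (1 + t) + \<bar>b\<bar>)"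
      by (simp add: y algebra_simps)
    also have "\<dots> \<le> snq q * (10 / pi)"
    proof (rule mult_left_mono[OF _ S])
      \<comment> \<open>Here the angle a^2 / 10 is decided: \<open>9/8 (1 + pi/2)\<close>, about
        2.89, stays below \<open>10 / pi\<close>.\<close>
      have "(9 / 8) * (1 + t) + \<bar>b\<bar> \<le> (9 / 8) * (1 + 1571 / 1000)"
      proof -
        have "t + \<bar>b\<bar> \<le> 1571 / 1000"
          using bt pi by simp
        then show ?thesis
          using abs_ge_zero[of b] by (simp add: field_simps)
      qed
      also have "\<dots> \<le> 10 / (3142 / 1000)"
        by simp
      also have "\<dots> \<le> 10 / pi"
        using pi by (intro divide_left_mono) auto
      finally show "(9 / 8) * (1 + t) + \<bar>b\<bar> \<le> 10 / pi" .
    qed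
    finally have "\<bar>\<delta>\<bar> * ((9 / 8) * x + \<bar>y\<bar>) \<le> (a\<^sup>2 / 10) * (snq q * (10 / pi))"
      using \<delta> x0 by (intro mult_mono) auto
    then show ?thesis
      by (simp add: mult.commute)
  qed
  with rot have "x - \<bar>y\<bar> - snq q * (a\<^sup>2 / pi) \<le> x' - \<bar>y'\<bar>"
    by linarith
  then have "\<T> * (1 + (x - \<bar>y\<bar> - snq q * (a\<^sup>2 / pi))) \<le> \<T> * (1 + (x' - \<bar>y'\<bar>))"
    using \<T>_pos by (intro mult_left_mono) auto
  moreover have "s + snq q * \<T> * (a\<^sup>2 / pi) \<le> \<T> * (1 + x - \<bar>y\<bar>)"
    using exponential_region(2)[OF t norm] unfolding s_def x_def y q_def .
  ultimately have sep: "s \<le> \<T> * (1 + x' - \<bar>y'\<bar>)"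
    by (simp add: algebra_simps)
  have hyp': "x'\<^sup>2 + y'\<^sup>2 = s\<^sup>2 + 1"
  proof -
    have "x'\<^sup>2 + y'\<^sup>2 = (x\<^sup>2 + y\<^sup>2) * ((cos \<delta>)\<^sup>2 + (sin \<delta>)\<^sup>2)"
      unfolding x'_def y'_def by algebra
    then show ?thesis
      using hyp by simp
  qed
  \<comment> \<open>For \<open>x' < 0\<close> the half-space gives
    \<open>|x'| + |y'| \<le> 1\<close>, whereas \<open>x'^2 + y'^2 \<ge> 1\<close>. So
    \<open>y' = 0\<close>, and rotating back would make x negative.\<close>
  have "0 \<le> x'"
  proof (rule ccontr)
    assume neg: "\<not> 0 \<le> x'"
    have "0 \<le> \<T> * (1 + x' - \<bar>y'\<bar>)"
      using sep s0 by linarith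
    then have le1: "\<bar>x'\<bar> + \<bar>y'\<bar> \<le> 1"
      using \<T>_pos neg by (simp add: zero_le_mult_iff)
    then have "(\<bar>x'\<bar> + \<bar>y'\<bar>)\<^sup>2 \<le> 1"
      by (simp add: power_le_one)
    then have "x'\<^sup>2 + y'\<^sup>2 + 2 * (\<bar>x'\<bar> * \<bar>y'\<bar>) \<le> 1"
      by (simp add: power2_sum)
    then have "\<bar>x'\<bar> * \<bar>y'\<bar> \<le> 0"
      using hyp' zero_le_power2[of s] by linarith
    then have "y' = 0"
      using neg by (auto simp: mult_le_0_iff zero_le_mult_iff)
    moreover have "x = x' * cos \<delta> + y' * sin \<delta>"
    proof -
      have "x' * cos \<delta> + y' * sin \<delta> = x * ((cos \<delta>)\<^sup>2 + (sin \<delta>)\<^sup>2)"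
        unfolding x'_def y'_def by algebra
      then show ?thesis by simp
    qed
    ultimately have "x < 0"
      using neg c by (simp add: mult_neg_pos)
    then show False
      using x0 by simp
  qed
  moreover have "Complex (csq q) (snq q * b) * cis \<delta> = Complex x' y'"
    by (simp add: x'_def y'_def x_def y_def complex_eq_iff)
  ultimately show ?thesis
    using sep s0 hyp' unfolding separated_def by (simp add: cmod_power2 s_def)
qed

text \<open>Squaring the half-space condition with \<open>s^2 = x^2 + z^2 - 2 z\<close> and
  \<open>T^2 = \<kappa> / (\<kappa> + 2)\<close> gives the conic. For z < 0 one would get
  \<open>s > x\<close>, against \<open>s \<le> T (x + z) \<le> x\<close>.\<close>

lemma separated_feasible:
  assumes "separated u s"
  shows "feasible \<kappa> (Re u) (1 - \<bar>Im u\<bar>)" and "s \<le> \<T> * (Re u + (1 - \<bar>Im u\<bar>))"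
proof -
  define x z where "x = Re u" and "z = 1 - \<bar>Im u\<bar>"
  have s: "0 \<le> s" "0 \<le> x" "s \<le> \<T> * (x + z)"
    using assms by (auto simp: separated_def x_def z_def algebra_simps)
  then show "s \<le> \<T> * (Re u + (1 - \<bar>Im u\<bar>))"
    by (simp add: x_def z_def)
  have "s\<^sup>2 = x\<^sup>2 + \<bar>Im u\<bar>\<^sup>2 - 1"
    using assms by (simp add: separated_def cmod_power2 x_def)
  then have s2: "s\<^sup>2 = x\<^sup>2 + z\<^sup>2 - 2 * z"
    by (simp add: z_def power2_diff)
  have z1: "z \<le> 1"
    by (simp add: z_def)
  have z0: "0 \<le> z"
  proof (rule ccontr)
    assume neg: "\<not> 0 \<le> z"
    then have "x\<^sup>2 < s\<^sup>2"
      using s2 zero_le_power2[of z] by linarith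
    then have "x < s"
      using s by (intro power_less_imp_less_base[of x 2 s]) auto
    moreover have "\<T> * (x + z) \<le> 1 * x"
      using neg s \<T>_pos \<T>_less_1 by (intro order_trans[OF mult_left_mono[of "x + z" x \<T>]] mult_right_mono) auto
    ultimately show False
      using s by linarith
  qed
  have "z * z \<le> 1 * z"
    using z0 z1 by (intro mult_right_mono) auto
  then have "z\<^sup>2 \<le> x\<^sup>2"
    using s2 zero_le_power2[of s] by (simp add: power2_eq_square)
  then have zx: "z \<le> x"
    by (rule power2_le_imp_le[OF _ s(2)])
  have "s\<^sup>2 \<le> (\<T> * (x + z))\<^sup>2"
    using s by (intro power_mono) auto
  then have "x\<^sup>2 + z\<^sup>2 - 2 * z \<le> \<kappa> / (\<kappa> + 2) * (x + z)\<^sup>2"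
    by (simp only: s2 power_mult_distrib \<T>_sq)
  then have "(\<kappa> + 2) * (x\<^sup>2 + z\<^sup>2 - 2 * z) \<le> (\<kappa> + 2) * (\<kappa> / (\<kappa> + 2) * (x + z)\<^sup>2)"
    using \<kappa>_bounds by (intro mult_left_mono) auto
  also have "\<dots> = \<kappa> * (x + z)\<^sup>2"
    using \<kappa>_bounds by simp
  finally have "x\<^sup>2 + z\<^sup>2 - \<kappa> * x * z \<le> (\<kappa> + 2) * z"
    by (simp add: power2_sum algebra_simps power2_eq_square)
  then show "feasible \<kappa> (Re u) (1 - \<bar>Im u\<bar>)"
    using z0 z1 zx by (simp add: feasible_def x_def z_def)
qed

lemma disc_linear_bound:
  fixes u1 u2 U :: complex
  assumes U: "cmod (U - u1 * u2) \<le> s1 * s2" and re: "0 \<le> Re u1" "0 \<le> Re u2"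
    and coeff: "0 \<le> \<alpha>" "0 \<le> \<beta>" "0 \<le> N" "\<alpha>\<^sup>2 + \<beta>\<^sup>2 \<le> N\<^sup>2"
  shows "\<alpha> * \<bar>Im U\<bar> - \<beta> * Re U \<le> \<alpha> * (Re u1 * \<bar>Im u2\<bar> + Re u2 * \<bar>Im u1\<bar>)
     + \<beta> * (\<bar>Im u1\<bar> * \<bar>Im u2\<bar> - Re u1 * Re u2) + N * (s1 * s2)"
proof -
  define W where "W = U - u1 * u2"
  have UW: "U = u1 * u2 + W"
    by (simp add: W_def)
  have "\<alpha> * \<bar>Im W\<bar> - \<beta> * Re W \<le> N * cmod W"
  proof (rule power2_le_imp_le)
    have "(\<alpha> * \<bar>Im W\<bar> - \<beta> * Re W)\<^sup>2 + (\<alpha> * Re W + \<beta> * \<bar>Im W\<bar>)\<^sup>2 = (\<alpha>\<^sup>2 + \<beta>\<^sup>2) * ((Re W)\<^sup>2 + \<bar>Im W\<bar>\<^sup>2)"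
      by (simp add: algebra_simps power2_eq_square del: power2_abs)
    also have "\<dots> \<le> N\<^sup>2 * ((Re W)\<^sup>2 + \<bar>Im W\<bar>\<^sup>2)"
      using coeff by (intro mult_right_mono) auto
    also have "\<dots> = (N * cmod W)\<^sup>2"
      by (simp add: power_mult_distrib cmod_power2)
    finally show "(\<alpha> * \<bar>Im W\<bar> - \<beta> * Re W)\<^sup>2 \<le> (N * cmod W)\<^sup>2"
      using zero_le_power2[of "\<alpha> * Re W + \<beta> * \<bar>Im W\<bar>"] by linarith
  qed (use coeff in auto)
  also have "\<dots> \<le> N * (s1 * s2)"
    using U coeff by (intro mult_left_mono) (auto simp: W_def)
  finally have W: "\<alpha> * \<bar>Im W\<bar> - \<beta> * Re W \<le> N * (s1 * s2)" .
  have "\<bar>Im U\<bar> \<le> \<bar>Re u1 * Im u2\<bar> + \<bar>Im u1 * Re u2\<bar> + \<bar>Im W\<bar>"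
    unfolding UW by simp
  also have "\<dots> = Re u1 * \<bar>Im u2\<bar> + Re u2 * \<bar>Im u1\<bar> + \<bar>Im W\<bar>"
    using re by (simp add: abs_mult)
  finally have "\<alpha> * \<bar>Im U\<bar> \<le> \<alpha> * (Re u1 * \<bar>Im u2\<bar> + Re u2 * \<bar>Im u1\<bar> + \<bar>Im W\<bar>)"
    using coeff by (intro mult_left_mono) auto
  moreover have "- \<beta> * Re U \<le> \<beta> * (\<bar>Im u1\<bar> * \<bar>Im u2\<bar> - Re u1 * Re u2) - \<beta> * Re W"
  proof -
    have "Im u1 * Im u2 \<le> \<bar>Im u1\<bar> * \<bar>Im u2\<bar>"
      by (simp flip: abs_mult)
    then have "\<beta> * (Im u1 * Im u2) \<le> \<beta> * (\<bar>Im u1\<bar> * \<bar>Im u2\<bar>)"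
      using coeff by (intro mult_left_mono) auto
    then show ?thesis
      unfolding UW by (simp add: algebra_simps)
  qed
  ultimately show ?thesis
    using W by (simp add: algebra_simps)
qed

lemma separated_mult_le:
  assumes "separated u1 s1" "separated u2 s2"
  shows "s1 * s2 \<le> \<kappa> / (\<kappa> + 2) * ((Re u1 + (1 - \<bar>Im u1\<bar>)) * (Re u2 + (1 - \<bar>Im u2\<bar>)))"
proof -
  have "s1 * s2 \<le> (\<T> * (Re u1 + (1 - \<bar>Im u1\<bar>))) * (\<T> * (Re u2 + (1 - \<bar>Im u2\<bar>)))"
  proof (rule mult_mono[OF separated_feasible(2)[OF assms(1)] separated_feasible(2)[OF assms(2)]])
    show "0 \<le> s2" "0 \<le> \<T> * (Re u1 + (1 - \<bar>Im u1\<bar>))"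
      using assms separated_feasible(2)[OF assms(1)] by (auto simp only: separated_def intro: order_trans)
  qed
  then show ?thesis
    by (simp only: \<T>_sq[symmetric] power2_eq_square mult_ac)
qed

text \<open>The line is the tangent of the target conic at the point with parameter \<open>\<rho>\<close>.\<close>

lemma product_left_tangent:
  assumes sep: "separated u1 s1" "separated u2 s2" and U: "cmod (U - u1 * u2) \<le> s1 * s2"
    and \<rho>: "0 < \<rho>" "\<rho> * (\<kappa> + 1) \<le> 1"
  shows "\<rho> * (2 - \<kappa> * \<rho>) * \<bar>Im U\<bar> - (1 - \<rho>\<^sup>2) * Re U \<le> (1 - \<rho>\<^sup>2) + (\<kappa> + 2) * \<rho>\<^sup>2"
proof -
  define e where "e = \<rho> * (2 - \<kappa> * \<rho>)"
  \<comment> \<open>With \<open>A = 1 - \<rho>^2\<close>, the number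
    \<open>A + \<eta> = A + e^2 / (2 A)\<close> is the linearised upper bound for
    \<open>sqrt (A^2 + e^2)\<close>.\<close>
  define \<eta> where "\<eta> = e\<^sup>2 / (2 * (1 - \<rho>\<^sup>2))"
  note k = \<kappa>_bounds
  have "\<rho> * (5 / 2) \<le> \<rho> * (\<kappa> + 1)"
    using \<rho> k by (intro mult_left_mono) auto
  then have \<rho>4: "\<rho> \<le> 4 / 10"
    using \<rho> by linarith
  have "\<rho>\<^sup>2 \<le> (4 / 10)\<^sup>2"
    using \<rho> \<rho>4 by (intro power_mono) auto
  then have \<rho>2: "\<rho>\<^sup>2 \<le> 16 / 100"
    by (simp add: power2_eq_square)
  have k\<rho>: "0 \<le> \<kappa> * \<rho>" "\<kappa> * \<rho> \<le> 1"
    using \<rho> k by (auto simp: algebra_simps)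
  have e0: "0 \<le> e"
    using \<rho> k\<rho> by (simp add: e_def)
  have \<eta>0: "0 \<le> \<eta>"
    using \<rho>2 by (simp add: \<eta>_def)
  have "\<rho> * (4 + \<kappa> * \<kappa>) \<le> (4 / 10) * (4 + (15094 / 10000) * (15094 / 10000))"
    using \<rho> \<rho>4 k by (intro mult_mono add_left_mono) auto
  also have "\<dots> \<le> 4 * \<kappa>"
    using k by simp
  finally have "\<rho> * (\<rho> * (4 + \<kappa> * \<kappa>)) \<le> \<rho> * (4 * \<kappa>)"
    using \<rho> by (intro mult_left_mono) auto
  then have "(2 - \<kappa> * \<rho>)\<^sup>2 \<le> 4 * (1 - \<rho>\<^sup>2)"
    by (simp add: power2_diff) (simp add: algebra_simps power2_eq_square)
  then have "\<rho>\<^sup>2 * (2 - \<kappa> * \<rho>)\<^sup>2 \<le> \<rho>\<^sup>2 * (4 * (1 - \<rho>\<^sup>2))"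
    by (intro mult_left_mono) auto
  moreover have eq4: "\<rho>\<^sup>2 * (4 * (1 - \<rho>\<^sup>2)) = 2 * \<rho>\<^sup>2 * (2 * (1 - \<rho>\<^sup>2))"
    by simp
  ultimately have "e\<^sup>2 \<le> 2 * \<rho>\<^sup>2 * (2 * (1 - \<rho>\<^sup>2))"
    by (simp only: e_def power_mult_distrib eq4)
  then have \<eta>1: "\<eta> \<le> 2 * \<rho>\<^sup>2"
    using \<rho>2 by (simp add: \<eta>_def pos_divide_le_eq)
  have "e\<^sup>2 = 2 * (1 - \<rho>\<^sup>2) * \<eta>"
    using \<rho>2 by (simp add: \<eta>_def)
  then have N: "e\<^sup>2 + (1 - \<rho>\<^sup>2)\<^sup>2 \<le> (1 - \<rho>\<^sup>2 + \<eta>)\<^sup>2"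
    unfolding power2_sum[of "1 - \<rho>\<^sup>2" \<eta>] by simp
  have "e * \<bar>Im U\<bar> - (1 - \<rho>\<^sup>2) * Re U \<le> e * (Re u1 * \<bar>Im u2\<bar> + Re u2 * \<bar>Im u1\<bar>)
     + (1 - \<rho>\<^sup>2) * (\<bar>Im u1\<bar> * \<bar>Im u2\<bar> - Re u1 * Re u2) + (1 - \<rho>\<^sup>2 + \<eta>) * (s1 * s2)"
    by (rule disc_linear_bound[OF U]) (use sep e0 \<eta>0 \<rho>2 N in \<open>auto simp: separated_def\<close>)
  moreover have "(1 - \<rho>\<^sup>2 + \<eta>) * (s1 * s2) \<le> (1 - \<rho>\<^sup>2 + \<eta>) * (\<kappa> / (\<kappa> + 2) * ((Re u1 + (1 - \<bar>Im u1\<bar>)) * (Re u2 + (1 - \<bar>Im u2\<bar>))))"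
    using separated_mult_le[OF sep] \<eta>0 \<rho>2 by (intro mult_left_mono) auto
  moreover define z1 z2 where "z1 = 1 - \<bar>Im u1\<bar>" and "z2 = 1 - \<bar>Im u2\<bar>"
  have y: "\<bar>Im u1\<bar> = 1 - z1" "\<bar>Im u2\<bar> = 1 - z2"
    by (auto simp: z1_def z2_def)
  have "0 \<le> (\<kappa> + 2) * \<rho>\<^sup>2 - e * (Re u1 + Re u2) + (1 - \<rho>\<^sup>2) * (z1 + z2 + Re u1 * Re u2 - z1 * z2) + e * (Re u1 * z2 + Re u2 * z1)
     - (1 - \<rho>\<^sup>2 + \<eta>) * (\<kappa> / (\<kappa> + 2)) * ((Re u1 + z1) * (Re u2 + z2))"
    unfolding e_def z1_def z2_def using k \<rho> \<eta>0 \<eta>1 by (intro left_biaffine separated_feasible[OF sep(1)] separated_feasible[OF sep(2)]) auto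
  moreover have "(1 - \<rho>\<^sup>2) + (\<kappa> + 2) * \<rho>\<^sup>2 - (e * (Re u1 * (1 - z2) + Re u2 * (1 - z1))
     + (1 - \<rho>\<^sup>2) * ((1 - z1) * (1 - z2) - Re u1 * Re u2))
     = (\<kappa> + 2) * \<rho>\<^sup>2 - e * (Re u1 + Re u2) + (1 - \<rho>\<^sup>2) * (z1 + z2 + Re u1 * Re u2 - z1 * z2) + e * (Re u1 * z2 + Re u2 * z1)"
    by (simp add: algebra_simps)
  ultimately show ?thesis
    unfolding y e_def[symmetric] by (simp add: mult.assoc)
qed

lemma product_right_tangent:
  assumes sep: "separated u1 s1" "separated u2 s2" and U: "cmod (U - u1 * u2) \<le> s1 * s2"
  shows "\<bar>Im U\<bar> \<le> cosh (pi / 2) + (76 / 100) * Re U" and "\<bar>Im U\<bar> \<le> 53 / 10"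
proof -
  note f = separated_feasible(1)[OF sep(1)] separated_feasible(1)[OF sep(2)]
  note le = separated_mult_le[OF sep]
  have "1 * \<bar>Im U\<bar> - (76 / 100) * Re U \<le> 1 * (Re u1 * \<bar>Im u2\<bar> + Re u2 * \<bar>Im u1\<bar>)
     + (76 / 100) * (\<bar>Im u1\<bar> * \<bar>Im u2\<bar> - Re u1 * Re u2) + (12561 / 10000) * (s1 * s2)"
    by (rule disc_linear_bound[OF U]) (use sep in \<open>auto simp: separated_def power2_eq_square\<close>)
  moreover have "(12561 / 10000) * (s1 * s2) \<le> (12561 / 10000) * (\<kappa> / (\<kappa> + 2) * ((Re u1 + (1 - \<bar>Im u1\<bar>)) * (Re u2 + (1 - \<bar>Im u2\<bar>))))"
    using le by (intro mult_left_mono) auto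
  ultimately show "\<bar>Im U\<bar> \<le> cosh (pi / 2) + (76 / 100) * Re U"
    using right_biaffine(1)[OF \<kappa>_bounds f] unfolding mult.assoc by (simp add: cosh_pi_half)
  have "1 * \<bar>Im U\<bar> - 0 * Re U \<le> 1 * (Re u1 * \<bar>Im u2\<bar> + Re u2 * \<bar>Im u1\<bar>)
     + 0 * (\<bar>Im u1\<bar> * \<bar>Im u2\<bar> - Re u1 * Re u2) + 1 * (s1 * s2)"
    by (rule disc_linear_bound[OF U]) (use sep in \<open>auto simp: separated_def\<close>)
  then have "\<bar>Im U\<bar> \<le> Re u1 * \<bar>Im u2\<bar> + Re u2 * \<bar>Im u1\<bar> + s1 * s2"
    by simp
  moreover have "1 - (1 - x) = x" for x :: real
    by simp
  ultimately show "\<bar>Im U\<bar> \<le> 53 / 10"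
    using right_biaffine(2)[OF \<kappa>_bounds f] le by (simp only:)
qed

text \<open>The conic region is recovered from its tangents: the one at the arc point of height
  \<open>w = 1 + Re U\<close> bounds \<open>|Im U|\<close> by the abscissa of that point.\<close>

lemma product_left_region:
  assumes sep: "separated u1 s1" "separated u2 s2" and U: "cmod (U - u1 * u2) \<le> s1 * s2"
    and re: "- 1 < Re U" "Re U \<le> 0" and s: "s\<^sup>2 = (cmod U)\<^sup>2 - 1"
  shows "s \<le> \<T> * (1 + Re U + \<bar>Im U\<bar>)"
proof -
  define w y where "w = 1 + Re U" and "y = \<bar>Im U\<bar>"
  have w: "0 < w" "w \<le> 1"
    using re by (auto simp: w_def)
  note k = \<kappa>_bounds
  \<comment> \<open>A positive zero r of \<open>f\<close> is the parameter with
    \<open>r * arcx \<kappa> r = w\<close>.\<close>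
  define f where "f r = (\<kappa> + 2) * r\<^sup>2 - w * arcd \<kappa> r" for r
  have "\<exists>r. 0 \<le> r \<and> r \<le> 1 / (\<kappa> + 1) \<and> f r = 0"
  proof (rule IVT')
    show "f 0 \<le> 0"
      using w by (simp add: f_def arcd_def)
    have "arcd \<kappa> (1 / (\<kappa> + 1)) = (\<kappa> + 2) * (1 / (\<kappa> + 1))\<^sup>2"
    proof -
      have "\<kappa> + 1 \<noteq> 0" using k by simp
      then show ?thesis
        by (simp add: arcd_def divide_simps power2_eq_square)
    qed
    then have "f (1 / (\<kappa> + 1)) = (1 - w) * ((\<kappa> + 2) * (1 / (\<kappa> + 1))\<^sup>2)"
      unfolding f_def by (simp add: algebra_simps)
    then show "0 \<le> f (1 / (\<kappa> + 1))"
      using w k by simp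
    show "continuous_on {0..1 / (\<kappa> + 1)} f"
      unfolding f_def arcd_def by (intro continuous_intros)
  qed (use k in auto)
  then obtain r where r: "0 \<le> r" "r \<le> 1 / (\<kappa> + 1)" "f r = 0"
    by blast
  have "r \<noteq> 0"
    using r(3) w by (auto simp: f_def arcd_def)
  then have r0: "0 < r"
    using r by simp
  have wr: "w * arcd \<kappa> r = (\<kappa> + 2) * r\<^sup>2"
    using r(3) by (simp add: f_def)
  have rk: "r * (\<kappa> + 1) \<le> 1"
    using r(2) k by (simp add: pos_le_divide_eq)
  have "r * \<kappa> \<le> 1"
    using rk r0 by (simp add: algebra_simps)
  then have pos: "0 < 2 - \<kappa> * r"
    by (simp add: mult.commute)
  have "r * (2 - \<kappa> * r) * y \<le> (1 - r\<^sup>2) * w + (\<kappa> + 2) * r\<^sup>2"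
    using product_left_tangent[OF sep U r0 rk] by (simp add: w_def y_def algebra_simps)
  also have "\<dots> = w * (2 - \<kappa> * r)"
    unfolding wr[symmetric] by (simp add: arcd_def algebra_simps)
  finally have "(2 - \<kappa> * r) * (r * y) \<le> (2 - \<kappa> * r) * w"
    by (simp add: mult_ac)
  then have ry: "r * y \<le> w"
    using pos by simp
  \<comment> \<open>The quadratic expression of the conic is convex in y, nonpositive at y = 0 and
    zero at y = w / r; \<theta> is the position of y between the two.\<close>
  define \<theta> where "\<theta> = r * y / w"
  have y0: "0 \<le> y"
    by (simp add: y_def)
  have \<theta>: "0 \<le> \<theta>" "\<theta> \<le> 1" "r * y = \<theta> * w"
    using ry w r0 y0 by (auto simp: \<theta>_def)
  have "y\<^sup>2 + w\<^sup>2 - \<kappa> * y * w \<le> (\<kappa> + 2) * w"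
  proof -
    have "w * (w * arcd \<kappa> r) = w * ((\<kappa> + 2) * r\<^sup>2)"
      by (simp only: wr)
    then have arc: "w\<^sup>2 - \<kappa> * w\<^sup>2 * r + w\<^sup>2 * r\<^sup>2 = (\<kappa> + 2) * w * r\<^sup>2"
      by (simp add: arcd_def algebra_simps power2_eq_square)
    have "r\<^sup>2 * (y\<^sup>2 + w\<^sup>2 - \<kappa> * y * w - (\<kappa> + 2) * w) = (r * y)\<^sup>2 - \<kappa> * r * w * (r * y) + r\<^sup>2 * (w\<^sup>2 - (\<kappa> + 2) * w)"
      by (simp add: algebra_simps power2_eq_square)
    also have "\<dots> = \<theta>\<^sup>2 * w\<^sup>2 - \<theta> * (\<kappa> * w\<^sup>2 * r) + r\<^sup>2 * (w\<^sup>2 - (\<kappa> + 2) * w)"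
      unfolding \<theta>(3) by (simp add: algebra_simps power2_eq_square)
    also have "\<dots> \<le> \<theta> * w\<^sup>2 - \<theta> * (\<kappa> * w\<^sup>2 * r) + r\<^sup>2 * (w\<^sup>2 - (\<kappa> + 2) * w)"
    proof -
      have "\<theta>\<^sup>2 \<le> \<theta>"
        using \<theta> by (simp add: power2_eq_square mult_left_le)
      then have "\<theta>\<^sup>2 * w\<^sup>2 \<le> \<theta> * w\<^sup>2"
        by (intro mult_right_mono) auto
      then show ?thesis by linarith
    qed
    also have "\<dots> = \<theta> * (w\<^sup>2 - \<kappa> * w\<^sup>2 * r + w\<^sup>2 * r\<^sup>2 - (\<kappa> + 2) * w * r\<^sup>2) + (1 - \<theta>) * (r\<^sup>2 * (w\<^sup>2 - (\<kappa> + 2) * w))"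
      by (simp add: algebra_simps)
    also have "\<dots> = (1 - \<theta>) * (r\<^sup>2 * (w\<^sup>2 - (\<kappa> + 2) * w))"
      unfolding arc by simp
    also have "\<dots> \<le> 0"
    proof -
      have "w * w \<le> (\<kappa> + 2) * w"
        using w k by (intro mult_right_mono) auto
      then show ?thesis
        using \<theta> by (intro mult_nonneg_nonpos) (auto simp: power2_eq_square)
    qed
    finally have "r\<^sup>2 * (y\<^sup>2 + w\<^sup>2 - \<kappa> * y * w - (\<kappa> + 2) * w) \<le> 0" .
    then show ?thesis
      using r0 by (simp add: mult_le_0_iff)
  qed
  moreover have "s\<^sup>2 = y\<^sup>2 + w\<^sup>2 - 2 * w"
    using s by (simp add: cmod_power2 y_def w_def power2_sum)
  moreover have "(\<kappa> + 2) * (y\<^sup>2 + w\<^sup>2 - 2 * w) = \<kappa> * (y + w)\<^sup>2 + 2 * ((y\<^sup>2 + w\<^sup>2 - \<kappa> * y * w) - (\<kappa> + 2) * w)"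
    by (simp add: power2_sum algebra_simps)
  ultimately have "(\<kappa> + 2) * s\<^sup>2 \<le> \<kappa> * (y + w)\<^sup>2"
    by simp
  then have "s\<^sup>2 \<le> (\<T> * (w + y))\<^sup>2"
    using k by (simp add: power_mult_distrib \<T>_sq pos_le_divide_eq mult.commute add.commute)
  then show ?thesis
    unfolding w_def[symmetric] y_def[symmetric]
    by (rule power2_le_imp_le) (use w y0 \<T>_pos in auto)
qed

text \<open>As \<rho> tends to 0 the tangent inequality gives \<open>-1 \<le> Re U\<close>. In the
  case of equality, dividing by \<rho> before passing to the limit gives
  \<open>Im U = 0\<close>.\<close>

lemma product_boundary:
  assumes sep: "separated u1 s1" "separated u2 s2" and U: "cmod (U - u1 * u2) \<le> s1 * s2"
  shows "- 1 < Re U \<or> U = - 1"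
proof -
  note k = \<kappa>_bounds
  have bound: "(2 - \<kappa> * \<rho>) * (\<rho> * \<bar>Im U\<bar>) \<le> (1 - \<rho>\<^sup>2) * (1 + Re U) + (\<kappa> + 2) * \<rho>\<^sup>2" if "0 < \<rho>" "\<rho> \<le> 1 / 3" for \<rho>
  proof -
    have "\<rho> * (\<kappa> + 1) \<le> 1 / 3 * 3"
      using that k by (intro mult_mono) auto
    then show ?thesis
      using product_left_tangent[OF sep U that(1)] by (simp add: algebra_simps)
  qed
  have lim: "((\<lambda>\<rho>. (1 - \<rho>\<^sup>2) * (1 + Re U) + (\<kappa> + 2) * \<rho>\<^sup>2 - (2 - \<kappa> * \<rho>) * (\<rho> * \<bar>Im U\<bar>)) \<longlongrightarrow> (1 - 0\<^sup>2) * (1 + Re U) + (\<kappa> + 2) * 0\<^sup>2 - (2 - \<kappa> * 0) * (0 * \<bar>Im U\<bar>)) (at_right 0)"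
    by (intro tendsto_intros)
  have ev: "\<forall>\<^sub>F \<rho> in at_right 0. 0 < \<rho> \<and> \<rho> \<le> (1 / 3 :: real)"
    by (auto simp: eventually_at_right_field intro!: exI[of _ "1 / 3"])
  have "0 \<le> 1 + Re U"
    using tendsto_lowerbound[OF lim, of 0] eventually_mono[OF ev] bound by (force simp: trivial_limit_at_right_real)
  moreover have "Im U = 0" if "Re U = - 1"
  proof -
    have "(2 - \<kappa> * \<rho>) * \<bar>Im U\<bar> \<le> (\<kappa> + 2) * \<rho>" if "0 < \<rho>" "\<rho> \<le> 1 / 3" for \<rho>
      using bound[OF that] \<open>Re U = - 1\<close> that by (simp add: power2_eq_square mult_ac)
    moreover have lim': "((\<lambda>\<rho>. (\<kappa> + 2) * \<rho> - (2 - \<kappa> * \<rho>) * \<bar>Im U\<bar>) \<longlongrightarrow> (\<kappa> + 2) * 0 - (2 - \<kappa> * 0) * \<bar>Im U\<bar>) (at_right 0)"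
      by (intro tendsto_intros)
    ultimately have "0 \<le> (\<kappa> + 2) * 0 - (2 - \<kappa> * 0) * \<bar>Im U\<bar>"
      using eventually_mono[OF ev] by (intro tendsto_lowerbound[OF lim']) (force simp: trivial_limit_at_right_real)+
    then show ?thesis by simp
  qed
  ultimately show ?thesis
    by (auto simp: complex_eq_iff less_le)
qed

section \<open>Norm bounds for the logarithm\<close>

definition c0 :: real where "c0 = pi / 2 * exp (pi / 2)"

lemma c0_bounds: "75556 / 10000 < c0" "c0 < 756 / 100"
proof -
  have "(31415 / 20000) * (48102 / 10000) < pi / 2 * exp (pi / 2)"
    by (rule mult_strict_mono) (use pi_approx exp_pi_half_bounds in auto)
  then show "75556 / 10000 < c0"
    by (simp add: c0_def)
  have "pi / 2 * exp (pi / 2) < (31416 / 20000) * (48108 / 10000)"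
    by (rule mult_strict_mono) (use pi_approx exp_pi_half_bounds in auto)
  then show "c0 < 756 / 100"
    by (simp add: c0_def)
qed

lemma c0_pos: "0 < c0"
  using c0_bounds by linarith

lemma c0_sq: "57087 / 1000 \<le> c0\<^sup>2"
proof -
  have "(75556 / 10000)\<^sup>2 \<le> c0\<^sup>2"
    using c0_bounds by (intro power_mono) auto
  then show ?thesis
    by (simp add: power2_eq_square)
qed

lemma pi_bounds: "314159 / 100000 < pi" "pi < 31416 / 10000"
  using pi_approx by auto

lemma pi_sq: "pi\<^sup>2 \<le> 98697 / 10000"
proof -
  have "pi\<^sup>2 \<le> (31416 / 10000)\<^sup>2"
    using pi_bounds by (intro power_mono) auto
  then show ?thesis
    by (simp add: power2_eq_square)
qed

text \<open>The linear factor is the tangent of tan at pi/4.\<close>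

lemma sin_ge_cos_linear:
  assumes "pi / 4 \<le> h" "h \<le> pi / 2"
  shows "cos h * (1 + 2 * (h - pi / 4)) \<le> sin h"
proof -
  define g where "g h = sin h - cos h * (1 + 2 * (h - pi / 4))" for h :: real
  have "g (pi / 4) \<le> g h"
  proof (rule DERIV_nonneg_imp_nondecreasing[OF assms(1)])
    fix x assume x: "pi / 4 \<le> x" "x \<le> h"
    have "cos x \<le> sin x"
      using x assms sin_45 cos_45 sin_mono_le_eq[of "pi / 4" x] cos_mono_le_eq[of x "pi / 4"] by simp
    moreover have "sin x * 1 \<le> sin x * (1 + 2 * (x - pi / 4))"
      using x assms by (intro mult_left_mono sin_ge_zero) auto
    ultimately have "0 \<le> sin x * (1 + 2 * (x - pi / 4)) - cos x"
      by linarith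
    moreover have "(g has_real_derivative sin x * (1 + 2 * (x - pi / 4)) - cos x) (at x)"
      unfolding g_def by (rule derivative_eq_intros refl | simp)+
    ultimately show "\<exists>D. (g has_real_derivative D) (at x) \<and> 0 \<le> D"
      by blast
  qed
  then show ?thesis
    by (simp add: g_def sin_45 cos_45)
qed

text \<open>This encodes the bound \<open>c0\<close> for trace-free logarithms on the boundary of
  the left region. Equality holds at \<phi> = pi/2, the extremal pair, and the difference of the two
  sides increases from there.\<close>

lemma left_base:
  assumes \<phi>: "pi / 2 \<le> \<phi>" "\<phi> \<le> pi"
  shows "(exp (pi / 2) - 1) * (\<phi> * cos (\<phi> / 2)) \<le> (c0 - 2 * \<phi>\<^sup>2 / pi) * sin (\<phi> / 2)"
proof -
  define E where "E = exp (pi / 2)"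
  have E: "48102 / 10000 < E" "E < 48108 / 10000"
    using exp_pi_half_bounds by (auto simp: E_def)
  define A where "A = (E - 1) / 2 - 4 / pi"
  define F where "F x = (c0 - 2 * x\<^sup>2 / pi) * sin (x / 2) - (E - 1) * (x * cos (x / 2))" for x
  have pi_inv: "1 / pi \<le> 3184 / 10000" "1 / pi \<ge> 0"
    using pi_bounds by (auto simp: divide_le_eq)
  have A: "63 / 100 \<le> A"
  proof -
    have "4 / pi = 4 * (1 / pi)" "(E - 1) / 2 = E / 2 - 1 / 2"
      by (simp_all add: diff_divide_distrib)
    then show ?thesis
      using E pi_inv unfolding A_def by linarith
  qed
  have c0E: "c0 = pi / 2 * E"
    by (simp add: c0_def E_def)
  have "F (pi / 2) \<le> F \<phi>"
  proof (rule DERIV_nonneg_imp_nondecreasing[OF \<phi>(1)])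
    fix x assume x: "pi / 2 \<le> x" "x \<le> \<phi>"
    have c: "0 \<le> cos (x / 2)"
      using x \<phi> by (intro cos_ge_zero) auto
    have sc: "cos (x / 2) * (1 + (x - pi / 2)) \<le> sin (x / 2)"
      using sin_ge_cos_linear[of "x / 2"] x \<phi> by (simp add: algebra_simps)
    have E2: "E - 1 - pi / 4 * E \<le> 4 / 100"
    proof -
      have "E * (1 - pi / 4) \<le> (48108 / 10000) * (1 - (314159 / 100000) / 4)"
        using E pi_bounds by (intro mult_mono) auto
      then show ?thesis
        by (simp add: algebra_simps)
    qed
    have "E - 1 - pi / 4 * E + x\<^sup>2 / pi \<le> x * A * (1 + (x - pi / 2))"
    proof -
      have x2: "x\<^sup>2 / pi \<le> (3184 / 10000) * x\<^sup>2"
        using mult_right_mono[OF pi_inv(1), of "x\<^sup>2"] by simp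
      have "157 / 100 \<le> x"
        using x pi_bounds by simp
      then have x157: "(157 / 100) * x \<le> x\<^sup>2" "(157 / 100) \<le> x"
        by (auto simp: power2_eq_square intro!: mult_right_mono)
      have "x * (63 / 100) * (1 + (x - (15708 / 10000))) \<le> x * A * (1 + (x - pi / 2))"
        using A x157 pi_bounds x by (intro mult_mono mult_left_mono) auto
      moreover have "4 / 100 + (3184 / 10000) * x\<^sup>2 \<le> x * (63 / 100) * (1 + (x - (15708 / 10000)))"
      proof -
        have "x * (63 / 100) * (1 + (x - (15708 / 10000))) = (63 / 100) * x\<^sup>2 - (63 / 100) * (5708 / 10000) * x"
          by (simp add: field_simps power2_eq_square)
        then show ?thesis
          using x157 by linarith
      qed
      ultimately show ?thesis
        using x2 E2 by linarith
    qed
    then have "cos (x / 2) * (E - 1 - pi / 4 * E + x\<^sup>2 / pi) \<le> cos (x / 2) * (x * A * (1 + (x - pi / 2)))"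
      using c by (intro mult_left_mono) auto
    also have "\<dots> = x * A * (cos (x / 2) * (1 + (x - pi / 2)))"
      by simp
    also have "\<dots> \<le> x * A * sin (x / 2)"
    proof (rule mult_left_mono[OF sc])
      show "0 \<le> x * A"
        using A x pi_gt_zero by (intro mult_nonneg_nonneg; linarith)
    qed
    finally have "0 \<le> x * A * sin (x / 2) - cos (x / 2) * (E - 1 - pi / 4 * E + x\<^sup>2 / pi)"
      by simp
    moreover have "(F has_real_derivative x * A * sin (x / 2) - cos (x / 2) * (E - 1 - pi / 4 * E + x\<^sup>2 / pi)) (at x)"
      unfolding F_def A_def c0E by (rule derivative_eq_intros refl | simp)+ (simp add: algebra_simps add_divide_distrib diff_divide_distrib)
    ultimately show "\<exists>D. (F has_real_derivative D) (at x) \<and> 0 \<le> D"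
      by blast
  qed
  moreover have "F (pi / 2) = 0"
    unfolding F_def c0E by (simp add: sin_45 cos_45 power2_eq_square field_simps)
  ultimately show ?thesis
    by (simp add: F_def E_def)
qed

text \<open>For n = Z + W one has \<open>2 Z = n + q / n\<close>, so this bounds n by
  \<open>c0\<close> along the line of slope 0.76. The difference of the two sides vanishes at 0 and
  at pi/2, and its derivative decreases.\<close>

lemma right_base:
  assumes \<phi>: "0 \<le> \<phi>" "\<phi> \<le> pi / 2"
  shows "2 * \<phi> * (cosh (pi / 2) + (76 / 100) * cos \<phi>) \<le> (c0 + \<phi>\<^sup>2 / c0) * sin \<phi>"
proof -
  define c where "c = cosh (pi / 2)"
  define f where "f x = (c0 + x\<^sup>2 / c0) * sin x - 2 * x * (c + (76 / 100) * cos x)" for x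
  define f' where "f' x = 2 * x / c0 * sin x + (c0 + x\<^sup>2 / c0) * cos x - 2 * c - (152 / 100) * cos x + (152 / 100) * x * sin x" for x
  have "0 \<le> f \<phi>"
  proof (rule nonneg_between_zeros[of f 0 "pi / 2" "\<lambda>_. 1" f'])
    have "(pi / 2)\<^sup>2 / c0 = pi / 2 * exp (- (pi / 2))"
      by (simp add: c0_def power2_eq_square exp_minus field_simps)
    then have "f (pi / 2) = 0"
      by (simp add: f_def c_def cosh_def c0_def algebra_simps)
    then show "0 \<le> f (pi / 2)" by simp
    show "continuous_on {0..pi / 2} f"
      unfolding f_def using c0_pos by (intro continuous_intros) auto
    show "(f has_real_derivative 1 * f' x) (at x)" for x
      unfolding f_def f'_def using c0_pos by (auto intro!: derivative_eq_intros simp: algebra_simps add_divide_distrib diff_divide_distrib)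
    fix x y :: real assume xy: "0 < x" "x \<le> y" "y < pi / 2"
    show "f' y \<le> f' x"
    proof (rule DERIV_nonpos_imp_nonincreasing[OF xy(2)])
      fix z assume z: "x \<le> z" "z \<le> y"
      have c: "0 < cos z" and s: "0 \<le> sin z"
        using z xy by (auto intro!: cos_gt_zero_pi sin_ge_zero)
      have "z \<le> tan z"
        using abs_tan_ge[of z] tan_gt_zero[of z] z xy by simp
      then have zc: "z * cos z \<le> sin z"
        using c by (simp add: tan_def pos_le_divide_eq)
      have ic: "1 / c0 \<le> 14 / 100" "0 \<le> 1 / c0"
        using c0_bounds by (auto simp: divide_le_eq)
      have "(z * cos z) * (4 / c0 + 152 / 100) \<le> sin z * (4 / c0 + 152 / 100)"
        using zc c0_pos by (intro mult_right_mono) auto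
      moreover have "sin z * (2 / c0 - c0 - z\<^sup>2 / c0 + 304 / 100 + (4 / c0 + 152 / 100)) \<le> 0"
      proof (rule mult_nonneg_nonpos[OF s])
        have "0 \<le> z\<^sup>2 / c0"
          using c0_pos by simp
        moreover have "2 / c0 = 2 * (1 / c0)" "4 / c0 = 4 * (1 / c0)"
          by simp_all
        ultimately show "2 / c0 - c0 - z\<^sup>2 / c0 + 304 / 100 + (4 / c0 + 152 / 100) \<le> 0"
          using ic c0_bounds by linarith
      qed
      ultimately have "sin z * (2 / c0 - c0 - z\<^sup>2 / c0 + 304 / 100) + (z * cos z) * (4 / c0 + 152 / 100) \<le> 0"
        unfolding distrib_left[of "sin z" "2 / c0 - c0 - z\<^sup>2 / c0 + 304 / 100"] by linarith
      moreover have "(f' has_real_derivative sin z * (2 / c0 - c0 - z\<^sup>2 / c0 + 304 / 100) + (z * cos z) * (4 / c0 + 152 / 100)) (at z)"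
        unfolding f'_def using c0_pos by (auto intro!: derivative_eq_intros simp: algebra_simps add_divide_distrib diff_divide_distrib)
      ultimately show "\<exists>D. (f' has_real_derivative D) (at z) \<and> D \<le> 0"
        by blast
    qed
  qed (use \<phi> in \<open>auto simp: f_def\<close>)
  then show ?thesis
    by (simp add: f_def c_def)
qed

section \<open>Elementary bounds for hyperbolic functions and the sine\<close>

lemma sinh_ge_Taylor:
  assumes "0 \<le> x"
  shows "x + x ^ 3 / 6 + x ^ 5 / 120 \<le> sinh (x :: real)"
proof -
  have mono: "f 0 \<le> f x" if "\<And>z. (f has_real_derivative f' z) (at z)" "\<And>z. 0 \<le> z \<Longrightarrow> 0 \<le> f' z" "0 \<le> x"
    for f f' :: "real \<Rightarrow> real" and x
  proof (rule DERIV_nonneg_imp_nondecreasing[OF that(3)])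
    fix z :: real assume "0 \<le> z"
    then show "\<exists>D. (f has_real_derivative D) (at z) \<and> 0 \<le> D"
      using that(1,2) by blast
  qed
  have d2: "((\<lambda>x. cosh x - (1 + x\<^sup>2 / 2)) has_real_derivative sinh z - z) (at z)" for z :: real
    by (auto intro!: derivative_eq_intros)
  have d3: "((\<lambda>x. sinh x - (x + x ^ 3 / 6)) has_real_derivative cosh z - (1 + z\<^sup>2 / 2)) (at z)" for z :: real
    by (auto intro!: derivative_eq_intros)
  have d4: "((\<lambda>x. cosh x - (1 + x\<^sup>2 / 2 + x ^ 4 / 24)) has_real_derivative sinh z - (z + z ^ 3 / 6)) (at z)" for z :: real
    by (auto intro!: derivative_eq_intros)
  have d5: "((\<lambda>x. sinh x - (x + x ^ 3 / 6 + x ^ 5 / 120)) has_real_derivative cosh z - (1 + z\<^sup>2 / 2 + z ^ 4 / 24)) (at z)" for z :: real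
    by (auto intro!: derivative_eq_intros)
  have c2: "0 \<le> cosh x - (1 + x\<^sup>2 / 2)" if "0 \<le> x" for x :: real
    using mono[OF d2 _ that] sinh_ge_self by simp
  have s3: "0 \<le> sinh x - (x + x ^ 3 / 6)" if "0 \<le> x" for x :: real
    using mono[OF d3 c2 that] by simp
  have c4: "0 \<le> cosh x - (1 + x\<^sup>2 / 2 + x ^ 4 / 24)" if "0 \<le> x" for x :: real
    using mono[OF d4 s3 that] by simp
  show ?thesis
    using mono[OF d5 c4 assms] by simp
qed

lemma sinh_le_times_cosh:
  assumes "0 \<le> z"
  shows "sinh z \<le> z * cosh (z :: real)"
proof -
  have "0 * cosh 0 - sinh 0 \<le> z * cosh z - sinh z"
  proof (rule DERIV_nonneg_imp_nondecreasing[OF assms])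
    fix y :: real assume "0 \<le> y"
    then show "\<exists>D. ((\<lambda>z. z * cosh z - sinh z) has_real_derivative D) (at y) \<and> 0 \<le> D"
      by (intro exI[of _ "y * sinh y"]) (auto intro!: derivative_eq_intros)
  qed
  then show ?thesis by simp
qed

lemma cosh_times_le:
  assumes "0 \<le> x"
  shows "x * cosh x \<le> (1 + x\<^sup>2 / 3) * sinh (x :: real)"
proof -
  have "(1 + 0\<^sup>2 / 3) * sinh 0 - 0 * cosh 0 \<le> (1 + x\<^sup>2 / 3) * sinh x - x * cosh x"
  proof (rule DERIV_nonneg_imp_nondecreasing[OF assms])
    fix y :: real assume "0 \<le> y"
    then have "0 \<le> y / 3 * (y * cosh y - sinh y)"
      using sinh_le_times_cosh[of y] by (intro mult_nonneg_nonneg) auto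
    then show "\<exists>D. ((\<lambda>x. (1 + x\<^sup>2 / 3) * sinh x - x * cosh x) has_real_derivative D) (at y) \<and> 0 \<le> D"
      by (intro exI[of _ "y / 3 * (y * cosh y - sinh y)"])
        (auto intro!: derivative_eq_intros simp: field_simps power2_eq_square)
  qed
  then show ?thesis by simp
qed

lemma sin_ge_cubic: "0 \<le> x \<Longrightarrow> x - x ^ 3 / 6 \<le> sin (x :: real)"
proof -
  assume x: "0 \<le> x"
  have "sin 0 - (0 - 0 ^ 3 / 6) \<le> sin x - (x - x ^ 3 / 6)"
  proof (rule DERIV_nonneg_imp_nondecreasing[OF x])
    fix y :: real
    show "\<exists>D. ((\<lambda>x. sin x - (x - x ^ 3 / 6)) has_real_derivative D) (at y) \<and> 0 \<le> D"
      using cos_ge_quadratic[of y]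
      by (intro exI[of _ "cos y - (1 - y\<^sup>2 / 2)"]) (auto intro!: derivative_eq_intros)
  qed
  then show ?thesis by simp
qed

text \<open>Squaring \<open>sqrt (L^2 + Z^2) \<le> c - W\<close> and inserting
  \<open>Z^2 = q + W^2\<close> cancels W^2 and leaves a condition linear in W.\<close>

lemma norm_le_of_quadratic:
  fixes L Z W c q :: real
  assumes "0 < c" "Z\<^sup>2 - W\<^sup>2 = q" "2 * c * W \<le> c\<^sup>2 - q - L\<^sup>2" "W \<le> c"
  shows "sqrt (L\<^sup>2 + Z\<^sup>2) + W \<le> c"
proof -
  have "L\<^sup>2 + Z\<^sup>2 \<le> (c - W)\<^sup>2"
    using assms by (simp add: power2_diff algebra_simps)
  then have "sqrt (L\<^sup>2 + Z\<^sup>2) \<le> c - W"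
    using assms by (intro real_le_lsqrt) auto
  then show ?thesis by simp
qed

text \<open>Here \<open>x + \<i> y\<close> is the complex-linear part of a matrix of determinant one and \<open>s\<close> the norm of its antilinear
  part; \<open>\<delta>\<close> is the angle gained by the factors from the traces, whose sum is \<open>L\<close>.\<close>

lemma log_norm_left:
  fixes x y s L \<delta> q :: real
  assumes q: "q < pi\<^sup>2" "csq q = x" and x: "x \<le> 0" and y: "0 \<le> y" and s: "0 \<le> s" "s\<^sup>2 = x\<^sup>2 + y\<^sup>2 - 1"
    and \<delta>: "0 \<le> \<delta>" "\<delta> \<le> 1 / 2" and L: "L\<^sup>2 \<le> 20 * \<delta>" "\<bar>L\<bar> \<le> pi"
    and sep: "s \<le> \<T> * (1 + x + y * (1 - sin \<delta>))"
  shows "sqrt (L\<^sup>2 + (y / snq q)\<^sup>2) + s / snq q \<le> c0"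
proof -
  have q0: "(pi / 2)\<^sup>2 \<le> q"
  proof (rule ccontr)
    assume "\<not> (pi / 2)\<^sup>2 \<le> q"
    then have "csq ((pi / 2)\<^sup>2) < csq q"
      by (intro csq_strict_antimono) (auto intro!: power_mono)
    then show False
      using q x by (simp add: csq_def)
  qed
  define \<phi> where "\<phi> = sqrt q"
  have qpos: "0 < q"
    using q0 pi_gt_zero by (intro less_le_trans[OF _ q0]) simp
  have \<phi>: "\<phi>\<^sup>2 = q" "0 \<le> \<phi>"
    using qpos by (auto simp: \<phi>_def)
  have \<phi>1: "pi / 2 \<le> \<phi>"
    unfolding \<phi>_def using q0 by (intro real_le_rsqrt)
  have \<phi>2: "\<phi> < pi"
    unfolding \<phi>_def using q qpos by (intro real_less_lsqrt) auto
  define S where "S = snq q"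
  have S: "0 < S"
    unfolding S_def by (rule snq_pos[OF q(1)])
  define Z W where "Z = y / S" and "W = s / S"
  have Z: "0 \<le> Z" and W: "0 \<le> W"
    using y s S by (auto simp: Z_def W_def)
  have ZW: "Z\<^sup>2 - W\<^sup>2 = q"
  proof -
    have "Z\<^sup>2 - W\<^sup>2 = (y\<^sup>2 - s\<^sup>2) / S\<^sup>2"
      by (simp add: Z_def W_def power_divide diff_divide_distrib)
    also have "y\<^sup>2 - s\<^sup>2 = q * S\<^sup>2"
      using s csq_snq_pythagoras[of q] q by (simp add: S_def)
    finally show ?thesis
      using S by simp
  qed
  define P where "P = (1 + x) / S"
  have base: "2 * \<T> * P \<le> (1 - \<T>) * c0 - (1 + \<T>) * (q / c0)"
  proof -
    define E where "E = exp (pi / 2)"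
    have E: "0 < E" "1 < E"
      by (auto simp: E_def)
    have T: "\<T> = (E - 1) / (E + 1)"
      by (simp add: \<T>_eq E_def)
    have s2: "0 < sin (\<phi> / 2)"
      using \<phi>1 \<phi>2 pi_gt_zero by (intro sin_gt_zero) auto
    have c2: "0 < cos (\<phi> / 2)"
      using \<phi>1 \<phi>2 pi_gt_zero by (intro cos_gt_zero_pi) auto
    have "P = \<phi> * cos (\<phi> / 2) / sin (\<phi> / 2)"
    proof -
      have "sin \<phi> = 2 * sin (\<phi> / 2) * cos (\<phi> / 2)" "1 + cos \<phi> = 2 * cos (\<phi> / 2) * cos (\<phi> / 2)"
        using sin_double[of "\<phi> / 2"] cos_double_cos[of "\<phi> / 2"] by (auto simp: power2_eq_square)
      moreover have "P = (1 + cos \<phi>) / (sin \<phi> / \<phi>)"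
        using q qpos by (auto simp: P_def S_def csq_def snq_def \<phi>_def)
      ultimately have "P = (2 * cos (\<phi> / 2) * cos (\<phi> / 2)) / ((2 * sin (\<phi> / 2) * cos (\<phi> / 2)) / \<phi>)"
        by simp
      then show ?thesis
        using s2 c2 by simp
    qed
    then have "(E - 1) * P \<le> c0 - 2 * q / pi"
      using left_base[OF \<phi>1 less_imp_le[OF \<phi>2]] s2 unfolding \<phi>(1) E_def by (simp add: pos_divide_le_eq)
    moreover have "2 * q / pi = E * (q / c0)"
      by (simp add: c0_def E_def)
    ultimately have "2 * ((E - 1) * P) / (E + 1) \<le> 2 * (c0 - E * (q / c0)) / (E + 1)"
      using E by (intro divide_right_mono) auto
    moreover have "2 * \<T> * P = 2 * ((E - 1) * P) / (E + 1)"
      by (simp add: T)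
    moreover have "1 - \<T> = 2 / (E + 1)" "1 + \<T> = 2 * E / (E + 1)"
      using E by (auto simp: T field_simps)
    then have "(1 - \<T>) * c0 - (1 + \<T>) * (q / c0) = 2 * (c0 - E * (q / c0)) / (E + 1)"
      by (simp add: diff_divide_distrib right_diff_distrib mult_ac)
    ultimately show ?thesis
      by simp
  qed
  define \<sigma> where "\<sigma> = sin \<delta>"
  have \<sigma>: "0 \<le> \<sigma>"
    unfolding \<sigma>_def using \<delta> pi_gt3 by (intro sin_ge_zero) auto
  have "s / S \<le> \<T> * (1 + x + y * (1 - \<sigma>)) / S"
    using sep S unfolding \<sigma>_def by (intro divide_right_mono) auto
  then have "W \<le> \<T> * (P + Z * (1 - \<sigma>))"
    by (simp add: W_def P_def Z_def add_divide_distrib distrib_left)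
  then have W1: "W - \<T> * Z \<le> \<T> * P - \<T> * \<sigma> * Z"
    by (simp add: algebra_simps)
  define n where "n = Z + W"
  have Zpos: "0 < Z"
    using Z ZW qpos zero_le_power2[of W] by (cases "Z = 0") auto
  then have n: "0 < n"
    using W by (simp add: n_def)
  have "(Z - W) * n = q"
    using ZW by (simp add: n_def algebra_simps power2_eq_square)
  then have qn: "Z - W = q / n"
    using n by (simp add: eq_divide_eq)
  \<comment> \<open>The right side increases with n, so comparison with \<open>base\<close>, its
    counterpart at \<open>c0\<close>, bounds n, and the gain \<sigma> turns into slack
    \<open>c0 - n\<close>.\<close>
  have "2 * (W - \<T> * Z) = (1 - \<T>) * n - (1 + \<T>) * (q / n)"
    unfolding qn[symmetric] unfolding n_def by (simp add: algebra_simps)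
  then have gap: "2 * (\<T> * \<sigma> * Z) \<le> (1 - \<T>) * (c0 - n) + (1 + \<T>) * (q / n - q / c0)"
    using W1 base by (simp add: algebra_simps)
  have qd: "q / n - q / c0 = (c0 - n) * (q / (n * c0))"
    using n c0_pos by (simp add: field_simps)
  have gap2: "2 * (\<T> * \<sigma> * Z) \<le> (c0 - n) * ((1 - \<T>) + (1 + \<T>) * (q / (n * c0)))"
    using gap unfolding qd by (simp add: algebra_simps)
  have qnc: "0 \<le> q / (n * c0)"
    using qpos n c0_pos by simp
  have bracket: "0 < (1 - \<T>) + (1 + \<T>) * (q / (n * c0))"
    using \<T>_bounds qnc by (intro add_pos_nonneg mult_nonneg_nonneg) auto
  have nc: "n \<le> c0"
  proof -
    have "0 \<le> 2 * (\<T> * \<sigma> * Z)"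
      using \<sigma> Z \<T>_pos by simp
    then have "0 \<le> (c0 - n) * ((1 - \<T>) + (1 + \<T>) * (q / (n * c0)))"
      using gap2 by linarith
    then show ?thesis
      using bracket by (simp add: zero_le_mult_iff)
  qed
  have Lpi: "L\<^sup>2 \<le> pi\<^sup>2"
    using L(2) by (simp add: abs_le_square_iff[symmetric])
  \<comment> \<open>Below 6.2 the slack \<open>c0 - n\<close> alone beats pi^2. Otherwise
    \<open>Z \<ge> 3.1\<close>, and the gain forces \<open>c0 - n \<ge> 4.5 \<delta>\<close>, which
    times \<open>c0 > 5\<close> exceeds 20 \<delta>.\<close>
  have key: "L\<^sup>2 \<le> (c0 - n) * c0"
  proof (cases "n \<le> 62 / 10")
    case True
    have "(13556 / 10000) * (75556 / 10000) \<le> (c0 - n) * c0"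
      using True c0_bounds by (intro mult_mono) auto
    then show ?thesis
      using Lpi pi_sq by simp
  next
    case False
    have "Z \<ge> W"
      using qn qpos n by (smt (verit) divide_pos_pos)
    then have Z3: "31 / 10 \<le> Z"
      using False by (simp add: n_def)
    have "q / (n * c0) \<le> (98697 / 10000) / ((62 / 10) * (75556 / 10000))"
      using q(1) pi_sq False c0_bounds qpos by (intro frac_le mult_mono) auto
    also have "\<dots> \<le> 211 / 1000"
      by simp
    finally have "(1 + \<T>) * (q / (n * c0)) \<le> (1 + 656 / 1000) * (211 / 1000)"
      using \<T>_bounds qnc by (intro mult_mono) auto
    moreover have "(1 - \<T>) + B \<le> 7 / 10" if "B \<le> (1 + 656 / 1000) * (211 / 1000)" for B
      using that \<T>_bounds by simp
    ultimately have br: "(1 - \<T>) + (1 + \<T>) * (q / (n * c0)) \<le> 7 / 10"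
      by blast
    have "2 * ((655 / 1000) * \<sigma> * (31 / 10)) \<le> 2 * (\<T> * \<sigma> * Z)"
      using \<T>_bounds \<sigma> Z3 by (intro mult_left_mono mult_mono) auto
    also have "\<dots> \<le> (c0 - n) * (7 / 10)"
      using gap2 br nc by (intro order_trans[OF gap2] mult_left_mono) auto
    finally have g: "5 * \<sigma> \<le> c0 - n"
      using \<sigma> by simp
    have "\<delta> ^ 3 \<le> 1 / 4 * \<delta>"
    proof -
      have "\<delta> * \<delta> \<le> 1 / 2 * (1 / 2)"
        using \<delta> by (intro mult_mono) auto
      then have "(\<delta> * \<delta>) * \<delta> \<le> 1 / 4 * \<delta>"
        using \<delta> by (intro mult_right_mono) auto
      then show ?thesis
        by (simp add: power3_eq_cube)
    qed
    then have "(9 / 10) * \<delta> \<le> \<sigma>"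
      using sin_ge_cubic[OF \<delta>(1)] \<delta>(1) unfolding \<sigma>_def by simp
    then have "(9 / 2) * \<delta> \<le> c0 - n"
      using g by linarith
    then have "(9 / 2) * \<delta> * 5 \<le> (c0 - n) * c0"
      using \<delta> c0_bounds by (intro mult_mono) auto
    then show ?thesis
      using L \<delta> by linarith
  qed
  have "0 \<le> (c0 - n) * (Z - W)"
    using nc qn qpos n by (intro mult_nonneg_nonneg) (auto simp: qn)
  then have "L\<^sup>2 \<le> (c0 - n) * (c0 + (Z - W))"
    using key by (simp add: distrib_left)
  also have "\<dots> = (c0 - W)\<^sup>2 - Z\<^sup>2"
    by (simp add: n_def algebra_simps power2_eq_square)
  finally have "2 * c0 * W \<le> c0\<^sup>2 - q - L\<^sup>2"
    using ZW by (simp add: power2_diff)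
  moreover have "W \<le> c0"
    using nc Z by (simp add: n_def)
  ultimately show ?thesis
    using norm_le_of_quadratic[OF c0_pos ZW] by (simp add: Z_def W_def S_def)
qed

lemma rotation_gain:
  fixes \<delta> :: real
  assumes "0 \<le> \<delta>" "\<delta> \<le> 1 / 2"
  shows "1 + (45 / 100) * \<delta> \<le> cos \<delta> + (76 / 100) * sin \<delta>"
proof -
  have d2: "\<delta>\<^sup>2 \<le> 1 / 2 * \<delta>"
    unfolding power2_eq_square using assms by (intro mult_right_mono) auto
  have "\<delta> ^ 3 \<le> 1 / 4 * \<delta>"
  proof -
    have "\<delta> * \<delta> \<le> 1 / 2 * (1 / 2)"
      using assms by (intro mult_mono) auto
    then have "(\<delta> * \<delta>) * \<delta> \<le> 1 / 4 * \<delta>"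
      using assms by (intro mult_right_mono) auto
    then show ?thesis
      by (simp add: power3_eq_cube)
  qed
  then have "\<delta> * (23 / 24) \<le> sin \<delta>"
    using sin_ge_cubic[OF assms(1)] by simp
  then show ?thesis
    using cos_ge_quadratic[of \<delta>] d2 assms by simp
qed

text \<open>The line gives \<open>2 Z (1 + 0.45 \<delta>) \<le> c0 + q / c0\<close>. The extra
  factor absorbs the trace and leaves \<open>2 c0 Z \<le> c0^2 + q - L^2\<close>; with
  \<open>W^2 = Z^2 - q\<close> this becomes the bound on W that controls the norm.\<close>

lemma log_norm_right:
  fixes x y s L \<delta> q :: real
  assumes q: "csq q = x" "q \<le> pi\<^sup>2" and x: "0 \<le> x" "x \<le> 1" and y: "0 \<le> y" and s: "0 \<le> s" "s\<^sup>2 = x\<^sup>2 + y\<^sup>2 - 1"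
    and \<delta>: "0 \<le> \<delta>" "\<delta> \<le> 1 / 2" and L: "L\<^sup>2 \<le> 20 * \<delta>" "\<bar>L\<bar> \<le> pi"
    and line: "y * (1 + (45 / 100) * \<delta>) \<le> cosh (pi / 2) + (76 / 100) * x"
  shows "sqrt (L\<^sup>2 + (y / snq q)\<^sup>2) + s / snq q \<le> c0"
proof -
  have q0: "0 \<le> q"
  proof (rule ccontr)
    assume "\<not> 0 \<le> q"
    then have "csq 0 < csq q"
      by (intro csq_strict_antimono) auto
    then show False
      using q x by (simp add: csq_def)
  qed
  have q1: "q \<le> (pi / 2)\<^sup>2"
  proof (rule ccontr)
    assume "\<not> q \<le> (pi / 2)\<^sup>2"
    then have "csq q < csq ((pi / 2)\<^sup>2)"
      using q by (intro csq_strict_antimono) auto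
    then show False
      using q x by (simp add: csq_def)
  qed
  define \<phi> where "\<phi> = sqrt q"
  have \<phi>: "\<phi>\<^sup>2 = q" "0 \<le> \<phi>" "\<phi> \<le> pi / 2"
    unfolding \<phi>_def
  proof -
    show "sqrt q \<le> pi / 2"
      using q1 pi_gt_zero by (intro real_le_lsqrt) simp_all
  qed (use q0 in simp_all)
  define S where "S = snq q"
  have "(pi / 2)\<^sup>2 < pi\<^sup>2"
    using pi_gt_zero by (intro power_strict_mono) auto
  then have S: "0 < S"
    unfolding S_def using q1 by (intro snq_pos) simp
  define Z W where "Z = y / S" and "W = s / S"
  have Z: "0 \<le> Z" and W: "0 \<le> W"
    using y s S by (auto simp: Z_def W_def)
  have ZW: "Z\<^sup>2 - W\<^sup>2 = q"
  proof -
    have "Z\<^sup>2 - W\<^sup>2 = (y\<^sup>2 - s\<^sup>2) / S\<^sup>2"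
      by (simp add: Z_def W_def power_divide diff_divide_distrib)
    also have "y\<^sup>2 - s\<^sup>2 = q * S\<^sup>2"
      using s csq_snq_pythagoras[of q] q by (simp add: S_def)
    finally show ?thesis
      using S by simp
  qed
  define c where "c = cosh (pi / 2)"
  have base: "2 * (c + (76 / 100) * x) \<le> (c0 + q / c0) * S"
  proof (cases "q = 0")
    case True
    then show ?thesis
      using q cosh_pi_half_bounds c0_bounds by (simp add: csq_def snq_def S_def c_def)
  next
    case False
    then have \<phi>0: "0 < \<phi>" "0 < q"
      using q0 by (auto simp: \<phi>_def)
    have "\<phi> * (2 * (c + (76 / 100) * x)) \<le> \<phi> * ((c0 + q / c0) * S)"
      using right_base[OF \<phi>(2,3)] \<phi>0 q unfolding \<phi>(1) by (simp add: csq_def snq_def S_def c_def \<phi>_def[symmetric] mult_ac)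
    then show ?thesis
      using \<phi>0 by simp
  qed
  define R where "R = c0 + q / c0"
  have R: "c0 \<le> R"
    using q0 c0_pos by (simp add: R_def)
  have Lpi: "L\<^sup>2 \<le> pi\<^sup>2"
    using L(2) by (simp add: abs_le_square_iff[symmetric])
  \<comment> \<open>The part of the gain guaranteed by \<open>L^2 \<le> 20 \<delta>\<close>. It
    outweighs the trace because \<open>1 + g \<le> 0.0225 c0^2\<close>, where 0.0225 = 0.45 /
    20.\<close>
  define g where "g = (45 / 100) * (L\<^sup>2 / 20)"
  have g: "0 \<le> g" "g \<le> 2221 / 10000" "g \<le> (45 / 100) * \<delta>"
    using Lpi pi_sq L by (auto simp: g_def)
  have "2 * Z * (1 + g) \<le> 2 * Z * (1 + (45 / 100) * \<delta>)"
    using Z g by (intro mult_left_mono) auto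
  also have "\<dots> = 2 * (y * (1 + (45 / 100) * \<delta>)) / S"
    by (simp add: Z_def)
  also have "\<dots> \<le> 2 * (c + (76 / 100) * x) / S"
    using line S unfolding c_def by (intro divide_right_mono mult_left_mono) auto
  also have "\<dots> \<le> R"
    using base S unfolding R_def by (simp add: pos_divide_le_eq)
  also have "R \<le> (R - L\<^sup>2 / c0) * (1 + g)"
  proof -
    have "L\<^sup>2 / c0 * (1 + g) \<le> L\<^sup>2 / c0 * (12221 / 10000)"
      using g c0_pos by (intro mult_left_mono) auto
    also have "\<dots> \<le> g * c0"
    proof -
      have "L\<^sup>2 * (12221 / 10000) \<le> L\<^sup>2 * ((45 / 2000) * c0\<^sup>2)"
        using c0_sq by (intro mult_left_mono) auto
      then show ?thesis
        using c0_pos by (simp add: g_def pos_divide_le_eq power2_eq_square mult_ac)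
    qed
    also have "\<dots> \<le> g * R"
      using g R by (intro mult_left_mono) auto
    finally show ?thesis
      by (simp add: algebra_simps)
  qed
  finally have "2 * Z \<le> R - L\<^sup>2 / c0"
    using g by simp
  then have "c0 * (2 * Z) \<le> c0 * (R - L\<^sup>2 / c0)"
    using c0_pos by (intro mult_left_mono) auto
  then have Zle: "2 * c0 * Z \<le> c0\<^sup>2 + q - L\<^sup>2"
    using c0_pos by (simp add: R_def algebra_simps power2_eq_square)
  have q25: "q \<le> 2468 / 1000"
    using q1 pi_sq by (simp add: power_divide)
  have nonneg: "0 \<le> c0\<^sup>2 - q - L\<^sup>2"
    using c0_sq q25 Lpi pi_sq by linarith
  have "(2 * c0 * W)\<^sup>2 = (2 * c0 * Z)\<^sup>2 - 4 * c0\<^sup>2 * q"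
    unfolding ZW[symmetric] by (simp add: algebra_simps power2_eq_square)
  also have "\<dots> \<le> (c0\<^sup>2 + q - L\<^sup>2)\<^sup>2 - 4 * c0\<^sup>2 * q"
    using Zle Z c0_pos by (intro diff_right_mono power_mono) auto
  also have "\<dots> = (c0\<^sup>2 - q - L\<^sup>2)\<^sup>2 - 4 * (L\<^sup>2 * q)"
    by (simp add: algebra_simps power2_eq_square)
  also have "\<dots> \<le> (c0\<^sup>2 - q - L\<^sup>2)\<^sup>2"
    using q0 by simp
  finally have Wle: "2 * c0 * W \<le> c0\<^sup>2 - q - L\<^sup>2"
    using nonneg by (rule power2_le_imp_le)
  then have "2 * c0 * W \<le> 2 * c0\<^sup>2"
    using q0 zero_le_power2[of L] zero_le_power2[of c0] by linarith
  then have "W \<le> c0"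
    using c0_pos by (simp add: power2_eq_square)
  then show ?thesis
    using norm_le_of_quadratic[OF c0_pos ZW Wle] by (simp add: Z_def W_def S_def)
qed

text \<open>This case is away from the extremal pair. With \<open>q = - \<tau>^2\<close>,
  eliminating W reduces it to \<open>4 Z^2 + 2 (\<tau>^2 + L^2) \<le> c0^2\<close>, where
  \<open>\<tau> + |L| \<le> pi\<close>. For \<tau> \<ge> 2 the size of \<open>snq q\<close> makes Z
  small; otherwise the line does.\<close>

lemma log_norm_hyperbolic:
  fixes x y s L \<delta> q :: real
  assumes q: "csq q = x" "q < pi\<^sup>2" and x: "1 < x" and y: "0 \<le> y" "y \<le> 53 / 10" and s: "0 \<le> s" "s\<^sup>2 = x\<^sup>2 + y\<^sup>2 - 1"
    and \<delta>: "0 \<le> \<delta>" and L: "L\<^sup>2 \<le> 20 * \<delta>" "\<bar>L\<bar> \<le> pi" "x \<le> cosh (pi - \<bar>L\<bar>)"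
    and line: "y * (1 + (45 / 100) * \<delta>) \<le> cosh (pi / 2) + (76 / 100) * x"
  shows "sqrt (L\<^sup>2 + (y / snq q)\<^sup>2) + s / snq q \<le> c0"
proof -
  have q0: "q < 0"
  proof (rule ccontr)
    assume "\<not> q < 0"
    then have "csq q \<le> 1"
      by (simp add: csq_def)
    then show False
      using q x by simp
  qed
  define \<tau> where "\<tau> = sqrt (- q)"
  have \<tau>: "0 < \<tau>" "\<tau>\<^sup>2 = - q"
    using q0 by (auto simp: \<tau>_def)
  have xc: "x = cosh \<tau>"
    using q q0 by (simp add: csq_def \<tau>_def)
  have \<tau>L: "\<tau> \<le> pi - \<bar>L\<bar>"
    using L(2,3) \<tau> unfolding xc by (simp add: cosh_real_nonneg_le_iff)
  define S where "S = snq q"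
  have S: "0 < S"
    unfolding S_def by (rule snq_pos[OF q(2)])
  have S\<tau>: "S * \<tau> = sinh \<tau>"
    using q0 \<tau> by (simp add: S_def snq_def \<tau>_def)
  define Z W where "Z = y / S" and "W = s / S"
  have Z: "0 \<le> Z" and W: "0 \<le> W"
    using y s S by (auto simp: Z_def W_def)
  have ZW: "Z\<^sup>2 - W\<^sup>2 = q"
  proof -
    have "Z\<^sup>2 - W\<^sup>2 = (y\<^sup>2 - s\<^sup>2) / S\<^sup>2"
      by (simp add: Z_def W_def power_divide diff_divide_distrib)
    also have "y\<^sup>2 - s\<^sup>2 = q * S\<^sup>2"
      using s csq_snq_pythagoras[of q] q by (simp add: S_def)
    finally show ?thesis
      using S by simp
  qed
  have S_ge: "1 + \<tau>\<^sup>2 / 6 + \<tau> ^ 4 / 120 \<le> S"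
  proof -
    have "\<tau> * (1 + \<tau>\<^sup>2 / 6 + \<tau> ^ 4 / 120) \<le> \<tau> * S"
      using sinh_ge_Taylor[of \<tau>] \<tau> S\<tau> by (simp add: algebra_simps power2_eq_square power3_eq_cube eval_nat_numeral)
    then show ?thesis
      using \<tau> by simp
  qed
  have sum: "\<tau>\<^sup>2 + L\<^sup>2 \<le> pi\<^sup>2"
  proof -
    have "(\<tau> + \<bar>L\<bar>)\<^sup>2 \<le> pi\<^sup>2"
      using \<tau> \<tau>L by (intro power_mono) auto
    moreover have "0 \<le> \<tau> * \<bar>L\<bar>"
      using \<tau> by simp
    ultimately show ?thesis
      by (simp add: power2_sum)
  qed
  have main: "4 * Z\<^sup>2 + 2 * (\<tau>\<^sup>2 + L\<^sup>2) \<le> c0\<^sup>2"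
  proof (cases "2 \<le> \<tau>")
    case True
    have "2\<^sup>2 \<le> \<tau>\<^sup>2" "2 ^ 4 \<le> \<tau> ^ 4"
      using True by (intro power_mono; simp)+
    then have "18 / 10 \<le> S"
      using S_ge by simp
    then have "Z \<le> (53 / 10) / (18 / 10)"
      unfolding Z_def using y by (intro frac_le) auto
    then have "Z\<^sup>2 \<le> ((53 / 10) / (18 / 10))\<^sup>2"
      using Z by (intro power_mono) auto
    then show ?thesis
      using sum pi_sq c0_sq by (simp add: power_divide power2_eq_square)
  next
    case False
    define r where "r = \<tau>\<^sup>2"
    have "\<tau> * \<tau> \<le> 2 * 2"
      using False \<tau> by (intro mult_mono) auto
    then have r: "0 \<le> r" "r \<le> 4"
      by (auto simp: r_def power2_eq_square)
    have Sr: "1 + r / 6 \<le> S"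
      using S_ge \<tau> by (simp add: r_def) (smt (verit) zero_le_power divide_nonneg_nonneg)
    have xS: "x \<le> (1 + r / 3) * S"
    proof -
      have "\<tau> * x \<le> (1 + r / 3) * sinh \<tau>"
        using cosh_times_le[of \<tau>] \<tau>(1) unfolding xc r_def by simp
      also have "\<dots> = \<tau> * ((1 + r / 3) * S)"
        by (simp add: S\<tau>[symmetric])
      finally have "\<tau> * x \<le> \<tau> * ((1 + r / 3) * S)" .
      then show ?thesis
        using \<tau> by simp
    qed
    have cx: "cosh (pi / 2) + (76 / 100) * x \<le> (328 / 100) * S"
    proof -
      \<comment> \<open>The right side is concave in r, so the ends 0 and 4 decide; 3.28 leaves
        little room at either.\<close>
      have "25094 / 10000 \<le> (328 / 100 - (76 / 100) * (1 + r / 3)) * (1 + r / 6)"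
      proof -
        have "r * (4 - r) \<ge> 0"
          using r by simp
        then show ?thesis
          using r by (simp add: field_simps)
      qed
      also have "\<dots> \<le> (328 / 100 - (76 / 100) * (1 + r / 3)) * S"
        using r Sr by (intro mult_left_mono) auto
      finally have "25094 / 10000 + (76 / 100) * ((1 + r / 3) * S) \<le> (328 / 100) * S"
        by (simp add: field_simps)
      moreover have "cosh (pi / 2) + (76 / 100) * x \<le> (328 / 100) * S"
        if "25094 / 10000 + (76 / 100) * V \<le> (328 / 100) * S" "x \<le> V" for V
        using that cosh_pi_half_bounds by simp
      ultimately show ?thesis
        using xS by blast
    qed
    define g where "g = (45 / 100) * (L\<^sup>2 / 20)"
    have g: "0 \<le> g" "g \<le> (45 / 100) * \<delta>"
      using L by (auto simp: g_def)
    have "y * (1 + g) \<le> y * (1 + (45 / 100) * \<delta>)"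
      using g y by (intro mult_left_mono) auto
    then have "y * (1 + g) \<le> (328 / 100) * S"
      using line cx by linarith
    then have "y * (1 + g) / S \<le> 328 / 100"
      using S by (simp add: pos_divide_le_eq)
    then have Zg: "Z * (1 + g) \<le> 328 / 100"
      by (simp add: Z_def)
    show ?thesis
    \<comment> \<open>\<open>4 * 3.28^2 + 2 * 7\<close> is just below the lower bound for
      \<open>c0^2\<close>. Beyond 7 the trace must be large, and then the gain reduces Z by the
      factor 1.15.\<close>
    proof (cases "\<tau>\<^sup>2 + L\<^sup>2 \<le> 7")
      case True
      have "Z * 1 \<le> Z * (1 + g)"
        using Z g by (intro mult_left_mono) auto
      then have "Z\<^sup>2 \<le> (328 / 100)\<^sup>2"
        using Z Zg by (intro power_mono) auto
      then show ?thesis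
        using True c0_sq by (simp add: power2_eq_square)
    next
      case False2: False
      \<comment> \<open>0.56 is just above the smaller root of
        \<open>\<tau>^2 + (pi - \<tau>)^2 = 7\<close>.\<close>
      have "\<tau> < 56 / 100"
      proof (rule ccontr)
        assume "\<not> \<tau> < 56 / 100"
        then have "(\<tau> - 56 / 100) * (\<tau> - 2) \<le> 0"
          using False by (intro mult_nonneg_nonpos) auto
        moreover have "L\<^sup>2 \<le> (pi - \<tau>)\<^sup>2"
          using \<tau>L by (simp add: abs_le_square_iff[symmetric])
        moreover have "(pi - \<tau>)\<^sup>2 \<le> (31416 / 10000 - \<tau>)\<^sup>2"
          using False pi_bounds by (intro power_mono) auto
        ultimately have "\<tau>\<^sup>2 + L\<^sup>2 \<le> 7"
          using \<open>\<not> \<tau> < 56 / 100\<close> by (simp add: field_simps power2_eq_square)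
        then show False
          using False2 by simp
      qed
      then have "\<tau> * \<tau> \<le> (56 / 100) * (56 / 100)"
        using \<tau> by (intro mult_mono) auto
      then have "668 / 100 \<le> L\<^sup>2"
        using False2 by (simp add: power2_eq_square)
      then have "Z * (115 / 100) \<le> Z * (1 + g)"
        using Z by (intro mult_left_mono) (auto simp: g_def)
      then have "Z \<le> 2853 / 1000"
        using Zg by simp
      then have "Z\<^sup>2 \<le> (2853 / 1000)\<^sup>2"
        using Z by (intro power_mono) auto
      then show ?thesis
        using sum pi_sq c0_sq by (simp add: power2_eq_square)
    qed
  qed
  have nonneg: "0 \<le> c0\<^sup>2 - q - L\<^sup>2"
    using c0_sq q0 sum pi_sq \<tau> zero_le_power2[of \<tau>] by linarith
  have W2: "W\<^sup>2 = Z\<^sup>2 + \<tau>\<^sup>2"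
    using ZW \<tau> by simp
  have "(2 * c0 * W)\<^sup>2 = c0\<^sup>2 * (4 * Z\<^sup>2 + 4 * \<tau>\<^sup>2)"
    by (simp add: power_mult_distrib W2 algebra_simps)
  also have "\<dots> \<le> c0\<^sup>2 * (c0\<^sup>2 + 2 * (\<tau>\<^sup>2 - L\<^sup>2))"
    using main by (intro mult_left_mono) auto
  also have "\<dots> = (c0\<^sup>2 + (\<tau>\<^sup>2 - L\<^sup>2))\<^sup>2 - (\<tau>\<^sup>2 - L\<^sup>2)\<^sup>2"
    by (simp add: algebra_simps power2_eq_square)
  also have "\<dots> \<le> (c0\<^sup>2 - q - L\<^sup>2)\<^sup>2"
    using \<tau> by (simp add: algebra_simps)
  finally have Wle: "2 * c0 * W \<le> c0\<^sup>2 - q - L\<^sup>2"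
    using nonneg by (rule power2_le_imp_le)
  have "- q \<le> 98697 / 10000"
    using sum pi_sq \<tau> zero_le_power2[of L] by linarith
  then have "2 * c0 * W \<le> 2 * c0\<^sup>2"
    using Wle c0_sq zero_le_power2[of L] by linarith
  then have "W \<le> c0"
    using c0_pos by (simp add: power2_eq_square)
  then show ?thesis
    using norm_le_of_quadratic[OF c0_pos ZW Wle] by (simp add: Z_def W_def S_def)
qed

section \<open>Products of two exponentials\<close>

lemma snq_times_le_sinh:
  assumes t: "0 \<le> t" and q: "- t\<^sup>2 \<le> q" "q \<le> (pi / 2)\<^sup>2"
  shows "snq q * t \<le> sinh t"
proof -
  consider "q > 0" | "q = 0" | "q < 0" by linarith
  then show ?thesis
  proof cases
    case 1
    have "sin (sqrt q) \<le> sqrt q"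
      by (rule sin_x_le_x) (use 1 in simp)
    then have "snq q \<le> 1"
      using 1 by (simp add: snq_def)
    then have "snq q * t \<le> 1 * t"
      using t by (intro mult_right_mono) auto
    then show ?thesis
      using sinh_ge_self[OF t] by simp
  next
    case 2
    then show ?thesis
      using sinh_ge_self[OF t] by (simp add: snq_def)
  next
    case 3
    define x where "x = sqrt (- q)"
    have "sqrt (- q) \<le> t"
      by (rule real_le_lsqrt) (use t q in simp_all)
    then have x: "0 < x" "x \<le> t"
      using 3 by (simp_all add: x_def)
    have "sinh x / x \<le> sinh t / t"
    proof (rule DERIV_nonneg_imp_nondecreasing[of x t "\<lambda>x. sinh x / x", OF x(2)])
      fix z assume "x \<le> z" "z \<le> t"
      then have z: "0 < z" using x by simp
      then have "0 \<le> (cosh z * z - sinh z * 1) / (z * z)"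
        using sinh_le_times_cosh[of z] by (simp add: mult.commute)
      moreover have "((\<lambda>x. sinh x / x) has_real_derivative (cosh z * z - sinh z * 1) / (z * z)) (at z)"
        by (rule derivative_eq_intros refl)+ (use z in simp_all)
      ultimately show "\<exists>D. ((\<lambda>x. sinh x / x) has_real_derivative D) (at z) \<and> 0 \<le> D"
        by blast
    qed
    moreover have "snq q = sinh x / x"
      using 3 by (simp add: snq_def x_def)
    ultimately show ?thesis
      using x by (simp add: pos_le_divide_eq)
  qed
qed

text \<open>A vanishing \<open>csq\<close> forces \<open>b^2 - t^2 = (pi/2)^2\<close>, so b alone
  exhausts the norm bound.\<close>

lemma extremal_exponential:
  fixes a b t :: real
  assumes t: "0 \<le> t" and norm: "sqrt (a\<^sup>2 + b\<^sup>2) + t \<le> pi / 2" and zero: "csq (b\<^sup>2 - t\<^sup>2) = 0"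
  shows "a = 0" "\<bar>b\<bar> = pi / 2" "t = 0"
proof -
  have q: "\<bar>b\<^sup>2 - t\<^sup>2\<bar> \<le> (pi / 2)\<^sup>2"
    by (rule exponential_region(1)[OF t norm])
  have le: "(pi / 2)\<^sup>2 \<le> pi\<^sup>2"
    by (intro power_mono) auto
  have "csq ((pi / 2)\<^sup>2) = 0"
    by (simp add: csq_def)
  then have "csq (b\<^sup>2 - t\<^sup>2) = csq ((pi / 2)\<^sup>2)"
    by (simp only: zero)
  then have bt: "b\<^sup>2 - t\<^sup>2 = (pi / 2)\<^sup>2"
    by (rule csq_inj) (use q le in linarith)+
  have ab: "a\<^sup>2 + b\<^sup>2 \<le> (pi / 2)\<^sup>2"
  proof (rule sqrt_le_D)
    show "sqrt (a\<^sup>2 + b\<^sup>2) \<le> pi / 2"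
      using norm t by linarith
  qed
  have "a\<^sup>2 + t\<^sup>2 \<le> 0"
    using ab bt by linarith
  then show a: "a = 0" and t: "t = 0"
    by (simp_all add: sum_power2_le_zero_iff)
  have "\<bar>b\<bar>\<^sup>2 = (pi / 2)\<^sup>2"
    unfolding power2_abs using bt unfolding t by (simp only: power2_eq_square mult_zero_left diff_zero)
  then show "\<bar>b\<bar> = pi / 2"
    by (rule power2_eq_imp_eq) simp_all
qed

text \<open>The factors are \<open>exp (Re \<alpha>i)\<close> times \<open>z \<mapsto> ui z + vi cnj z\<close> with \<open>si = |vi|\<close>, and their product is \<open>exp L\<close> times
  \<open>z \<mapsto> U z + V cnj z\<close>; \<open>\<delta>\<close> is the total angle gained from the traces.\<close>

locale exp_pair =
  fixes \<alpha>1 \<beta>1 \<alpha>2 \<beta>2 :: complex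
  assumes norm1: "cmod \<alpha>1 + cmod \<beta>1 \<le> pi / 2" and norm2: "cmod \<alpha>2 + cmod \<beta>2 \<le> pi / 2"
begin

definition "q1 = (Im \<alpha>1)\<^sup>2 - (cmod \<beta>1)\<^sup>2"
definition "q2 = (Im \<alpha>2)\<^sup>2 - (cmod \<beta>2)\<^sup>2"
definition "u1 = Complex (csq q1) (snq q1 * Im \<alpha>1)"
definition "u2 = Complex (csq q2) (snq q2 * Im \<alpha>2)"
definition "s1 = snq q1 * cmod \<beta>1"
definition "s2 = snq q2 * cmod \<beta>2"
definition "U = u1 * u2 + of_real (snq q1) * \<beta>1 * cnj (of_real (snq q2) * \<beta>2)"
definition "V = u1 * (of_real (snq q2) * \<beta>2) + of_real (snq q1) * \<beta>1 * cnj u2"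
definition "L = Re \<alpha>1 + Re \<alpha>2"

lemma exp_product:
  "mexp (cmat \<alpha>1 \<beta>1) ** mexp (cmat \<alpha>2 \<beta>2) = cmat (of_real (exp L) * U) (of_real (exp L) * V)"
proof -
  have *: "mexp (cmat \<alpha> \<beta>) = cmat (of_real (exp (Re \<alpha>)) * Complex (csq ((Im \<alpha>)\<^sup>2 - (cmod \<beta>)\<^sup>2)) (snq ((Im \<alpha>)\<^sup>2 - (cmod \<beta>)\<^sup>2) * Im \<alpha>))
      (of_real (exp (Re \<alpha>)) * (of_real (snq ((Im \<alpha>)\<^sup>2 - (cmod \<beta>)\<^sup>2)) * \<beta>))" for \<alpha> \<beta>
    using mexp_cmat[of "Re \<alpha>" "Im \<alpha>" \<beta>] by simp
  show ?thesis
    unfolding * q1_def[symmetric] q2_def[symmetric] u1_def[symmetric] u2_def[symmetric] cmat_mult cmat_inject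
    by (simp add: U_def V_def L_def exp_add algebra_simps)
qed

lemma norms: "sqrt ((Re \<alpha>1)\<^sup>2 + (Im \<alpha>1)\<^sup>2) + cmod \<beta>1 \<le> pi / 2" "sqrt ((Re \<alpha>2)\<^sup>2 + (Im \<alpha>2)\<^sup>2) + cmod \<beta>2 \<le> pi / 2"
  using norm1 norm2 by (simp_all add: cmod_def)

lemma q_bounds: "\<bar>q1\<bar> \<le> (pi / 2)\<^sup>2" "\<bar>q2\<bar> \<le> (pi / 2)\<^sup>2"
  unfolding q1_def q2_def
  by (rule exponential_region(1)[OF norm_ge_zero norms(1)], rule exponential_region(1)[OF norm_ge_zero norms(2)])

lemma separated_rotated:
  assumes "\<bar>\<epsilon>\<bar> \<le> 1"
  shows "separated (u1 * cis (\<epsilon> * ((Re \<alpha>1)\<^sup>2 / 10))) s1" "separated (u2 * cis (\<epsilon> * ((Re \<alpha>2)\<^sup>2 / 10))) s2"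
proof -
  have *: "\<bar>\<epsilon> * (x\<^sup>2 / 10)\<bar> \<le> x\<^sup>2 / 10" for x :: real
    using mult_right_mono[OF assms, of "x\<^sup>2 / 10"] by (simp add: abs_mult)
  show "separated (u1 * cis (\<epsilon> * ((Re \<alpha>1)\<^sup>2 / 10))) s1"
    unfolding u1_def s1_def q1_def by (rule separated_exponential[OF norm_ge_zero norms(1) *])
  show "separated (u2 * cis (\<epsilon> * ((Re \<alpha>2)\<^sup>2 / 10))) s2"
    unfolding u2_def s2_def q2_def by (rule separated_exponential[OF norm_ge_zero norms(2) *])
qed

lemma separated_factors: "separated u1 s1" "separated u2 s2"
  using separated_rotated[of 0] by simp_all

definition "\<delta> = (Re \<alpha>1)\<^sup>2 / 10 + (Re \<alpha>2)\<^sup>2 / 10"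

lemma disc: "cmod (U - u1 * u2) \<le> s1 * s2"
  using snq_nonneg[OF q_bounds(1)] snq_nonneg[OF q_bounds(2)] by (simp add: U_def s1_def s2_def norm_mult)

lemma disc_rotated:
  "cmod (U * cis (\<epsilon> * \<delta>) - (u1 * cis (\<epsilon> * ((Re \<alpha>1)\<^sup>2 / 10))) * (u2 * cis (\<epsilon> * ((Re \<alpha>2)\<^sup>2 / 10)))) \<le> s1 * s2"
proof -
  have cis: "cis (\<epsilon> * \<delta>) = cis (\<epsilon> * ((Re \<alpha>1)\<^sup>2 / 10)) * cis (\<epsilon> * ((Re \<alpha>2)\<^sup>2 / 10))"
    by (simp add: \<delta>_def distrib_left cis_mult)
  have "U * cis (\<epsilon> * \<delta>) - (u1 * cis (\<epsilon> * ((Re \<alpha>1)\<^sup>2 / 10))) * (u2 * cis (\<epsilon> * ((Re \<alpha>2)\<^sup>2 / 10))) = (U - u1 * u2) * cis (\<epsilon> * \<delta>)"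
    unfolding cis by (simp add: algebra_simps)
  then show ?thesis
    using disc by (simp add: norm_mult)
qed

lemma det_factors: "(cmod u1)\<^sup>2 - s1\<^sup>2 = 1" "(cmod u2)\<^sup>2 - s2\<^sup>2 = 1"
  using separated_factors by (auto simp: separated_def)

lemma det_product: "(cmod U)\<^sup>2 - (cmod V)\<^sup>2 = 1"
proof -
  define v1 v2 where "v1 = of_real (snq q1) * \<beta>1" and "v2 = of_real (snq q2) * \<beta>2"
  have v: "cmod v1 = s1" "cmod v2 = s2"
    using snq_nonneg[OF q_bounds(1)] snq_nonneg[OF q_bounds(2)] by (auto simp: v1_def v2_def s1_def s2_def norm_mult)
  have "(cmod (u1 * u2 + v1 * cnj v2))\<^sup>2 - (cmod (u1 * v2 + v1 * cnj u2))\<^sup>2 = ((cmod u1)\<^sup>2 - (cmod v1)\<^sup>2) * ((cmod u2)\<^sup>2 - (cmod v2)\<^sup>2)"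
    unfolding cmod_power2 by (simp add: algebra_simps power2_eq_square)
  then show ?thesis
    using det_factors by (simp add: U_def V_def v1_def[symmetric] v2_def[symmetric] v)
qed

text \<open>If U = -1, the determinant gives V = 0, and multiplying by the inverse of the second
  factor gives \<open>u1 = - cnj u2\<close>. Both real parts are nonnegative, so they vanish, which
  singles out the extremal rotations.\<close>

lemma Re_U_gt:
  assumes "\<not> (\<beta>1 = 0 \<and> \<beta>2 = 0 \<and> \<alpha>1 = \<alpha>2 \<and> (\<alpha>1 = of_real (pi / 2) * \<i> \<or> \<alpha>1 = - of_real (pi / 2) * \<i>))"
  shows "- 1 < Re U"
proof (rule ccontr)
  assume "\<not> - 1 < Re U"
  then have U: "U = - 1"
    using product_boundary[OF separated_factors disc] by blast
  then have V: "V = 0"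
    using det_product by simp
  define v1 v2 where "v1 = of_real (snq q1) * \<beta>1" and "v2 = of_real (snq q2) * \<beta>2"
  have v2: "cmod v2 = s2"
    using snq_nonneg[OF q_bounds(2)] by (simp add: v2_def s2_def norm_mult)
  have "u2 * cnj u2 - v2 * cnj v2 = of_real ((cmod u2)\<^sup>2 - (cmod v2)\<^sup>2)"
    by (simp only: complex_norm_square of_real_diff)
  also have "\<dots> = 1"
    unfolding v2 det_factors by (rule of_real_1)
  finally have one: "u2 * cnj u2 - v2 * cnj v2 = 1" .
  have UV: "U = u1 * u2 + v1 * cnj v2" "V = u1 * v2 + v1 * cnj u2"
    by (simp_all only: U_def V_def v1_def v2_def)
  have "u1 * (u2 * cnj u2 - v2 * cnj v2) = U * cnj u2 - V * cnj v2"
    unfolding UV by (simp only: algebra_simps)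
  then have u12: "u1 = - cnj u2"
    unfolding one U V by simp
  then have "Re u1 = - Re u2"
    by simp
  moreover have "0 \<le> Re u1" "0 \<le> Re u2"
    using separated_factors by (simp_all add: separated_def)
  ultimately have "Re u1 = 0" "Re u2 = 0"
    by linarith+
  then have "csq q1 = 0" "csq q2 = 0"
    by (simp_all add: u1_def u2_def)
  note zero = this[unfolded q1_def q2_def]
  note ext = extremal_exponential[OF norm_ge_zero norms(1) zero(1)] extremal_exponential[OF norm_ge_zero norms(2) zero(2)]
  have "\<bar>Im \<alpha>1\<bar>\<^sup>2 = \<bar>Im \<alpha>2\<bar>\<^sup>2"
    by (simp only: ext)
  then have "(Im \<alpha>1)\<^sup>2 = (Im \<alpha>2)\<^sup>2"
    by (simp only: power2_abs)
  then have q12: "q1 = q2"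
    unfolding q1_def q2_def using ext(3,6) by simp
  have "0 < snq q2"
  proof (rule snq_pos)
    have "(pi / 2)\<^sup>2 < pi\<^sup>2"
      by (intro power_strict_mono) auto
    then show "q2 < pi\<^sup>2"
      using q_bounds(2) by linarith
  qed
  moreover have "snq q2 * Im \<alpha>1 = snq q2 * Im \<alpha>2"
    using arg_cong[OF u12, of Im] by (simp add: u1_def u2_def q12)
  ultimately have "Im \<alpha>1 = Im \<alpha>2"
    by simp
  moreover have "Im \<alpha>1 = pi / 2 \<or> Im \<alpha>1 = - (pi / 2)"
    using ext(2) by linarith
  ultimately have "\<alpha>1 = \<alpha>2 \<and> (\<alpha>1 = of_real (pi / 2) * \<i> \<or> \<alpha>1 = - of_real (pi / 2) * \<i>)"
    using ext(1,4) by (simp add: complex_eq_iff)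
  moreover have "\<beta>1 = 0 \<and> \<beta>2 = 0"
    using ext(3,6) by simp
  ultimately show False
    using assms by blast
qed

section \<open>Effect of the traces and the bound for the logarithm of the product\<close>

lemma Re_alpha_bounds: "\<bar>Re \<alpha>1\<bar> + cmod \<beta>1 \<le> pi / 2" "\<bar>Re \<alpha>2\<bar> + cmod \<beta>2 \<le> pi / 2"
  using norm1 norm2 abs_Re_le_cmod[of \<alpha>1] abs_Re_le_cmod[of \<alpha>2] by linarith+

lemma abs_L: "\<bar>L\<bar> \<le> pi - (cmod \<beta>1 + cmod \<beta>2)"
  using Re_alpha_bounds abs_triangle_ineq[of "Re \<alpha>1" "Re \<alpha>2"] unfolding L_def by linarith

lemma delta_bounds: "0 \<le> \<delta>" "\<delta> \<le> 1 / 2" "L\<^sup>2 \<le> 20 * \<delta>"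
proof -
  have "x\<^sup>2 \<le> 25 / 10" if "\<bar>x\<bar> + y \<le> pi / 2" "0 \<le> y" for x y :: real
  proof -
    have "\<bar>x\<bar>\<^sup>2 \<le> (15708 / 10000)\<^sup>2"
      using that pi_bounds by (intro power_mono) auto
    then show ?thesis
      by (simp add: power2_eq_square)
  qed
  from this[OF Re_alpha_bounds(1)] this[OF Re_alpha_bounds(2)] show "\<delta> \<le> 1 / 2"
    by (simp add: \<delta>_def)
  show "0 \<le> \<delta>"
    by (simp add: \<delta>_def)
  show "L\<^sup>2 \<le> 20 * \<delta>"
    using zero_le_power2[of "Re \<alpha>1 - Re \<alpha>2"] by (simp add: L_def \<delta>_def power2_eq_square algebra_simps)
qed

text \<open>The parts of each factor are at most cosh and sinh of \<open>cmod \<beta>i\<close>; the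
  addition theorem of cosh combines them, and \<open>abs_L\<close> bounds the resulting
  argument.\<close>

lemma norm_U_le: "cmod U \<le> cosh (pi - \<bar>L\<bar>)"
proof -
  have *: "snq q * t \<le> sinh t" if "0 \<le> t" "q = b\<^sup>2 - t\<^sup>2" "\<bar>q\<bar> \<le> (pi / 2)\<^sup>2" for q b t :: real
    using that by (intro snq_times_le_sinh) auto
  have s: "s1 \<le> sinh (cmod \<beta>1)" "s2 \<le> sinh (cmod \<beta>2)" "0 \<le> s1" "0 \<le> s2"
    unfolding s1_def s2_def using *[OF norm_ge_zero q1_def q_bounds(1)] *[OF norm_ge_zero q2_def q_bounds(2)]
      snq_nonneg[OF q_bounds(1)] snq_nonneg[OF q_bounds(2)] by auto
  have u: "cmod u \<le> cosh t" if "(cmod u)\<^sup>2 - s\<^sup>2 = 1" "s \<le> sinh t" "0 \<le> s" for u :: complex and s t :: real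
  proof (rule power2_le_imp_le)
    have "s\<^sup>2 \<le> (sinh t)\<^sup>2"
      using that by (intro power_mono) auto
    then show "(cmod u)\<^sup>2 \<le> (cosh t)\<^sup>2"
      using that cosh_square_eq[of t] by linarith
  qed simp
  have "cmod U \<le> cmod (U - u1 * u2) + cmod (u1 * u2)"
    using norm_triangle_ineq[of "U - u1 * u2" "u1 * u2"] by simp
  also have "\<dots> \<le> s1 * s2 + cmod u1 * cmod u2"
    using disc by (simp add: norm_mult)
  also have "\<dots> \<le> sinh (cmod \<beta>1) * sinh (cmod \<beta>2) + cosh (cmod \<beta>1) * cosh (cmod \<beta>2)"
    using s u[OF det_factors(1)] u[OF det_factors(2)] by (intro add_mono mult_mono) auto
  also have "\<dots> = cosh (cmod \<beta>1 + cmod \<beta>2)"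
    by (simp add: cosh_add)
  also have "\<dots> \<le> cosh (pi - \<bar>L\<bar>)"
    using abs_L norm_ge_zero[of \<beta>1] norm_ge_zero[of \<beta>2] by (intro cosh_real_nonneg_le_iff[THEN iffD2]; linarith)
  finally show ?thesis .
qed

text \<open>Rotating each factor by its share of \<delta> keeps it separated and rotates U by
  \<delta>. The line, applied to U turned away from the positive real axis, leaves U itself a slack
  proportional to \<delta>.\<close>

lemma rotated_right:
  assumes "0 \<le> Re U"
  shows "\<bar>Im U\<bar> * (1 + (45 / 100) * \<delta>) \<le> cosh (pi / 2) + (76 / 100) * Re U"
proof -
  define \<epsilon> :: real where "\<epsilon> = (if Im U \<ge> 0 then 1 else - 1)"
  have \<epsilon>: "\<bar>\<epsilon>\<bar> \<le> 1"
    by (simp add: \<epsilon>_def)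
  have "\<bar>Im (U * cis (\<epsilon> * \<delta>))\<bar> \<le> cosh (pi / 2) + (76 / 100) * Re (U * cis (\<epsilon> * \<delta>))"
    by (rule product_right_tangent(1)[OF separated_rotated[OF \<epsilon>] disc_rotated])
  moreover have "Re (U * cis (\<epsilon> * \<delta>)) = Re U * cos \<delta> - \<bar>Im U\<bar> * sin \<delta>"
    by (auto simp: \<epsilon>_def)
  moreover have "Re U * sin \<delta> + \<bar>Im U\<bar> * cos \<delta> \<le> \<bar>Im (U * cis (\<epsilon> * \<delta>))\<bar>"
    by (auto simp: \<epsilon>_def)
  ultimately have *: "Re U * sin \<delta> + \<bar>Im U\<bar> * (cos \<delta> + (76 / 100) * sin \<delta>) \<le> cosh (pi / 2) + (76 / 100) * (Re U * cos \<delta>)"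
    by (simp add: algebra_simps)
  have "\<bar>Im U\<bar> * (1 + (45 / 100) * \<delta>) \<le> \<bar>Im U\<bar> * (cos \<delta> + (76 / 100) * sin \<delta>)"
    using rotation_gain[OF delta_bounds(1,2)] by (intro mult_left_mono) auto
  moreover have "0 \<le> Re U * sin \<delta>"
    using assms delta_bounds pi_gt3 by (intro mult_nonneg_nonneg sin_ge_zero) auto
  moreover have "Re U * cos \<delta> \<le> Re U"
    using assms by (simp add: mult_left_le)
  ultimately show ?thesis
    using * by linarith
qed

text \<open>The target inequality is applied to U turned by \<delta> towards the negative real axis,
  and \<open>1 \<le> cos \<delta> + sin \<delta>\<close> carries it back to U.\<close>

lemma rotated_left:
  assumes "- 1 < Re U" "Re U \<le> 0"
  shows "cmod V \<le> \<T> * (1 + Re U + \<bar>Im U\<bar> * (1 - sin \<delta>))"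
proof -
  define \<epsilon> :: real where "\<epsilon> = (if Im U \<ge> 0 then 1 else - 1)"
  have \<epsilon>: "\<bar>\<epsilon>\<bar> \<le> 1" "\<epsilon> * Im U = \<bar>Im U\<bar>" "\<epsilon> * \<epsilon> = 1" "\<bar>\<epsilon>\<bar> = 1"
    by (auto simp: \<epsilon>_def)
  define x y where "x = Re U" and "y = \<bar>Im U\<bar>"
  have y: "0 \<le> y" by (simp add: y_def)
  have s\<delta>: "0 \<le> sin \<delta>" "sin \<delta> \<le> 1"
    using delta_bounds pi_gt3 by (auto intro: sin_ge_zero)
  have rot: "Re (U * cis (\<epsilon> * \<theta>)) = x * cos \<theta> - y * sin \<theta>" "\<bar>Im (U * cis (\<epsilon> * \<theta>))\<bar> = \<bar>x * sin \<theta> + y * cos \<theta>\<bar>" for \<theta>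
    by (auto simp: \<epsilon>_def x_def y_def)
  have sep: "separated (u1 * cis ((\<epsilon> * r) * ((Re \<alpha>1)\<^sup>2 / 10))) s1" "separated (u2 * cis ((\<epsilon> * r) * ((Re \<alpha>2)\<^sup>2 / 10))) s2"
    if "0 \<le> r" "r \<le> 1" for r
    using that by (intro separated_rotated; simp add: abs_mult \<epsilon>(4))+
  have trivial: ?thesis if "cmod U = 1"
  proof -
    have "V = 0"
      using det_product that by simp
    moreover have "0 \<le> 1 + Re U + \<bar>Im U\<bar> * (1 - sin \<delta>)"
    proof -
      have "0 \<le> \<bar>Im U\<bar> * (1 - sin \<delta>)"
        using s\<delta> by simp
      then show ?thesis
        using assms by linarith
    qed
    ultimately show ?thesis
      using \<T>_pos by simp
  qed
  have normU: "1 \<le> cmod U"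
  proof -
    have "1\<^sup>2 \<le> (cmod U)\<^sup>2"
      using det_product zero_le_power2[of "cmod V"] unfolding one_power2 by linarith
    then show ?thesis
      by (rule power2_le_imp_le) simp
  qed
  show ?thesis
  proof (cases "0 \<le> x * sin \<delta> + y * cos \<delta>")
    case False
    \<comment> \<open>If the rotation crosses the negative real axis, a smaller angle puts the
      product on it with \<open>Re U' \<le> -1\<close>. Only -1 is possible there, so
      \<open>|U| = 1\<close> and V = 0.\<close>
    define f where "f r = x * sin (r * \<delta>) + y * cos (r * \<delta>)" for r
    have "\<exists>r. 0 \<le> r \<and> r \<le> 1 \<and> f r = 0"
      by (rule IVT2') (use False y in \<open>auto simp: f_def intro!: continuous_intros\<close>)
    then obtain r where r: "0 \<le> r" "r \<le> 1" "f r = 0"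
      by blast
    define U' where "U' = U * cis ((\<epsilon> * r) * \<delta>)"
    have U': "\<bar>Im U'\<bar> = 0" "Re U' = x * cos (r * \<delta>) - y * sin (r * \<delta>)"
      using rot[of "r * \<delta>"] r(3) by (simp_all add: U'_def f_def mult.assoc)
    have r\<delta>: "0 \<le> r * \<delta>" "r * \<delta> \<le> 1 / 2"
      using r delta_bounds mult_mono[of r 1 \<delta> "1 / 2"] by auto
    have "x * cos (r * \<delta>) \<le> 0" "0 \<le> y * sin (r * \<delta>)"
      using r\<delta> pi_gt3 assms y by (auto simp: x_def intro!: mult_nonpos_nonneg mult_nonneg_nonneg cos_ge_zero sin_ge_zero)
    then have "Re U' \<le> 0"
      using U'(2) by linarith
    moreover have "cmod U' = cmod U"
      by (simp add: U'_def norm_mult)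
    moreover have "cmod U' = \<bar>Re U'\<bar>"
      using U'(1) by (simp add: cmod_def)
    ultimately have "Re U' \<le> - 1"
      using normU by simp
    moreover have "- 1 < Re U' \<or> U' = - 1"
      unfolding U'_def by (rule product_boundary[OF sep[OF r(1,2)] disc_rotated])
    ultimately have "cmod U = 1"
      using \<open>cmod U' = cmod U\<close> by auto
    then show ?thesis
      by (rule trivial)
  next
    case True
    define U' where "U' = U * cis (\<epsilon> * \<delta>)"
    have U': "\<bar>Im U'\<bar> = x * sin \<delta> + y * cos \<delta>" "Re U' = x * cos \<delta> - y * sin \<delta>"
      using rot[of \<delta>] True by (simp_all add: U'_def)
    have normU': "cmod U' = cmod U"
      by (simp add: U'_def norm_mult)
    have c\<delta>: "0 \<le> cos \<delta>"
      using delta_bounds pi_gt3 by (intro cos_ge_zero) auto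
    have bd: "- 1 < Re U' \<or> U' = - 1"
      unfolding U'_def by (rule product_boundary[OF separated_rotated[OF \<epsilon>(1)] disc_rotated])
    show ?thesis
    proof (cases "U' = - 1")
      case True
      then show ?thesis
        using normU' by (intro trivial) simp
    next
      case False
      have "x * cos \<delta> \<le> 0" "0 \<le> y * sin \<delta>"
        using c\<delta> s\<delta> assms y by (auto simp: x_def intro!: mult_nonpos_nonneg)
      then have re': "Re U' \<le> 0"
        using U'(2) by linarith
      have "cmod V \<le> \<T> * (1 + Re U' + \<bar>Im U'\<bar>)"
      proof (rule product_left_region[OF separated_rotated[OF \<epsilon>(1)] disc_rotated, folded U'_def])
        show "- 1 < Re U'"
          using False bd by blast
        show "Re U' \<le> 0"
          by (rule re')
        show "(cmod V)\<^sup>2 = (cmod U')\<^sup>2 - 1"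
          using det_product unfolding normU' by simp
      qed
      also have "\<dots> \<le> \<T> * (1 + x + y * (1 - sin \<delta>))"
      proof (rule mult_left_mono)
        have "1 \<le> cos \<delta> + sin \<delta>"
        proof -
          have "\<delta>\<^sup>2 \<le> 1 / 2 * \<delta>" "\<delta> ^ 3 \<le> 1 / 4 * \<delta>"
            using delta_bounds power_mono[of \<delta> "1 / 2" 2] mult_right_mono[of \<delta> "1 / 2" \<delta>] mult_right_mono[of "\<delta>\<^sup>2" "1 / 4" \<delta>]
            by (auto simp: power2_eq_square power3_eq_cube)
          then show ?thesis
            using cos_ge_quadratic[of \<delta>] sin_ge_cubic[OF delta_bounds(1)] delta_bounds(1) by linarith
        qed
        then have "x * (cos \<delta> + sin \<delta>) \<le> x * 1"
          using assms by (intro mult_left_mono_neg) (auto simp: x_def)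
        moreover have "y * cos \<delta> \<le> y * 1"
          using y by (intro mult_left_mono) auto
        ultimately show "1 + Re U' + \<bar>Im U'\<bar> \<le> 1 + x + y * (1 - sin \<delta>)"
          unfolding U' by (simp add: algebra_simps)
      qed (use \<T>_pos in simp)
      finally show ?thesis
        by (simp add: x_def y_def)
    qed
  qed
qed

lemma log_norm_le:
  assumes q: "q < pi\<^sup>2" "csq q = Re U"
  shows "sqrt (L\<^sup>2 + (Im U / snq q)\<^sup>2) + cmod V / snq q \<le> c0"
proof -
  have gt: "- 1 < Re U"
    using csq_strict_antimono[of q "pi\<^sup>2"] q by (simp add: csq_def)
  have s: "(cmod V)\<^sup>2 = (Re U)\<^sup>2 + \<bar>Im U\<bar>\<^sup>2 - 1"
    using det_product by (simp add: cmod_power2)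
  have Lpi: "\<bar>L\<bar> \<le> pi"
    using abs_L norm_ge_zero[of \<beta>1] norm_ge_zero[of \<beta>2] by linarith
  consider "Re U \<le> 0" | "0 \<le> Re U" "Re U \<le> 1" | "1 < Re U"
    by linarith
  then have "sqrt (L\<^sup>2 + (\<bar>Im U\<bar> / snq q)\<^sup>2) + cmod V / snq q \<le> c0"
  proof cases
    case 1
    then show ?thesis
      using s delta_bounds Lpi rotated_left[OF gt 1] by (intro log_norm_left[OF q]) auto
  next
    case 2
    then show ?thesis
      using s delta_bounds Lpi rotated_right[OF 2(1)] q by (intro log_norm_right[of q "Re U" "\<bar>Im U\<bar>" "cmod V" \<delta> L]) auto
  next
    case 3
    then have re: "0 \<le> Re U" by simp
    have "Re U \<le> cosh (pi - \<bar>L\<bar>)"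
      using norm_U_le complex_Re_le_cmod[of U] by linarith
    then show ?thesis
      using 3 s delta_bounds Lpi rotated_right[OF re] product_right_tangent(2)[OF separated_factors disc] q
      by (intro log_norm_hyperbolic[of q "Re U" "\<bar>Im U\<bar>" "cmod V" \<delta> L]) auto
  qed
  then show ?thesis
    by (simp add: power_divide)
qed

end

section \<open>The supremum and its attainment\<close>

theorem theorem9p2:
  shows "(\<forall>A B :: mat2. opnorm A \<le> pi / 2 \<and> opnorm B \<le> pi / 2 \<and>
            (A, B) \<notin> {((pi / 2) *\<^sub>R Itilde, (pi / 2) *\<^sub>R Itilde),
                         (- (pi / 2) *\<^sub>R Itilde, - (pi / 2) *\<^sub>R Itilde)}
            \<longrightarrow> (\<exists>!L. is_principal_log (mexp A ** mexp B) L))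
   \<and> Sup {opnorm (mlog (mexp A ** mexp B)) | A B :: mat2.
            opnorm A \<le> pi / 2 \<and> opnorm B \<le> pi / 2 \<and>
            (A, B) \<notin> {((pi / 2) *\<^sub>R Itilde, (pi / 2) *\<^sub>R Itilde),
                         (- (pi / 2) *\<^sub>R Itilde, - (pi / 2) *\<^sub>R Itilde)}}
     = pi / 2 * exp (pi / 2)"
proof -
  define adm :: "mat2 \<Rightarrow> mat2 \<Rightarrow> bool" where "adm A B \<longleftrightarrow> opnorm A \<le> pi / 2 \<and> opnorm B \<le> pi / 2 \<and>
            (A, B) \<notin> {((pi / 2) *\<^sub>R Itilde, (pi / 2) *\<^sub>R Itilde),
                         (- (pi / 2) *\<^sub>R Itilde, - (pi / 2) *\<^sub>R Itilde)}" for A B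
  have log: "\<exists>L. is_principal_log (mexp A ** mexp B) L \<and> opnorm L \<le> c0" if adm: "adm A B" for A B
  proof -
    obtain \<alpha>1 \<beta>1 where A: "A = cmat \<alpha>1 \<beta>1" by (rule cmat_exhaust)
    obtain \<alpha>2 \<beta>2 where B: "B = cmat \<alpha>2 \<beta>2" by (rule cmat_exhaust)
    interpret exp_pair \<alpha>1 \<beta>1 \<alpha>2 \<beta>2
      using adm by unfold_locales (simp_all add: adm_def A B opnorm_cmat)
    have I: "(pi / 2) *\<^sub>R Itilde = cmat (of_real (pi / 2) * \<i>) 0" "- (pi / 2) *\<^sub>R Itilde = cmat (- of_real (pi / 2) * \<i>) 0"
      by (simp_all add: Itilde_eq_cmat cmat_scaleR)
    have "- 1 < Re U"
      using adm unfolding adm_def A B I by (intro Re_U_gt) auto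
    then obtain q where q: "q < pi\<^sup>2" "csq q = Re U"
      by (rule csq_surj)
    let ?L = "cmat (Complex (ln (exp L)) (Im U / snq q)) (V / of_real (snq q))"
    have "is_principal_log (mexp A ** mexp B) ?L"
      unfolding A B exp_product by (rule principal_log_scaled_cmat[OF exp_gt_zero det_product q])
    moreover have "opnorm ?L \<le> c0"
      using log_norm_le[OF q] snq_pos[OF q(1)] by (simp add: opnorm_cmat norm_divide cmod_def[of "Complex _ _"])
    ultimately show ?thesis
      by blast
  qed
  have ex1: "\<exists>!L. is_principal_log (mexp A ** mexp B) L" if "adm A B" for A B
    using log[OF that] principal_log_cmat_unique by blast
  have le: "opnorm (mlog (mexp A ** mexp B)) \<le> c0" if "adm A B" for A B
    using log[OF that] mlog_eqI by metis
  define A0 B0 :: mat2 where "A0 = cmat (of_real (pi / 2) * \<i>) 0" and "B0 = cmat 0 (of_real (pi / 2))"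
  have sq: "(pi / 2)\<^sup>2 < pi\<^sup>2"
    by (intro power_strict_mono) auto
  have C: "csq ((pi / 2)\<^sup>2) = 0" "snq ((pi / 2)\<^sup>2) = 2 / pi"
    by (simp_all add: csq_def snq_def)
  have D: "csq (- (pi / 2)\<^sup>2) = cosh (pi / 2)" "snq (- (pi / 2)\<^sup>2) = sinh (pi / 2) / (pi / 2)"
    by (simp_all add: csq_def snq_def)
  have "A0 = cmat (Complex 0 (pi / 2)) 0"
    by (simp add: A0_def complex_eq_iff)
  then have expA: "mexp A0 = cmat \<i> 0"
    using mexp_cmat[of 0 "pi / 2" 0] C by (simp add: complex_eq_iff)
  have "B0 = cmat (Complex 0 0) (of_real (pi / 2))"
    by (simp add: B0_def complex_eq_iff)
  then have expB: "mexp B0 = cmat (of_real (cosh (pi / 2))) (of_real (sinh (pi / 2)))"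
    using mexp_cmat[of 0 0 "of_real (pi / 2)"] D by (simp add: complex_eq_iff norm_divide)
  \<comment> \<open>The product has trace zero, so \<open>q = (pi/2)^2\<close> and
    \<open>snq q = 2 / pi\<close>; the norm of its logarithm is then
    \<open>pi/2 (cosh (pi/2) + sinh (pi/2))\<close>.\<close>
  define u v :: complex where "u = Complex 0 (cosh (pi / 2))" and "v = Complex 0 (sinh (pi / 2))"
  have "mexp A0 ** mexp B0 = cmat (of_real 1 * u) (of_real 1 * v)"
    unfolding expA expB cmat_mult by (simp add: u_def v_def complex_eq_iff)
  moreover have "is_principal_log (cmat (of_real 1 * u) (of_real 1 * v))
      (cmat (Complex (ln 1) (Im u / snq ((pi / 2)\<^sup>2))) (v / of_real (snq ((pi / 2)\<^sup>2))))"
    by (rule principal_log_scaled_cmat[OF _ _ sq])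
      (simp_all add: u_def v_def C cmod_power2 hyperbolic_pythagoras)
  ultimately have "mlog (mexp A0 ** mexp B0) = cmat (Complex (ln 1) (Im u / snq ((pi / 2)\<^sup>2))) (v / of_real (snq ((pi / 2)\<^sup>2)))"
    by (simp add: mlog_eqI)
  then have "opnorm (mlog (mexp A0 ** mexp B0)) = pi / 2 * (cosh (pi / 2) + sinh (pi / 2))"
    by (simp add: opnorm_cmat u_def v_def C norm_divide cmod_def distrib_left mult.commute)
  then have val: "opnorm (mlog (mexp A0 ** mexp B0)) = c0"
    by (simp add: cosh_plus_sinh c0_def)
  have adm0: "adm A0 B0"
    by (simp add: adm_def A0_def B0_def opnorm_cmat Itilde_eq_cmat cmat_scaleR norm_mult)
  have "Sup {opnorm (mlog (mexp A ** mexp B)) | A B. adm A B} = c0"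
  proof (rule cSup_eq_maximum)
    show "c0 \<in> {opnorm (mlog (mexp A ** mexp B)) | A B. adm A B}"
      using val adm0 by force
  qed (use le in auto)
  then show ?thesis
    using ex1 unfolding adm_def c0_def by blast
qed

end
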